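(* There exists an arrangement $\mathcal{A}$ of finitely many hyperplanes in some $\mathbb{C}^{\ell}$ such that the characteristic variety $V_1(\mathcal{A})\subset(\mathbb{C}^* )^{|\mathcal{A}|}$ has a positive-dimensional irreducible component which does not pass through the origin $\mathbf{1}=(1,\dots,1)$ of the algebraic torus $(\mathbb{C}^* )^{|\mathcal{A}|}$.
   Context: Let $\mathcal{A}=\{H_1,\dots,H_n\}$ be an arrangement of hyperplanes in $\mathbb{C}^{\ell}$, $\ell\ge 2$, with complement $X=X(\mathcal{A})=\mathbb{C}^{\ell}\setminus\bigcup_{i=1}^n H_i$ and $G=\pi_1(X)$. Then $H_1(X,\mathbb{Z})\cong\mathbb{Z}^n$, with basis the classes of the (complex-oriented) meridians of $H_1,\dots,H_n$. A point $\mathbf{t}=(t_1,\dots,t_n)\in(\mathbb{C}^* )^n$ defines a character $G\to H_1(X,\mathbb{Z})\cong\mathbb{Z}^n\to\mathbb{C}^*$ sending the $i$-th meridian to $t_i$; let $\mathbb{C}_{\mathbf{t}}$ be the corresponding rank $1$ local system ($G$-module structure on $\mathbb{C}$). For $d\ge 0$, the $d$-th characteristic variety is the algebraic subvariety $$V_d(\mathcal{A})=\{\mathbf{t}\in(\mathbb{C}^* )^n \mid \dim_{\mathbb{C}}H^1(X,\mathbb{C}_{\mathbf{t}})\ge d\}.$$ *)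

theory Defs
  imports "HOL-Homology.Homology" "HOL-Library.Extended_Nat"
begin

section \<open>Hyperplane arrangements\<close>

text \<open>Since \<open>\<ell>\<close> is quantified inside the statement, \<open>\<complex>\<^sup>\<ell>\<close> is realised inside the type
  \<^typ>\<open>nat \<Rightarrow> complex\<close> (with its product topology) by the sequences vanishing from index \<open>\<ell>\<close> on,
  in the same way as the library's \<^const>\<open>Euclidean_space\<close>; on this set the product topology is
  the usual one.\<close>

definition cspace :: "nat \<Rightarrow> (nat \<Rightarrow> complex) set" where
  "cspace l = {x. \<forall>j\<ge>l. x j = 0}"

definition hyperplane :: "nat \<Rightarrow> (nat \<Rightarrow> complex) set \<Rightarrow> bool" where
  "hyperplane l P \<longleftrightarrow> (\<exists>a b. (\<exists>j<l. a j \<noteq> 0) \<and> P = {x \<in> cspace l. (\<Sum>j<l. a j * x j) = b})"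

definition hyperplane_arrangement :: "nat \<Rightarrow> nat \<Rightarrow> (nat \<Rightarrow> (nat \<Rightarrow> complex) set) \<Rightarrow> bool" where
  "hyperplane_arrangement l n H \<longleftrightarrow> inj_on H {..<n} \<and> (\<forall>i<n. hyperplane l (H i))"

definition complement :: "nat \<Rightarrow> nat \<Rightarrow> (nat \<Rightarrow> (nat \<Rightarrow> complex) set) \<Rightarrow> (nat \<Rightarrow> complex) set" where
  "complement l n H = cspace l - (\<Union>i<n. H i)"

text \<open>The complex-oriented meridians of \<open>H i\<close>: boundary circles, run through counterclockwise, of
  closed discs \<open>{q + z v | \<bar>z\<bar> \<le> 1}\<close> in a complex line which meet the arrangement in their centre
  only, this centre lying on \<open>H i\<close> and on no other hyperplane.\<close>

definition is_meridian ::
    "nat \<Rightarrow> nat \<Rightarrow> (nat \<Rightarrow> (nat \<Rightarrow> complex) set) \<Rightarrow> nat \<Rightarrow> (real \<Rightarrow> nat \<Rightarrow> complex) \<Rightarrow> bool" where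
  "is_meridian l n H i g \<longleftrightarrow> (\<exists>q \<in> cspace l. \<exists>v \<in> cspace l.
     (\<forall>z. cmod z \<le> 1 \<longrightarrow> (\<forall>k<n. (\<lambda>j. q j + z * v j) \<in> H k \<longleftrightarrow> k = i \<and> z = 0)) \<and>
     g = (\<lambda>s j. q j + exp (2 * complex_of_real pi * \<i> * complex_of_real s) * v j))"

section \<open>Cohomology with coefficients in a rank one local system\<close>

text \<open>A rank one local system of complex vector spaces on \<open>X\<close> is a representation of the fundamental
  groupoid. With every fibre identified with \<open>\<complex>\<close>, it is given by nonzero numbers \<open>L p\<close>, for
  paths \<open>p\<close> in \<open>X\<close>: multiplication by \<open>L p\<close> is the isomorphism from the fibre over
  \<^term>\<open>pathfinish p\<close> to the fibre over \<^term>\<open>pathstart p\<close>. On the loops at a base point, \<open>L\<close> is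
  the corresponding character of the fundamental group.\<close>

definition rank_one_local_system ::
    "'a::topological_space set \<Rightarrow> ((real \<Rightarrow> 'a) \<Rightarrow> complex) \<Rightarrow> bool" where
  "rank_one_local_system X L \<longleftrightarrow>
     (\<forall>p. path p \<and> path_image p \<subseteq> X \<longrightarrow> L p \<noteq> 0) \<and>
     (\<forall>p q. homotopic_paths X p q \<longrightarrow> L p = L q) \<and>
     (\<forall>p q. path p \<and> path_image p \<subseteq> X \<and> path q \<and> path_image q \<subseteq> X \<and> pathfinish p = pathstart q
        \<longrightarrow> L (p +++ q) = L p * L q)"

text \<open>Singular cochains with local coefficients: the value of a cochain on a singular simplex lies
  in the fibre over the image of the leading vertex, so the face opposite to this vertex has to be
  transported back along the edge joining vertices \<open>0\<close> and \<open>1\<close>.\<close>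

definition leading_edge :: "((nat \<Rightarrow> real) \<Rightarrow> 'a) \<Rightarrow> real \<Rightarrow> 'a" where
  "leading_edge f = (\<lambda>s. f (\<lambda>j. if j = 0 then 1 - s else if j = 1 then s else 0))"

definition twisted_coboundary ::
    "((real \<Rightarrow> 'a) \<Rightarrow> complex) \<Rightarrow> nat \<Rightarrow> (((nat \<Rightarrow> real) \<Rightarrow> 'a) \<Rightarrow> complex)
      \<Rightarrow> ((nat \<Rightarrow> real) \<Rightarrow> 'a) \<Rightarrow> complex" where
  "twisted_coboundary L p c f =
     L (leading_edge f) * c (singular_face (Suc p) 0 f)
     + (\<Sum>k = 1..Suc p. (- 1) ^ k * c (singular_face (Suc p) k f))"

text \<open>Cochains are total functions here, but cocycles and coboundaries below only depend on their
  values on singular simplices of \<open>X\<close>; as coboundaries are unconstrained elsewhere, the quotient of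
  the cocycles by the coboundaries is the usual cohomology.\<close>

definition twisted_cocycles ::
    "'a::topological_space set \<Rightarrow> ((real \<Rightarrow> 'a) \<Rightarrow> complex) \<Rightarrow> nat
      \<Rightarrow> (((nat \<Rightarrow> real) \<Rightarrow> 'a) \<Rightarrow> complex) set" where
  "twisted_cocycles X L p =
     {c. \<forall>f. singular_simplex (Suc p) (top_of_set X) f \<longrightarrow> twisted_coboundary L p c f = 0}"

definition twisted_coboundaries ::
    "'a::topological_space set \<Rightarrow> ((real \<Rightarrow> 'a) \<Rightarrow> complex) \<Rightarrow> nat
      \<Rightarrow> (((nat \<Rightarrow> real) \<Rightarrow> 'a) \<Rightarrow> complex) set" where
  "twisted_coboundaries X L p =
     {c. \<exists>b. \<forall>f. singular_simplex p (top_of_set X) f \<longrightarrow>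
           c f = (case p of 0 \<Rightarrow> 0 | Suc m \<Rightarrow> twisted_coboundary L m b f)}"

text \<open>\<open>dim H\<^sup>p(X; L) \<ge> d\<close>: there are \<open>d\<close> cocycles whose classes modulo coboundaries are linearly
  independent over \<open>\<complex>\<close>.\<close>

definition cohomology_dim_ge ::
    "'a::topological_space set \<Rightarrow> ((real \<Rightarrow> 'a) \<Rightarrow> complex) \<Rightarrow> nat \<Rightarrow> nat \<Rightarrow> bool" where
  "cohomology_dim_ge X L p d \<longleftrightarrow>
     (\<exists>c. (\<forall>i<d. c i \<in> twisted_cocycles X L p) \<and>
          (\<forall>a :: nat \<Rightarrow> complex.
             (\<lambda>f. \<Sum>i<d. a i * c i f) \<in> twisted_coboundaries X L p \<longrightarrow> (\<forall>i<d. a i = 0)))"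

section \<open>The algebraic torus and its Zariski topology\<close>

definition torus :: "nat \<Rightarrow> (nat \<Rightarrow> complex) set" where
  "torus n = {t. (\<forall>i<n. t i \<noteq> 0) \<and> (\<forall>i\<ge>n. t i = 0)}"

definition torus_one :: "nat \<Rightarrow> nat \<Rightarrow> complex" where
  "torus_one n = (\<lambda>i. if i < n then 1 else 0)"

text \<open>The regular functions on the torus are the Laurent polynomials.\<close>

inductive laurent_polynomial_fun :: "nat \<Rightarrow> ((nat \<Rightarrow> complex) \<Rightarrow> complex) \<Rightarrow> bool" for n where
  const: "laurent_polynomial_fun n (\<lambda>t. a)"
| coord: "i < n \<Longrightarrow> laurent_polynomial_fun n (\<lambda>t. t i)"
| inverse_coord: "i < n \<Longrightarrow> laurent_polynomial_fun n (\<lambda>t. inverse (t i))"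
| add: "laurent_polynomial_fun n f \<Longrightarrow> laurent_polynomial_fun n g
          \<Longrightarrow> laurent_polynomial_fun n (\<lambda>t. f t + g t)"
| mult: "laurent_polynomial_fun n f \<Longrightarrow> laurent_polynomial_fun n g
          \<Longrightarrow> laurent_polynomial_fun n (\<lambda>t. f t * g t)"

definition zariski_closed :: "nat \<Rightarrow> (nat \<Rightarrow> complex) set \<Rightarrow> bool" where
  "zariski_closed n Z \<longleftrightarrow>
     (\<exists>F. (\<forall>f\<in>F. laurent_polynomial_fun n f) \<and> Z = {t \<in> torus n. \<forall>f\<in>F. f t = 0})"

definition zariski_irreducible :: "nat \<Rightarrow> (nat \<Rightarrow> complex) set \<Rightarrow> bool" where
  "zariski_irreducible n S \<longleftrightarrow> S \<subseteq> torus n \<and> S \<noteq> {} \<and>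
     (\<forall>Y Z. zariski_closed n Y \<and> zariski_closed n Z \<and> S \<subseteq> Y \<union> Z \<longrightarrow> S \<subseteq> Y \<or> S \<subseteq> Z)"

definition irreducible_component ::
    "nat \<Rightarrow> (nat \<Rightarrow> complex) set \<Rightarrow> (nat \<Rightarrow> complex) set \<Rightarrow> bool" where
  "irreducible_component n V C \<longleftrightarrow> C \<subseteq> V \<and> zariski_irreducible n C \<and>
     (\<forall>D. D \<subseteq> V \<and> zariski_irreducible n D \<and> C \<subseteq> D \<longrightarrow> D = C)"

text \<open>Krull dimension of a nonempty subspace \<open>S\<close> of the torus: the supremum of the lengths \<open>k\<close> of
  chains \<open>Z 0 \<subset> \<dots> \<subset> Z k\<close> of irreducible relatively closed subsets of \<open>S\<close>.\<close>

definition zariski_dim :: "nat \<Rightarrow> (nat \<Rightarrow> complex) set \<Rightarrow> enat" where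
  "zariski_dim n S = Sup {enat k | k. \<exists>Z :: nat \<Rightarrow> (nat \<Rightarrow> complex) set.
     (\<forall>i\<le>k. zariski_irreducible n (Z i) \<and> (\<exists>Y. zariski_closed n Y \<and> Z i = S \<inter> Y)) \<and>
     (\<forall>i<k. Z i \<subset> Z (Suc i))}"

section \<open>Characteristic varieties\<close>

text \<open>The local system of \<open>t\<close> is the one with monodromy \<open>t i\<close> around \<open>H i\<close>. As the meridians
  generate the first homology group, it is unique up to isomorphism (rescaling of the fibres), and
  the dimension of its cohomology does not depend on the choice of \<open>L\<close>.\<close>

definition arrangement_local_system ::
    "nat \<Rightarrow> nat \<Rightarrow> (nat \<Rightarrow> (nat \<Rightarrow> complex) set) \<Rightarrow> (nat \<Rightarrow> complex)
      \<Rightarrow> ((real \<Rightarrow> nat \<Rightarrow> complex) \<Rightarrow> complex) \<Rightarrow> bool" where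
  "arrangement_local_system l n H t L \<longleftrightarrow>
     rank_one_local_system (complement l n H) L \<and>
     (\<forall>i<n. \<forall>g. is_meridian l n H i g \<longrightarrow> L g = t i)"

definition characteristic_variety ::
    "nat \<Rightarrow> nat \<Rightarrow> (nat \<Rightarrow> (nat \<Rightarrow> complex) set) \<Rightarrow> nat \<Rightarrow> (nat \<Rightarrow> complex) set" where
  "characteristic_variety l n H d =
     {t \<in> torus n. \<exists>L. arrangement_local_system l n H t L \<and>
        cohomology_dim_ge (complement l n H) L 1 d}"

end

theory Submission
  imports Defs "HOL-Complex_Analysis.Complex_Analysis"
begin

text \<open>The arrangement is the deleted \<open>B\<^sub>3\<close> arrangement of A. Suciu: the planes \<open>y\<close>, \<open>z\<close>, \<open>x \<plusminus> y\<close>,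
  \<open>x \<plusminus> z\<close>, \<open>y \<plusminus> z\<close> in \<open>\<complex>\<^sup>3\<close>, with the component
  \<open>(t\<^sup>2, t\<^sup>-\<^sup>2, -t\<^sup>-\<^sup>1, -t\<^sup>-\<^sup>1, t, t, -1, -1)\<close>. A cocycle with coefficients in a rank one local
  system is a flat bundle of affine lines, and it is a coboundary iff this bundle has a global flat
  section.

  Upper bound: let all \<open>t\<^sub>i \<noteq> 1\<close>. The meridians of a plane \<open>H\<close> have a unique fixed point in the affine
  fibre, which gives a flat section close to \<open>H\<close>; it extends over a codimension two stratum of \<open>H\<close>
  that is a normal crossing or along which the product of the \<open>t\<^sub>i\<close> differs from 1, because the
  central loop of the local group then has the same fixed point. If all but one of these strata are
  of this kind, project from the remaining one: a fibre close to \<open>H\<close> carries a flat section, which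
  spreads to all fibres. So a nontrivial cocycle forces enough of these products to be 1 to put \<open>t\<close>
  on the component.

  Lower bound: \<open>f = y\<^sup>2 (x\<^sup>2 - z\<^sup>2) / (z\<^sup>2 (x\<^sup>2 - y\<^sup>2))\<close> maps the complement to \<open>\<complex>\<^sup>*\<close> with the fibre over
  1 doubled, so that the sheets of \<open>sqrt (1 - f)\<close> can be told apart near the cut \<open>f \<le> 0\<close> with the help
  of local systems having monodromy \<open>-1\<close>; counting the crossings of this cut with weights in the
  local system gives a cocycle. It is nontrivial, since away from the cut a flat section must vanish
  by the monodromy \<open>-1\<close> around \<open>y = z\<close>.\<close>

section \<open>Affine systems on the path groupoid\<close>

text \<open>The deleted plane is x = 0; doubled, it is the fibre of \<open>f\<close> over 1 in the
  complement. So \<open>f\<close> maps to an orbifold, the punctured plane with a cone point of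
  order 2 at 1, whose group is the free product of Z and Z/2. Its characters that send the generator
  of Z/2 to -1 have a one-dimensional H^1, while those that send it to 1 have none in general. The
  curve consists of the pullbacks of the former, which is why it is a translate of a subtorus and
  misses the identity.

  Where some \<open>t i = 1\<close> nothing has to be known about the variety: this locus is closed
  and does not contain the curve, so an irreducible subset of the variety that contains the curve
  cannot lie in it. This is what limits the upper bound to points with all
  \<open>t i \<noteq> 1\<close>.

  The obstacle in the upper bound is that a meridian gives a fixed point only close to its plane.
  Everything is therefore phrased by transport along paths, without base points, and flat sections
  are moved by explicit deformations.\<close>

definition path_in :: "'a::topological_space set \<Rightarrow> (real \<Rightarrow> 'a) \<Rightarrow> bool" where
  "path_in X p \<longleftrightarrow> path p \<and> path_image p \<subseteq> X"

lemma path_in_iff: "path_in X p \<longleftrightarrow> continuous_on {0..1} p \<and> (\<forall>s\<in>{0..1}. p s \<in> X)"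
  by (auto simp: path_in_def path_def path_image_def)

lemma path_in_subset: "path_in S p \<Longrightarrow> S \<subseteq> T \<Longrightarrow> path_in T p"
  by (auto simp: path_in_def)

lemma path_in_join:
  "path_in S p \<Longrightarrow> path_in S q \<Longrightarrow> pathfinish p = pathstart q \<Longrightarrow> path_in S (p +++ q)"
  by (auto simp: path_in_def intro: subset_path_image_join[THEN subsetD])

lemma path_in_linepath: "convex S \<Longrightarrow> a \<in> S \<Longrightarrow> b \<in> S \<Longrightarrow> path_in S (linepath a b)"
  by (auto simp: path_in_def intro: closed_segment_subset[THEN subsetD])

lemma path_in_compose:
  assumes "path_in S p" "continuous_on S h" "h ` S \<subseteq> X"
  shows "path_in X (h \<circ> p)"
  using assms unfolding path_in_iff
  by (auto intro!: continuous_on_compose2[OF assms(2)])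

lemma homotopic_paths_convex_image:
  fixes K :: "'b::real_normed_vector set"
  assumes "convex K" "continuous_on K h" "h ` K \<subseteq> X"
    and "path_in K p" "path_in K q" "pathstart p = pathstart q" "pathfinish p = pathfinish q"
  shows "homotopic_paths X (h \<circ> p) (h \<circ> q)"
proof (rule homotopic_paths_continuous_image[of K])
  have pq: "path p" "path q" "path_image p \<subseteq> K" "path_image q \<subseteq> K"
    using assms by (auto simp: path_in_def)
  show "homotopic_paths K p q"
  proof (rule homotopic_paths_linear)
    fix t :: real assume "t \<in> {0..1}"
    then have "p t \<in> K" "q t \<in> K"
      using assms by (auto simp: path_in_iff)
    then show "closed_segment (p t) (q t) \<subseteq> K"
      using \<open>convex K\<close> by (rule closed_segment_subset)
  qed (use assms pq in auto)
qed (use assms in auto)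

text \<open>\<open>z \<mapsto> C p + L p * z\<close> is the transport of affine lines along
  \<open>p\<close>, from the fibre over the end of the path to the fibre over its start. The two
  join axioms say that these maps compose, so \<open>C\<close> is a crossed homomorphism on the path
  groupoid.\<close>

locale affine_system =
  fixes X :: "'a::topological_space set"
    and L C :: "(real \<Rightarrow> 'a) \<Rightarrow> complex"
  assumes L_nonzero: "path_in X p \<Longrightarrow> L p \<noteq> 0"
    and L_homotopic: "homotopic_paths X p q \<Longrightarrow> L p = L q"
    and C_homotopic: "homotopic_paths X p q \<Longrightarrow> C p = C q"
    and L_join: "path_in X p \<Longrightarrow> path_in X q \<Longrightarrow> pathfinish p = pathstart q \<Longrightarrow> L (p +++ q) = L p * L q"
    and C_join: "path_in X p \<Longrightarrow> path_in X q \<Longrightarrow> pathfinish p = pathstart q \<Longrightarrow>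
                   C (p +++ q) = C p + L p * C q"
begin

definition flat :: "'a set \<Rightarrow> ('a \<Rightarrow> complex) \<Rightarrow> bool" where
  "flat S s \<longleftrightarrow> (\<forall>p. path_in S p \<longrightarrow> s (pathstart p) = C p + L p * s (pathfinish p))"

lemma flatD: "flat S s \<Longrightarrow> path_in S p \<Longrightarrow> s (pathstart p) = C p + L p * s (pathfinish p)"
  by (simp add: flat_def)

lemma flat_subset: "flat S s \<Longrightarrow> T \<subseteq> S \<Longrightarrow> flat T s"
  using path_in_subset unfolding flat_def by blast

lemma L_cong: "path_in X p \<Longrightarrow> (\<And>s. s \<in> {0..1} \<Longrightarrow> p s = q s) \<Longrightarrow> L p = L q"
  by (intro L_homotopic homotopic_paths_eq) (auto simp: path_in_def)

lemma C_cong: "path_in X p \<Longrightarrow> (\<And>s. s \<in> {0..1} \<Longrightarrow> p s = q s) \<Longrightarrow> C p = C q"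
  by (intro C_homotopic homotopic_paths_eq) (auto simp: path_in_def)

lemma const_path:
  assumes "x \<in> X"
  shows "L (\<lambda>_. x) = 1" "C (\<lambda>_. x) = 0"
proof -
  let ?c = "\<lambda>_::real. x"
  have c: "path_in X ?c" "pathfinish ?c = pathstart ?c" "?c +++ ?c = ?c"
    unfolding path_in_iff using assms by (auto simp: pathfinish_def pathstart_def joinpaths_def)
  show "L ?c = 1"
    using L_join[of ?c ?c] L_nonzero[of ?c] c by simp
  then show "C ?c = 0"
    using C_join[of ?c ?c] c by simp
qed

text \<open>The unit square is convex, so its two boundary routes and its diagonal have homotopic
  images. The diagonal serves for loops that perform two independent motions at once.\<close>

lemma square:
  assumes h: "continuous_on ({0..1} \<times> {0..1}) h" "h ` ({0..1} \<times> {0..1}) \<subseteq> X"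
  defines "p1 \<equiv> \<lambda>s::real. h (s, 0::real)" and "p2 \<equiv> \<lambda>s. h (s, 1)"
    and "p3 \<equiv> \<lambda>s. h (0, s)" and "p4 \<equiv> \<lambda>s. h (1, s)"
  shows "L p1 * L p4 = L p3 * L p2"
    and "C p1 + L p1 * C p4 = C p3 + L p3 * C p2"
    and "L (\<lambda>s. h (s, s)) = L p1 * L p4"
    and "C (\<lambda>s. h (s, s)) = C p1 + L p1 * C p4"
proof -
  let ?K = "{0..1::real} \<times> {0..1::real}"
  let ?b = "linepath (0::real,0::real) (1,0)" and ?t = "linepath (0::real,1::real) (1,1)"
    and ?l = "linepath (0::real,0::real) (0,1)" and ?r = "linepath (1::real,0::real) (1,1)"
    and ?d = "linepath (0::real,0::real) (1,1)"
  have eqs: "p1 = h \<circ> ?b" "p2 = h \<circ> ?t" "p3 = h \<circ> ?l" "p4 = h \<circ> ?r" "(\<lambda>s. h (s,s)) = h \<circ> ?d"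
    by (auto simp: fun_eq_iff p1_def p2_def p3_def p4_def linepath_def)
  have conv: "convex ?K" by (intro convex_Times) auto
  have p: "path_in ?K ?b" "path_in ?K ?t" "path_in ?K ?l" "path_in ?K ?r" "path_in ?K ?d"
    by (intro path_in_linepath[OF conv]; simp)+
  have pX: "path_in X p1" "path_in X p2" "path_in X p3" "path_in X p4"
    unfolding eqs using p h by (auto intro!: path_in_compose)
  have ends: "pathfinish p1 = pathstart p4" "pathfinish p3 = pathstart p2"
    by (auto simp: p1_def p4_def p3_def p2_def pathfinish_def pathstart_def)
  have joins: "path_in ?K (?b +++ ?r)" "path_in ?K (?l +++ ?t)"
    using p by (auto intro: path_in_join)
  have 1: "homotopic_paths X (p1 +++ p4) (p3 +++ p2)"
    unfolding eqs path_compose_join[symmetric]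
    by (rule homotopic_paths_convex_image[OF conv h joins]) simp_all
  have 2: "homotopic_paths X (\<lambda>s. h (s,s)) (p1 +++ p4)"
    unfolding eqs path_compose_join[symmetric]
    by (rule homotopic_paths_convex_image[OF conv h p(5) joins(1)]) simp_all
  show "L p1 * L p4 = L p3 * L p2"
    using L_homotopic[OF 1] pX ends by (simp add: L_join)
  show "C p1 + L p1 * C p4 = C p3 + L p3 * C p2"
    using C_homotopic[OF 1] pX ends by (simp add: C_join)
  show "L (\<lambda>s. h (s, s)) = L p1 * L p4" "C (\<lambda>s. h (s, s)) = C p1 + L p1 * C p4"
    using L_homotopic[OF 2] C_homotopic[OF 2] pX ends by (simp_all add: L_join C_join)
qed

text \<open>Points fixed by the monodromy of a family of loops with multiplier other than 1.\<close>

lemma loop_family: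
  assumes h: "continuous_on ({0..1} \<times> {0..1}) h" "h ` ({0..1} \<times> {0..1}) \<subseteq> X"
    and loops: "\<And>s. s \<in> {0..1} \<Longrightarrow> h (s, 1::real) = h (s::real, 0::real)"
  shows "L (\<lambda>t. h (0, t)) = L (\<lambda>t. h (1, t))"
    and "L (\<lambda>t. h (0, t)) \<noteq> 1 \<Longrightarrow>
      C (\<lambda>t. h (0, t)) / (1 - L (\<lambda>t. h (0, t))) =
      C (\<lambda>s. h (s, 0)) + L (\<lambda>s. h (s, 0)) * (C (\<lambda>t. h (1, t)) / (1 - L (\<lambda>t. h (1, t))))"
proof -
  let ?p = "\<lambda>s. h (s, 0)" and ?l = "\<lambda>t. h (0, t)" and ?r = "\<lambda>t. h (1, t)"
  have p: "path_in X ?p"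
    unfolding path_in_iff using h by (auto intro!: continuous_on_compose2[OF h(1)] continuous_intros)
  have top: "L (\<lambda>s. h (s, 1)) = L ?p" "C (\<lambda>s. h (s, 1)) = C ?p"
    using L_cong[OF p, of "\<lambda>s. h (s,1)"] C_cong[OF p, of "\<lambda>s. h (s,1)"] loops by auto
  show L: "L ?l = L ?r"
    using square(1)[OF h] L_nonzero[OF p] top by (simp add: mult.commute)
  assume ne: "L ?l \<noteq> 1"
  have "C ?p + L ?p * C ?r = C ?l + L ?l * C ?p"
    using square(2)[OF h] top by simp
  then show "C ?l / (1 - L ?l) = C ?p + L ?p * (C ?r / (1 - L ?r))"
    using ne unfolding L[symmetric] by (simp add: field_simps)
qed

text \<open>A free homotopy suffices because the values of \<open>L\<close> commute: the
  contribution of the track of the base point cancels.\<close>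

lemma L_homotopic_loops:
  assumes "homotopic_loops X p q"
  shows "L p = L q"
proof -
  obtain h where h: "continuous_on ({0..1::real} \<times> {0..1::real}) h" "h ` ({0..1} \<times> {0..1}) \<subseteq> X"
    "\<And>x. x \<in> {0..1} \<Longrightarrow> h (0, x) = p x" "\<And>x. x \<in> {0..1} \<Longrightarrow> h (1, x) = q x"
    "\<And>t. t \<in> {0..1} \<Longrightarrow> h (t, 1) = h (t, 0)"
    using assms unfolding homotopic_loops by (auto simp: pathfinish_def pathstart_def image_subset_iff_funcset)
  have "path_in X p" "path_in X q"
    using assms homotopic_loops_imp_path homotopic_loops_imp_subset by (fastforce simp: path_in_def)+
  then show ?thesis
    using loop_family(1)[OF h(1,2,5)] h(3,4) L_cong[of p "\<lambda>t. h (0, t)"] L_cong[of q "\<lambda>t. h (1, t)"]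
    by simp
qed

text \<open>The transport rule is additive in the parameter interval and holds on short intervals by
  hypothesis. \<open>Bolzano\<close> takes the place of a Lebesgue number.\<close>

lemma flat_local:
  assumes "S \<subseteq> X" and loc: "\<And>x. x \<in> S \<Longrightarrow> \<exists>U. openin (top_of_set S) U \<and> x \<in> U \<and> flat U s"
  shows "flat S s"
  unfolding flat_def
proof (intro allI impI)
  fix p assume p: "path_in S p"
  define sub where "sub = (\<lambda>u v. p \<circ> linepath u (v::real))"
  have sub_in: "path_in T (sub u v)"
    if "p ` {u..v} \<subseteq> T" "0 \<le> u" "u \<le> v" "v \<le> 1" for u v :: real and T
    unfolding sub_def
  proof (rule path_in_compose[OF _ _ that(1)])
    show "path_in {u..v} (linepath u v)"
      using that by (intro path_in_linepath) auto
    show "continuous_on {u..v} p"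
      using p that by (auto simp: path_in_iff intro: continuous_on_subset)
  qed
  define P where "P = (\<lambda>u v. 0 \<le> u \<and> v \<le> 1 \<longrightarrow> s (p u) = C (sub u v) + L (sub u v) * s (p v))"
  have pS: "p x \<in> S" if "0 \<le> x" "x \<le> 1" for x
    using p that by (auto simp: path_in_iff)
  have "P 0 1"
  proof (rule Bolzano[of 0 "1::real" P])
    fix a b c :: real assume P: "P a b" "P b c" and le: "a \<le> b" "b \<le> c"
    show "P a c"
      unfolding P_def
    proof
      assume r: "0 \<le> a \<and> c \<le> 1"
      have in_S: "path_in S (sub a b)" "path_in S (sub b c)"
        using r le by (auto intro!: sub_in pS)
      then have in_X: "path_in X (sub a b)" "path_in X (sub b c)"
        using \<open>S \<subseteq> X\<close> by (auto intro: path_in_subset)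
      have ends: "pathfinish (sub a b) = pathstart (sub b c)"
        by (simp add: sub_def pathfinish_compose pathstart_compose)
      have hom: "homotopic_paths X (sub a c) (sub a b +++ sub b c)"
        unfolding sub_def path_compose_join[symmetric]
      proof (rule homotopic_paths_convex_image[of "{0..1}"])
        show "path_in {0..1} (linepath a b +++ linepath b c)"
          using r le by (intro path_in_join path_in_linepath) auto
        show "path_in {0..1} (linepath a c)"
          using r le by (intro path_in_linepath) auto
      qed (use p \<open>S \<subseteq> X\<close> in \<open>auto simp: path_in_iff\<close>)
      show "s (p a) = C (sub a c) + L (sub a c) * s (p c)"
        unfolding L_homotopic[OF hom] C_homotopic[OF hom] L_join[OF in_X ends] C_join[OF in_X ends]
        using P r le unfolding P_def by (simp add: algebra_simps)
    qed
  next
    fix x :: real assume x: "0 \<le> x" "x \<le> 1"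
    then obtain U where U: "openin (top_of_set S) U" "p x \<in> U" "flat U s"
      using loc pS by blast
    have "continuous_on {0..1} p" "p \<in> {0..1} \<rightarrow> S"
      using p by (auto simp: path_in_iff)
    then have "openin (top_of_set {0..1}) ({0..1} \<inter> p -` U)"
      using U(1) continuous_openin_preimage by blast
    then have "\<exists>d>0. \<forall>y\<in>{0..1}. dist y x < d \<longrightarrow> y \<in> {0..1} \<inter> p -` U"
      unfolding openin_euclidean_subtopology_iff using x U(2) by simp
    then obtain d where d: "d > 0" "\<And>y. y \<in> {0..1} \<Longrightarrow> dist y x < d \<Longrightarrow> p y \<in> U"
      by auto
    show "\<exists>d>0. \<forall>a b. a \<le> x \<and> x \<le> b \<and> b - a < d \<longrightarrow> P a b"
    proof (intro exI[of _ d] conjI allI impI)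
      fix a b assume ab: "a \<le> x \<and> x \<le> b \<and> b - a < d"
      show "P a b"
        unfolding P_def
      proof
        assume r: "0 \<le> a \<and> b \<le> 1"
        have "path_in U (sub a b)"
          using r ab by (intro sub_in) (auto intro!: d(2) simp: dist_real_def)
        from flatD[OF U(3) this] show "s (p a) = C (sub a b) + L (sub a b) * s (p b)"
          by (simp add: sub_def pathstart_compose pathfinish_compose)
      qed
    qed (use d in auto)
  qed auto
  moreover have "sub 0 1 = p"
    by (auto simp: sub_def fun_eq_iff linepath_def)
  ultimately show "s (pathstart p) = C p + L p * s (pathfinish p)"
    by (simp add: P_def pathstart_def pathfinish_def)
qed

text \<open>The new value at \<open>x\<close> is the value of \<open>s\<close> at the end of the
  track of \<open>x\<close>, transported back along this track. A path in \<open>S\<close> sweeps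
  out a square under \<open>D\<close>, which yields flatness. The tracks may leave \<open>S\<close>
  but not \<open>X\<close>.\<close>

lemma flat_deformation:
  assumes D: "continuous_on ({0..1} \<times> S) D" "D ` ({0..1} \<times> S) \<subseteq> X"
    and D0: "\<And>x. x \<in> S \<Longrightarrow> D (0, x) = x" and D1: "\<And>x. x \<in> S \<Longrightarrow> D (1::real, x) \<in> S'"
    and s: "flat S' s"
  shows "flat S (\<lambda>x. C (\<lambda>t. D (t, x)) + L (\<lambda>t. D (t, x)) * s (D (1, x)))"
  unfolding flat_def
proof (intro allI impI)
  fix p assume p: "path_in S p"
  let ?h = "\<lambda>z. D (snd z, p (fst z))"
  have pc: "continuous_on {0..1} p" and pS: "\<And>s. s \<in> {0..1} \<Longrightarrow> p s \<in> S"
    using p by (auto simp: path_in_iff)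
  have h: "continuous_on ({0..1} \<times> {0..1}) ?h" "?h ` ({0..1} \<times> {0..1}) \<subseteq> X"
    using D(2) pS
    by (auto intro!: continuous_on_compose2[OF D(1)] continuous_intros continuous_on_compose2[OF pc])
  have "path_in X (\<lambda>s. D (0, p s))"
    unfolding path_in_iff using D(2) pS
    by (auto intro!: continuous_on_compose2[OF D(1)] continuous_intros pc)
  then have bot: "L (\<lambda>s. D (0, p s)) = L p" "C (\<lambda>s. D (0, p s)) = C p"
    using pS D0 by (auto intro!: L_cong C_cong)
  have top: "path_in S' (\<lambda>s. D (1, p s))"
    unfolding path_in_iff using D1 pS
    by (auto intro!: continuous_on_compose2[OF D(1)] continuous_intros pc)
  have st: "s (D (1, p 0)) = C (\<lambda>s. D (1, p s)) + L (\<lambda>s. D (1, p s)) * s (D (1, p 1))"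
    using flatD[OF s top] by (simp add: pathstart_def pathfinish_def)
  have sq: "L p * L (\<lambda>t. D (t, p 1)) = L (\<lambda>t. D (t, p 0)) * L (\<lambda>s. D (1, p s))"
    "C p + L p * C (\<lambda>t. D (t, p 1)) = C (\<lambda>t. D (t, p 0)) + L (\<lambda>t. D (t, p 0)) * C (\<lambda>s. D (1, p s))"
    using square(1,2)[OF h] bot by simp_all
  have "C (\<lambda>t. D (t, p 0)) + L (\<lambda>t. D (t, p 0)) * s (D (1, p 0))
      = (C (\<lambda>t. D (t, p 0)) + L (\<lambda>t. D (t, p 0)) * C (\<lambda>s. D (1, p s)))
        + (L (\<lambda>t. D (t, p 0)) * L (\<lambda>s. D (1, p s))) * s (D (1, p 1))"
    unfolding st by (simp add: algebra_simps)
  also have "\<dots> = C p + L p * (C (\<lambda>t. D (t, p 1)) + L (\<lambda>t. D (t, p 1)) * s (D (1, p 1)))"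
    unfolding sq[symmetric] by (simp add: algebra_simps)
  finally show "C (\<lambda>t. D (t, pathstart p)) + L (\<lambda>t. D (t, pathstart p)) * s (D (1, pathstart p)) =
    C p + L p * (C (\<lambda>t. D (t, pathfinish p)) + L (\<lambda>t. D (t, pathfinish p)) * s (D (1, pathfinish p)))"
    by (simp add: pathstart_def pathfinish_def)
qed

text \<open>The value at the base point is fixed by the affine map
  \<open>z \<mapsto> C p + L p * z\<close>, which has one fixed point only when
  \<open>L p \<noteq> 1\<close>.\<close>

lemma flat_loop_unique:
  assumes "flat S s" "path_in S p" "pathfinish p = pathstart p" "L p \<noteq> 1"
  shows "s (pathstart p) = C p / (1 - L p)"
  using flatD[OF assms(1,2)] assms(3,4) by (simp add: field_simps)

lemma flat_eqI:
  assumes "flat S s" "flat S s'" "S \<subseteq> X" "path_connected S" "x \<in> S" "y \<in> S" "s x = s' x"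
  shows "s y = s' y"
proof -
  obtain p where p: "path_in S p" "pathstart p = x" "pathfinish p = y"
    using assms(4-6) unfolding path_connected_def path_in_def by blast
  then have "L p \<noteq> 0" using L_nonzero path_in_subset assms(3) by blast
  moreover have "C p + L p * s y = C p + L p * s' y"
    using flatD[OF assms(1) p(1)] flatD[OF assms(2) p(1)] p(2,3) assms(7) by simp
  ultimately show ?thesis by simp
qed

lemma pullback:
  assumes "continuous_on Y e" "e ` Y \<subseteq> X"
  shows "affine_system Y (\<lambda>p. L (e \<circ> p)) (\<lambda>p. C (e \<circ> p))"
proof
  have hom: "homotopic_paths X (e \<circ> p) (e \<circ> q)" if "homotopic_paths Y p q" for p q
    using that assms by (auto intro: homotopic_paths_continuous_image)
  have pin: "path_in X (e \<circ> p)" if "path_in Y p" for p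
    using that assms by (rule path_in_compose)
  show "L (e \<circ> p) \<noteq> 0" if "path_in Y p" for p
    using pin[OF that] by (rule L_nonzero)
  show "L (e \<circ> p) = L (e \<circ> q)" "C (e \<circ> p) = C (e \<circ> q)" if "homotopic_paths Y p q" for p q
    using hom[OF that] by (rule L_homotopic C_homotopic)+
  show "L (e \<circ> (p +++ q)) = L (e \<circ> p) * L (e \<circ> q)"
    "C (e \<circ> (p +++ q)) = C (e \<circ> p) + L (e \<circ> p) * C (e \<circ> q)"
    if "path_in Y p" "path_in Y q" "pathfinish p = pathstart q" for p q
    unfolding path_compose_join using that pin
    by (auto intro!: L_join C_join simp: pathfinish_compose pathstart_compose)
qed

end

section \<open>Rank one systems in the plane\<close>

text \<open>Clamping the distance from \<open>c\<close> to the interval from \<open>r\<close> to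
  \<open>R\<close> retracts the punctured plane onto the annulus, and in the punctured plane the
  winding number classifies loops up to free homotopy.\<close>

lemma homotopic_loops_annulus:
  fixes c :: complex
  assumes r: "0 < r" "r \<le> R"
    and p: "path_in {w. r \<le> cmod (w - c) \<and> cmod (w - c) \<le> R} p" "pathfinish p = pathstart p"
    and q: "path_in {w. r \<le> cmod (w - c) \<and> cmod (w - c) \<le> R} q" "pathfinish q = pathstart q"
    and wn: "winding_number p c = winding_number q c"
  shows "homotopic_loops {w. r \<le> cmod (w - c) \<and> cmod (w - c) \<le> R} p q"
proof -
  let ?S = "{w. r \<le> cmod (w - c) \<and> cmod (w - c) \<le> R}"
  define clamp where
    "clamp = (\<lambda>w. c + of_real (max r (min R (cmod (w - c))) / cmod (w - c)) * (w - c))"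
  have "c \<notin> ?S" using r by auto
  then have ne: "path p" "path q" "c \<notin> path_image p" "c \<notin> path_image q"
    using p q by (auto simp: path_in_def)
  have "homotopic_loops (- {c}) p q"
    using winding_number_homotopic_loops_eq[of p c q] ne p q wn by auto
  moreover have "continuous_on (- {c}) clamp"
    unfolding clamp_def by (intro continuous_intros) auto
  moreover have "cmod (clamp w - c) = max r (min R (cmod (w - c)))" if "w \<noteq> c" for w
    unfolding clamp_def using that r by (simp add: norm_mult norm_divide)
  then have "clamp \<in> - {c} \<rightarrow> ?S" using r by auto
  ultimately have hom: "homotopic_loops ?S (clamp \<circ> p) (clamp \<circ> q)"
    by (rule homotopic_loops_continuous_image)
  have id: "clamp w = w" if "w \<in> ?S" for w
    using that r by (auto simp: clamp_def)
  have "homotopic_loops ?S p (clamp \<circ> p)" "homotopic_loops ?S q (clamp \<circ> q)"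
    using p q by (auto intro!: homotopic_loops_eq simp: path_in_def id[symmetric] path_image_def subset_iff)
  with hom show ?thesis
    using homotopic_loops_sym homotopic_loops_trans by blast
qed

text \<open>The aim is to evaluate \<open>L\<close> on a large circle from its values on small
  circles around the punctures in \<open>A\<close>. As \<open>L\<close> takes commuting values, no
  connecting paths have to be recorded and cutting rectangles into smaller ones is enough.\<close>

locale planar_system = affine_system "U - A" L C for U A :: "complex set" and L C +
  assumes finite_A: "finite A"
begin

definition seg :: "real \<Rightarrow> real \<Rightarrow> real \<Rightarrow> real \<Rightarrow> complex" where
  "seg x y x' y' = L (linepath (Complex x y) (Complex x' y'))"

definition bx :: "real \<Rightarrow> real \<Rightarrow> real \<Rightarrow> real \<Rightarrow> complex set" where
  "bx x0 x1 y0 y1 = {z. x0 \<le> Re z \<and> Re z \<le> x1 \<and> y0 \<le> Im z \<and> Im z \<le> y1}"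

text \<open>The value on the boundary of a rectangle, run through counterclockwise.\<close>

definition rect :: "real \<Rightarrow> real \<Rightarrow> real \<Rightarrow> real \<Rightarrow> complex" where
  "rect x0 x1 y0 y1 = seg x0 y0 x1 y0 * seg x1 y0 x1 y1 * seg x1 y1 x0 y1 * seg x0 y1 x0 y0"

definition good :: "real \<Rightarrow> real \<Rightarrow> real \<Rightarrow> real \<Rightarrow> bool" where
  "good x0 x1 y0 y1 \<longleftrightarrow> x0 < x1 \<and> y0 < y1 \<and> bx x0 x1 y0 y1 \<subseteq> U \<and>
     (\<forall>a\<in>A \<inter> bx x0 x1 y0 y1. x0 < Re a \<and> Re a < x1 \<and> y0 < Im a \<and> Im a < y1)"

lemma line_triangle:
  assumes "convex K" "K \<subseteq> U - A" "a \<in> K" "b \<in> K" "c \<in> K"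
  shows "L (linepath a b) * L (linepath b c) = L (linepath a c)"
proof -
  have p: "path_in K (linepath a b)" "path_in K (linepath b c)" "path_in K (linepath a c)"
    using assms by (auto intro: path_in_linepath)
  have "homotopic_paths (U - A) (id \<circ> (linepath a b +++ linepath b c)) (id \<circ> linepath a c)"
    using p assms by (intro homotopic_paths_convex_image[of K]) (auto intro: path_in_join)
  then have "L (linepath a b +++ linepath b c) = L (linepath a c)"
    by (auto dest: L_homotopic)
  then show ?thesis
    using p assms by (subst (asm) L_join) (auto intro: path_in_subset)
qed

lemma line_refl: "a \<in> U - A \<Longrightarrow> L (linepath a a) = 1"
  using const_path(1)[of a] by (simp add: linepath_def flip: scaleR_add_left)

lemma convex_slices:
  "convex {z. x0 \<le> Re z \<and> Re z \<le> x1 \<and> y0 \<le> Im z \<and> Im z \<le> y1}"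
proof -
  have "{z. x0 \<le> Re z \<and> Re z \<le> x1 \<and> y0 \<le> Im z \<and> Im z \<le> y1} = cbox (Complex x0 y0) (Complex x1 y1)"
    by (auto simp: in_cbox_complex_iff)
  then show ?thesis by simp
qed

lemma seg_triangle:
  assumes "bx x0 x1 y0 y1 \<subseteq> U - A" "Complex a a' \<in> bx x0 x1 y0 y1" "Complex b b' \<in> bx x0 x1 y0 y1"
    "Complex c c' \<in> bx x0 x1 y0 y1"
  shows "seg a a' b b' * seg b b' c c' = seg a a' c c'"
  unfolding seg_def using convex_slices assms by (intro line_triangle) (auto simp: bx_def)

lemma seg_refl:
  assumes "bx x0 x1 y0 y1 \<subseteq> U - A" "Complex a a' \<in> bx x0 x1 y0 y1"
  shows "seg a a' a a' = 1"
  unfolding seg_def using assms by (intro line_refl) blast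

lemma good_sub:
  assumes "good x0 x1 y0 y1" "x0 \<le> u0" "u0 < u1" "u1 \<le> x1" "y0 \<le> v0" "v0 < v1" "v1 \<le> y1"
    and "\<And>a. a \<in> A \<Longrightarrow> (x0 < u0 \<longrightarrow> Re a \<noteq> u0) \<and> (u1 < x1 \<longrightarrow> Re a \<noteq> u1)"
    and "\<And>a. a \<in> A \<Longrightarrow> (y0 < v0 \<longrightarrow> Im a \<noteq> v0) \<and> (v1 < y1 \<longrightarrow> Im a \<noteq> v1)"
  shows "good u0 u1 v0 v1"
proof -
  have sub: "bx u0 u1 v0 v1 \<subseteq> bx x0 x1 y0 y1"
    using assms(2-7) by (auto simp: bx_def)
  show ?thesis
    unfolding good_def
  proof (intro conjI ballI)
    show "bx u0 u1 v0 v1 \<subseteq> U" using sub assms(1) by (auto simp: good_def)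
    fix a assume a: "a \<in> A \<inter> bx u0 u1 v0 v1"
    then have "x0 < Re a" "Re a < x1" "y0 < Im a" "Im a < y1"
      "u0 \<le> Re a" "Re a \<le> u1" "v0 \<le> Im a" "Im a \<le> v1"
      using sub assms(1) by (auto simp: good_def bx_def)
    then show "u0 < Re a" "Re a < u1" "v0 < Im a" "Im a < v1"
      using assms(8,9)[of a] a assms(2,4,5,7) by auto
  qed (use assms in auto)
qed

lemma good_slice:
  assumes "good x0 x1 y0 y1" "x0 \<le> u0" "u1 \<le> x1" "y0 \<le> v0" "v1 \<le> y1"
    and "u0 = u1 \<and> (u0 = x0 \<or> u0 = x1 \<or> (\<forall>a\<in>A. Re a \<noteq> u0)) \<or>
         v0 = v1 \<and> (v0 = y0 \<or> v0 = y1 \<or> (\<forall>a\<in>A. Im a \<noteq> v0))"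
  shows "bx u0 u1 v0 v1 \<subseteq> U - A"
proof
  fix w assume w: "w \<in> bx u0 u1 v0 v1"
  then have wb: "w \<in> bx x0 x1 y0 y1" using assms(2-5) by (auto simp: bx_def)
  then have "w \<in> U" using assms(1) by (auto simp: good_def)
  moreover have "w \<notin> A"
  proof
    assume "w \<in> A"
    then have "x0 < Re w" "Re w < x1" "y0 < Im w" "Im w < y1"
      using assms(1) wb by (auto simp: good_def)
    then show False using \<open>w \<in> A\<close> w assms(6) by (auto simp: bx_def)
  qed
  ultimately show "w \<in> U - A" by simp
qed

text \<open>The cut \<open>Re z = m\<close> is traversed once in each direction, and the two
  contributions cancel.\<close>

lemma split_vertical:
  assumes "good x0 x1 y0 y1" "x0 < m" "m < x1" "\<forall>a\<in>A. Re a \<noteq> m"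
  shows "good x0 m y0 y1" "good m x1 y0 y1" "rect x0 x1 y0 y1 = rect x0 m y0 y1 * rect m x1 y0 y1"
proof -
  show "good x0 m y0 y1" "good m x1 y0 y1"
    by (rule good_sub[OF assms(1)]; use assms in \<open>auto simp: good_def\<close>)+
  have sub: "bx x0 x1 y0 y0 \<subseteq> U - A" "bx x0 x1 y1 y1 \<subseteq> U - A" "bx m m y0 y1 \<subseteq> U - A"
    by (rule good_slice[OF assms(1)]; use assms in \<open>auto simp: good_def\<close>)+
  have le: "x0 \<le> x1" "y0 \<le> y1" using assms by (auto simp: good_def)
  have a: "seg x0 y0 m y0 * seg m y0 x1 y0 = seg x0 y0 x1 y0"
    by (rule seg_triangle[OF sub(1)]) (use assms le in \<open>auto simp: bx_def\<close>)
  have b: "seg x1 y1 m y1 * seg m y1 x0 y1 = seg x1 y1 x0 y1"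
    by (rule seg_triangle[OF sub(2)]) (use assms le in \<open>auto simp: bx_def\<close>)
  have "seg m y0 m y1 * seg m y1 m y0 = seg m y0 m y0"
    by (rule seg_triangle[OF sub(3)]) (use assms le in \<open>auto simp: bx_def\<close>)
  moreover have "seg m y0 m y0 = 1"
    by (rule seg_refl[OF sub(3)]) (use le assms in \<open>simp add: bx_def\<close>)
  ultimately have c: "seg m y0 m y1 * seg m y1 m y0 = 1" by simp
  have "rect x0 m y0 y1 * rect m x1 y0 y1 =
    (seg x0 y0 m y0 * seg m y0 x1 y0) * seg x1 y0 x1 y1 * (seg x1 y1 m y1 * seg m y1 x0 y1)
      * seg x0 y1 x0 y0 * (seg m y0 m y1 * seg m y1 m y0)"
    unfolding rect_def by (simp add: ac_simps)
  also have "\<dots> = rect x0 x1 y0 y1"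
    unfolding a b c rect_def by simp
  finally show "rect x0 x1 y0 y1 = rect x0 m y0 y1 * rect m x1 y0 y1" ..
qed

lemma split_horizontal:
  assumes "good x0 x1 y0 y1" "y0 < m" "m < y1" "\<forall>a\<in>A. Im a \<noteq> m"
  shows "good x0 x1 y0 m" "good x0 x1 m y1" "rect x0 x1 y0 y1 = rect x0 x1 y0 m * rect x0 x1 m y1"
proof -
  show "good x0 x1 y0 m" "good x0 x1 m y1"
    by (rule good_sub[OF assms(1)]; use assms in \<open>auto simp: good_def\<close>)+
  have sub: "bx x1 x1 y0 y1 \<subseteq> U - A" "bx x0 x0 y0 y1 \<subseteq> U - A" "bx x0 x1 m m \<subseteq> U - A"
    by (rule good_slice[OF assms(1)]; use assms in \<open>auto simp: good_def\<close>)+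
  have le: "x0 \<le> x1" "y0 \<le> y1" using assms by (auto simp: good_def)
  have a: "seg x1 y0 x1 m * seg x1 m x1 y1 = seg x1 y0 x1 y1"
    by (rule seg_triangle[OF sub(1)]) (use assms le in \<open>auto simp: bx_def\<close>)
  have b: "seg x0 y1 x0 m * seg x0 m x0 y0 = seg x0 y1 x0 y0"
    by (rule seg_triangle[OF sub(2)]) (use assms le in \<open>auto simp: bx_def\<close>)
  have "seg x0 m x1 m * seg x1 m x0 m = seg x0 m x0 m"
    by (rule seg_triangle[OF sub(3)]) (use assms le in \<open>auto simp: bx_def\<close>)
  moreover have "seg x0 m x0 m = 1"
    by (rule seg_refl[OF sub(3)]) (use le assms in \<open>simp add: bx_def\<close>)
  ultimately have c: "seg x0 m x1 m * seg x1 m x0 m = 1" by simp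
  have "rect x0 x1 y0 m * rect x0 x1 m y1 =
    seg x0 y0 x1 y0 * (seg x1 y0 x1 m * seg x1 m x1 y1) * seg x1 y1 x0 y1
      * (seg x0 y1 x0 m * seg x0 m x0 y0) * (seg x0 m x1 m * seg x1 m x0 m)"
    unfolding rect_def by (simp add: ac_simps)
  also have "\<dots> = rect x0 x1 y0 y1"
    unfolding a b c rect_def by simp
  finally show "rect x0 x1 y0 y1 = rect x0 x1 y0 m * rect x0 x1 m y1" ..
qed

lemma rect_empty:
  assumes "good x0 x1 y0 y1" "A \<inter> bx x0 x1 y0 y1 = {}"
  shows "rect x0 x1 y0 y1 = 1"
proof -
  have sub: "bx x0 x1 y0 y1 \<subseteq> U - A" and le: "x0 \<le> x1" "y0 \<le> y1"
    using assms by (auto simp: good_def)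
  have "seg x0 y0 x1 y0 * seg x1 y0 x1 y1 = seg x0 y0 x1 y1"
    "seg x0 y0 x1 y1 * seg x1 y1 x0 y1 = seg x0 y0 x0 y1"
    "seg x0 y0 x0 y1 * seg x0 y1 x0 y0 = seg x0 y0 x0 y0"
    by (rule seg_triangle[OF sub]; use le in \<open>simp add: bx_def\<close>)+
  moreover have "seg x0 y0 x0 y0 = 1"
    by (rule seg_refl[OF sub]) (use le in \<open>simp add: bx_def\<close>)
  ultimately show ?thesis unfolding rect_def by simp
qed

lemma ex_between_notin:
  fixes a b :: real
  assumes "a < b" "finite F"
  shows "\<exists>m. a < m \<and> m < b \<and> m \<notin> F"
proof -
  have "infinite ({a<..<b} - F)" using assms by (simp add: infinite_Ioo)
  then show ?thesis by (metis DiffD1 DiffD2 equals0I finite.emptyI greaterThanLessThan_iff)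
qed

lemma rect_single:
  assumes g: "good x0 x1 y0 y1" and a: "A \<inter> bx x0 x1 y0 y1 = {a}"
    and sq: "\<And>h. 0 < h \<Longrightarrow> h < d \<Longrightarrow> rect (Re a - h) (Re a + h) (Im a - h) (Im a + h) = m" and d: "d > 0"
  shows "rect x0 x1 y0 y1 = m"
proof -
  have ia: "x0 < Re a" "Re a < x1" "y0 < Im a" "Im a < y1"
    using g a by (auto simp: good_def)
  \<comment> \<open>The lines cutting out a square around \<open>a\<close> have to miss every point
    of \<open>A\<close>, inside the box or not; this excludes finitely many half-sides
    \<open>h\<close>.\<close>
  define F where "F = (\<lambda>b. \<bar>Re b - Re a\<bar>) ` A \<union> (\<lambda>b. \<bar>Im b - Im a\<bar>) ` A"
  define e where "e = Min {d, Re a - x0, x1 - Re a, Im a - y0, y1 - Im a}"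
  have "e > 0" using ia d by (auto simp: e_def)
  then obtain h where h: "0 < h" "h < e" "h \<notin> F"
    using ex_between_notin[of 0 e F] finite_A by (auto simp: F_def)
  have he: "h < d" "h < Re a - x0" "h < x1 - Re a" "h < Im a - y0" "h < y1 - Im a"
    using h(2) by (auto simp: e_def)
  have nF: "\<forall>b\<in>A. Re b \<noteq> Re a - h" "\<forall>b\<in>A. Re b \<noteq> Re a + h"
    "\<forall>b\<in>A. Im b \<noteq> Im a - h" "\<forall>b\<in>A. Im b \<noteq> Im a + h"
    using h(1,3) by (force simp: F_def abs_if)+
  let ?l = "Re a - h" and ?r = "Re a + h" and ?b = "Im a - h" and ?t = "Im a + h"
  note s1 = split_vertical[OF g _ _ nF(1)]
  have s1: "good x0 ?l y0 y1" "good ?l x1 y0 y1" "rect x0 x1 y0 y1 = rect x0 ?l y0 y1 * rect ?l x1 y0 y1"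
    using s1 he h(1) by auto
  have s2: "good ?l ?r y0 y1" "good ?r x1 y0 y1" "rect ?l x1 y0 y1 = rect ?l ?r y0 y1 * rect ?r x1 y0 y1"
    using split_vertical[OF s1(2) _ _ nF(2)] he h(1) by auto
  have s3: "good ?l ?r y0 ?b" "good ?l ?r ?b y1" "rect ?l ?r y0 y1 = rect ?l ?r y0 ?b * rect ?l ?r ?b y1"
    using split_horizontal[OF s2(1) _ _ nF(3)] he h(1) by auto
  have s4: "good ?l ?r ?b ?t" "good ?l ?r ?t y1" "rect ?l ?r ?b y1 = rect ?l ?r ?b ?t * rect ?l ?r ?t y1"
    using split_horizontal[OF s3(2) _ _ nF(4)] he h(1) by auto
  have only: "b = a" if "b \<in> A" "b \<in> bx x0 x1 y0 y1" for b using that a by auto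
  have e: "rect x0 ?l y0 y1 = 1" "rect ?r x1 y0 y1 = 1" "rect ?l ?r y0 ?b = 1" "rect ?l ?r ?t y1 = 1"
    using only he h(1)
    by (intro rect_empty[OF s1(1)] rect_empty[OF s2(2)] rect_empty[OF s3(1)] rect_empty[OF s4(2)]; force simp: bx_def)+
  show ?thesis
    using s1(3) s2(3) s3(3) s4(3) e sq[OF h(1) he(1)] by simp
qed

text \<open>Two different punctures differ in their real or imaginary part, so a line parallel to an
  axis separates them and leaves fewer punctures in both pieces. The induction ends with boxes
  holding at most one.\<close>

lemma rect_prod:
  assumes "good x0 x1 y0 y1"
    and sq: "\<And>a. a \<in> A \<Longrightarrow> \<exists>d>0. \<forall>h. 0 < h \<and> h < d \<longrightarrow>
        rect (Re a - h) (Re a + h) (Im a - h) (Im a + h) = m a"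
  shows "rect x0 x1 y0 y1 = (\<Prod>a\<in>A \<inter> bx x0 x1 y0 y1. m a)"
  using assms(1)
proof (induction "card (A \<inter> bx x0 x1 y0 y1)" arbitrary: x0 x1 y0 y1 rule: less_induct)
  case less
  let ?B = "A \<inter> bx x0 x1 y0 y1"
  have fin: "finite (A \<inter> S)" for S using finite_A by blast
  have step: "rect x0 x1 y0 y1 = (\<Prod>a\<in>?B. m a)"
    if "good u0 u1 v0 v1" "good u0' u1' v0' v1'" "rect x0 x1 y0 y1 = rect u0 u1 v0 v1 * rect u0' u1' v0' v1'"
      and un: "?B = (A \<inter> bx u0 u1 v0 v1) \<union> (A \<inter> bx u0' u1' v0' v1')"
      and disj: "(A \<inter> bx u0 u1 v0 v1) \<inter> (A \<inter> bx u0' u1' v0' v1') = {}"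
      and ne: "A \<inter> bx u0 u1 v0 v1 \<noteq> {}" "A \<inter> bx u0' u1' v0' v1' \<noteq> {}"
    for u0 u1 v0 v1 u0' u1' v0' v1'
  proof -
    have "card ?B = card (A \<inter> bx u0 u1 v0 v1) + card (A \<inter> bx u0' u1' v0' v1')"
      unfolding un by (rule card_Un_disjoint[OF fin fin disj])
    moreover have "card (A \<inter> bx u0 u1 v0 v1) > 0" "card (A \<inter> bx u0' u1' v0' v1') > 0"
      using ne fin by (simp_all add: card_gt_0_iff)
    ultimately have "rect u0 u1 v0 v1 = (\<Prod>a\<in>A \<inter> bx u0 u1 v0 v1. m a)"
      "rect u0' u1' v0' v1' = (\<Prod>a\<in>A \<inter> bx u0' u1' v0' v1'. m a)"
      using that(1,2) by (auto intro!: less.hyps)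
    then show ?thesis
      unfolding that(3) un by (subst prod.union_disjoint[OF fin fin disj]) simp
  qed
  consider "?B = {}" | a where "?B = {a}" | a b where "a \<in> ?B" "b \<in> ?B" "a \<noteq> b" by blast
  then show ?case
  proof cases
    case 1
    then show ?thesis using rect_empty[OF less.prems] by simp
  next
    case (2 a)
    obtain d where "d > 0" "\<And>h. 0 < h \<Longrightarrow> h < d \<Longrightarrow>
        rect (Re a - h) (Re a + h) (Im a - h) (Im a + h) = m a"
      using sq[of a] 2 by auto
    then have "rect x0 x1 y0 y1 = m a" by (intro rect_single[OF less.prems 2])
    then show ?thesis using 2 by simp
  next
    case (3 a b)
    have vert: ?thesis if ab: "a \<in> ?B" "b \<in> ?B" "Re a < Re b" for a b
    proof -
      obtain c where c: "Re a < c" "c < Re b" "c \<notin> Re ` A"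
        using ex_between_notin[OF ab(3), of "Re ` A"] finite_A by auto
      have c': "x0 < c" "c < x1" using ab c by (auto simp: bx_def)
      have "\<forall>z\<in>A. Re z \<noteq> c" using c(3) by auto
      from split_vertical[OF less.prems c' this] show ?thesis
        by (rule step) (use ab c c' in \<open>auto simp: bx_def\<close>)
    qed
    have horiz: ?thesis if ab: "a \<in> ?B" "b \<in> ?B" "Im a < Im b" for a b
    proof -
      obtain c where c: "Im a < c" "c < Im b" "c \<notin> Im ` A"
        using ex_between_notin[OF ab(3), of "Im ` A"] finite_A by auto
      have c': "y0 < c" "c < y1" using ab c by (auto simp: bx_def)
      have "\<forall>z\<in>A. Im z \<noteq> c" using c(3) by auto
      from split_horizontal[OF less.prems c' this] show ?thesis
        by (rule step) (use ab c c' in \<open>auto simp: bx_def\<close>)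
    qed
    have "Re a < Re b \<or> Re b < Re a \<or> Im a < Im b \<or> Im b < Im a"
      using 3(3) by (meson complex_eqI not_less_iff_gr_or_eq)
    then show ?thesis using vert horiz 3 by blast
  qed
qed

text \<open>Square and circle both wind once around \<open>c\<close> inside the annulus. The corners
  of the square are the reason for \<open>2 * h \<le> R\<close>: a point of the square has distance
  at most \<open>\<bar>Re\<bar> + \<bar>Im\<bar> \<le> 2 * h\<close> from \<open>c\<close>.\<close>

lemma rect_eq_circle:
  assumes h: "0 < h" "2 * h \<le> R" and ann: "{w. h \<le> cmod (w - c) \<and> cmod (w - c) \<le> R} \<subseteq> U - A"
    and r: "h \<le> r" "r \<le> R"
  shows "L (circlepath c r) = rect (Re c - h) (Re c + h) (Im c - h) (Im c + h)"
proof -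
  let ?S = "{w. h \<le> cmod (w - c) \<and> cmod (w - c) \<le> R}"
  let ?a = "Complex (Re c - h) (Im c - h)" and ?b = "Complex (Re c + h) (Im c + h)"
  have K: "K \<subseteq> ?S"
    if "\<And>w. w \<in> K \<Longrightarrow> \<bar>Re (w - c)\<bar> \<le> h \<and> \<bar>Im (w - c)\<bar> \<le> h \<and> (\<bar>Re (w - c)\<bar> = h \<or> \<bar>Im (w - c)\<bar> = h)" for K
  proof
    fix w assume "w \<in> K"
    from that[OF this] have "\<bar>Re (w - c)\<bar> \<le> h" "\<bar>Im (w - c)\<bar> \<le> h"
      "\<bar>Re (w - c)\<bar> = h \<or> \<bar>Im (w - c)\<bar> = h" by auto
    moreover have "cmod (w - c) \<le> \<bar>Re (w - c)\<bar> + \<bar>Im (w - c)\<bar>" by (rule cmod_le)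
    ultimately show "w \<in> ?S"
      using abs_Re_le_cmod[of "w - c"] abs_Im_le_cmod[of "w - c"] h by auto
  qed
  have line: "path_in ?S (linepath (Complex x y) (Complex x' y'))"
    if "x \<in> {Re c - h, Re c + h}" "y \<in> {Im c - h, Im c + h}"
      "x' \<in> {Re c - h, Re c + h}" "y' \<in> {Im c - h, Im c + h}" "x = x' \<or> y = y'" for x y x' y'
  proof (rule path_in_subset[OF path_in_linepath])
    let ?B = "{z. min x x' \<le> Re z \<and> Re z \<le> max x x' \<and> min y y' \<le> Im z \<and> Im z \<le> max y y'}"
    show "convex ?B" by (rule convex_slices)
    show "?B \<subseteq> ?S"
      by (rule K) (use that h in auto)
  qed auto
  have lines: "path_in ?S (linepath (Complex (Re c - h) (Im c - h)) (Complex (Re c + h) (Im c - h)))"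
    "path_in ?S (linepath (Complex (Re c + h) (Im c - h)) (Complex (Re c + h) (Im c + h)))"
    "path_in ?S (linepath (Complex (Re c + h) (Im c + h)) (Complex (Re c - h) (Im c + h)))"
    "path_in ?S (linepath (Complex (Re c - h) (Im c + h)) (Complex (Re c - h) (Im c - h)))"
    by (rule line; simp)+
  have rp: "rectpath ?a ?b = linepath (Complex (Re c - h) (Im c - h)) (Complex (Re c + h) (Im c - h)) +++
    linepath (Complex (Re c + h) (Im c - h)) (Complex (Re c + h) (Im c + h)) +++
    linepath (Complex (Re c + h) (Im c + h)) (Complex (Re c - h) (Im c + h)) +++
    linepath (Complex (Re c - h) (Im c + h)) (Complex (Re c - h) (Im c - h))"
    by (simp add: rectpath_def Let_def)
  have pin: "path_in ?S (rectpath ?a ?b)"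
    unfolding rp by (intro path_in_join lines) simp_all
  have "L (rectpath ?a ?b) = rect (Re c - h) (Re c + h) (Im c - h) (Im c + h)"
    unfolding rp rect_def seg_def
    by (subst L_join, (intro path_in_join path_in_subset[OF lines(1) ann] path_in_subset[OF lines(2) ann]
       path_in_subset[OF lines(3) ann] path_in_subset[OF lines(4) ann] | simp)+)+
  moreover have "homotopic_loops ?S (circlepath c r) (rectpath ?a ?b)"
  proof (rule homotopic_loops_annulus)
    show "path_in ?S (circlepath c r)"
      using h r by (auto simp: path_in_def path_image_circlepath_nonneg dist_norm norm_minus_commute)
    show "winding_number (circlepath c r) c = winding_number (rectpath ?a ?b) c"
      using h r by (subst winding_number_circlepath_centre winding_number_rectpath;
        simp add: in_box_complex_iff)+
  qed (use h pin in auto)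
  then have "L (circlepath c r) = L (rectpath ?a ?b)"
    using homotopic_loops_subset[OF _ ann] by (blast intro: L_homotopic_loops)
  ultimately show ?thesis by simp
qed

lemma circle_prod:
  assumes "A \<subseteq> ball c r" "2 * r \<le> R" "0 < r" "cball c R \<subseteq> U" "open U"
    and small: "\<And>a. a \<in> A \<Longrightarrow> \<exists>d>0. \<forall>h. 0 < h \<and> h < d \<longrightarrow> L (circlepath a h) = m a"
  shows "L (circlepath c R) = (\<Prod>a\<in>A. m a)"
proof -
  have cA: "\<bar>Re a - Re c\<bar> < r" "\<bar>Im a - Im c\<bar> < r" if "a \<in> A" for a
  proof -
    have "cmod (a - c) < r" using assms(1) that by (auto simp: dist_norm norm_minus_commute)
    then show "\<bar>Re a - Re c\<bar> < r" "\<bar>Im a - Im c\<bar> < r"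
      using abs_Re_le_cmod[of "a - c"] abs_Im_le_cmod[of "a - c"] by auto
  qed
  have inb: "A \<inter> bx (Re c - r) (Re c + r) (Im c - r) (Im c + r) = A"
  proof -
    have "a \<in> bx (Re c - r) (Re c + r) (Im c - r) (Im c + r)" if "a \<in> A" for a
      using cA[OF that] unfolding bx_def mem_Collect_eq by linarith
    then show ?thesis by blast
  qed
  have sub: "bx (Re c - r) (Re c + r) (Im c - r) (Im c + r) \<subseteq> cball c R"
  proof
    fix w assume "w \<in> bx (Re c - r) (Re c + r) (Im c - r) (Im c + r)"
    then have "\<bar>Re (w - c)\<bar> \<le> r" "\<bar>Im (w - c)\<bar> \<le> r" by (auto simp: bx_def)
    then show "w \<in> cball c R"
      using cmod_le[of "w - c"] assms(2) by (auto simp: dist_norm norm_minus_commute)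
  qed
  have g: "good (Re c - r) (Re c + r) (Im c - r) (Im c + r)"
    unfolding good_def
  proof (intro conjI ballI)
    show "bx (Re c - r) (Re c + r) (Im c - r) (Im c + r) \<subseteq> U"
      using assms(4) sub by blast
    fix a assume "a \<in> A \<inter> bx (Re c - r) (Re c + r) (Im c - r) (Im c + r)"
    then have "a \<in> A" by simp
    then show "Re c - r < Re a" "Re a < Re c + r" "Im c - r < Im a" "Im a < Im c + r"
      using cA[of a] by linarith+
  qed (use assms(3) in simp_all)
  have "\<exists>d>0. \<forall>h. 0 < h \<and> h < d \<longrightarrow> rect (Re a - h) (Re a + h) (Im a - h) (Im a + h) = m a"
    if a: "a \<in> A" for a
  proof -
    obtain d where d: "d > 0" "\<And>h. 0 < h \<Longrightarrow> h < d \<Longrightarrow> L (circlepath a h) = m a"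
      using small[OF a] by blast
    have "a \<in> cball c R" using a assms(1,2,3) by auto
    then have "a \<in> U" using assms(4) by (rule set_mp[rotated])
    have "open (U - (A - {a}))"
      using assms(5) finite_A by (intro open_Diff finite_imp_closed) auto
    then obtain e where e: "e > 0" "cball a e \<subseteq> U - (A - {a})"
      unfolding open_contains_cball using \<open>a \<in> U\<close> by blast
    show ?thesis
    proof (intro exI[of _ "min d (e / 2)"] conjI allI impI)
      fix h assume h: "0 < h \<and> h < min d (e / 2)"
      then have "L (circlepath a h) = rect (Re a - h) (Re a + h) (Im a - h) (Im a + h)"
        using e by (intro rect_eq_circle[of h e]) (auto simp: subset_iff dist_norm norm_minus_commute)
      then show "rect (Re a - h) (Re a + h) (Im a - h) (Im a + h) = m a"
        using d(2)[of h] h by simp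
    qed (use d e in auto)
  qed
  from rect_prod[OF g this] have "rect (Re c - r) (Re c + r) (Im c - r) (Im c + r) = (\<Prod>a\<in>A. m a)"
    unfolding inb .
  moreover have "L (circlepath c R) = rect (Re c - r) (Re c + r) (Im c - r) (Im c + r)"
    using assms by (intro rect_eq_circle[of r R]) (auto simp: subset_iff dist_norm norm_minus_commute)
  ultimately show ?thesis by simp
qed

end

section \<open>Pencils\<close>

abbreviation ee :: "real \<Rightarrow> complex" where
  "ee s \<equiv> exp (2 * complex_of_real pi * \<i> * complex_of_real s)"

lemma ee_0 [simp]: "ee 0 = 1" and ee_1 [simp]: "ee 1 = 1"
  by (auto simp: exp_two_pi_i' mult.commute mult.left_commute exp_two_pi_i)

lemma norm_ee [simp]: "cmod (ee s) = 1"
  by (simp add: norm_exp_eq_Re)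

lemma continuous_on_ee [continuous_intros]:
  "continuous_on S f \<Longrightarrow> continuous_on S (\<lambda>x. ee (f x))"
  by (intro continuous_intros)

definition lin :: "complex \<times> complex \<Rightarrow> complex \<times> complex \<Rightarrow> complex" where
  "lin u b = fst u * fst b + snd u * snd b"

definition sp :: "complex \<Rightarrow> complex \<times> complex \<Rightarrow> complex \<times> complex" where
  "sp z b = (z * fst b, z * snd b)"

lemma lin_add: "lin u (b + b') = lin u b + lin u b'"
  and lin_diff: "lin u (b - b') = lin u b - lin u b'"
  and lin_sp: "lin u (sp z b) = z * lin u b"
  and lin_scaleR: "lin u (c *\<^sub>R b) = c *\<^sub>R lin u b"
  and lin_diff_left: "lin (u - u') b = lin u b - lin u' b"
  by (auto simp: lin_def sp_def algebra_simps scaleR_conv_of_real)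

lemma continuous_on_lin [continuous_intros]:
  "continuous_on S f \<Longrightarrow> continuous_on S (\<lambda>x. lin u (f x))"
  unfolding lin_def by (intro continuous_intros)

lemma continuous_on_sp [continuous_intros]:
  "continuous_on S f \<Longrightarrow> continuous_on S g \<Longrightarrow> continuous_on S (\<lambda>x. sp (f x) (g x))"
  unfolding sp_def by (intro continuous_intros)

text \<open>Two points of \<open>S\<close> are joined inside a complex line, where only finitely many points are bad.\<close>

lemma path_connected_complex_lines:
  fixes U S :: "'a::real_normed_vector set"
  assumes U: "convex U" "open U" and "S \<subseteq> U"
    and line: "\<And>a b. a \<in> S \<Longrightarrow> b \<in> S \<Longrightarrow> \<exists>g :: complex \<Rightarrow> 'a. linear g \<and> g 1 = b - a \<and>
                 finite {z. a + g z \<notin> S \<and> a + g z \<in> U}"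
  shows "path_connected S"
  unfolding path_connected_def
proof (intro ballI)
  fix a b assume ab: "a \<in> S" "b \<in> S"
  obtain g :: "complex \<Rightarrow> 'a" where g: "linear g" "g 1 = b - a"
    "finite {z. a + g z \<notin> S \<and> a + g z \<in> U}"
    using line[OF ab] by blast
  have "continuous_on UNIV g"
    using g(1) by (simp add: linear_continuous_on linear_conv_bounded_linear)
  then have cont: "continuous_on T (\<lambda>z. a + g z)" for T
    by (auto intro!: continuous_intros intro: continuous_on_subset)
  define Z where "Z = (\<lambda>z. a + g z) -` U"
  have "open Z" unfolding Z_def using open_vimage[OF U(2) cont] .
  have "convex Z"
  proof (rule convexI)
    fix x y :: complex and u v :: real assume "x \<in> Z" "y \<in> Z" "0 \<le> u" "0 \<le> v" "u + v = 1"
    then have "u *\<^sub>R (a + g x) + v *\<^sub>R (a + g y) \<in> U"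
      using U(1) by (auto simp: Z_def intro: convexD)
    moreover have "u *\<^sub>R (a + g x) + v *\<^sub>R (a + g y) = a + g (u *\<^sub>R x + v *\<^sub>R y)"
      using \<open>u + v = 1\<close> by (simp add: linear_add[OF g(1)] linear_scale[OF g(1)] algebra_simps flip: scaleR_add_left)
    ultimately show "u *\<^sub>R x + v *\<^sub>R y \<in> Z" by (simp add: Z_def)
  qed
  let ?F = "{z. a + g z \<notin> S \<and> a + g z \<in> U}"
  have "path_connected (Z - ?F)"
  proof (rule path_connected_open_diff_countable)
    show "connected Z" using \<open>convex Z\<close> by (rule convex_connected)
  qed (use \<open>open Z\<close> g(3) in \<open>auto intro: countable_finite\<close>)
  moreover have "0 \<in> Z - ?F" "1 \<in> Z - ?F"
    using ab \<open>S \<subseteq> U\<close> g(2) linear_0[OF g(1)] by (auto simp: Z_def)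
  ultimately obtain p where p: "path p" "path_image p \<subseteq> Z - ?F" "pathstart p = 0" "pathfinish p = 1"
    unfolding path_connected_def by blast
  show "\<exists>p. path p \<and> path_image p \<subseteq> S \<and> pathstart p = a \<and> pathfinish p = b"
  proof (intro exI[of _ "(\<lambda>z. a + g z) \<circ> p"] conjI)
    show "path ((\<lambda>z. a + g z) \<circ> p)" using p(1) cont by (rule path_continuous_image)
    show "path_image ((\<lambda>z. a + g z) \<circ> p) \<subseteq> S"
      using p(2) by (auto simp: path_image_compose Z_def)
  qed (use p g(2) linear_0[OF g(1)] in \<open>auto simp: pathstart_compose pathfinish_compose\<close>)
qed

section \<open>Flat sections from families of loops, and their extension to larger sets\<close>

context affine_system begin

lemma flat_cong: "flat S s \<Longrightarrow> (\<And>x. x \<in> S \<Longrightarrow> s x = s' x) \<Longrightarrow> flat S s'"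
  unfolding flat_def by (metis path_in_def pathfinish_in_path_image pathstart_in_path_image subset_iff)

lemma L_loop_const:
  assumes "path_connected S" "x \<in> S" "y \<in> S"
    and g: "continuous_on (S \<times> {0..1}) g" "g ` (S \<times> {0..1}) \<subseteq> X"
      "\<And>x. x \<in> S \<Longrightarrow> g (x, 1) = g (x, 0::real)"
  shows "L (\<lambda>t. g (x, t)) = L (\<lambda>t. g (y, t))"
proof -
  obtain p where p: "path_in S p" "p 0 = x" "p 1 = y"
    using assms(1-3) unfolding path_connected_def path_in_def pathstart_def pathfinish_def by metis
  let ?h = "\<lambda>z. g (p (fst z), snd z)"
  have pc: "continuous_on {0..1} p" "\<And>s. s \<in> {0..1} \<Longrightarrow> p s \<in> S" using p(1) by (auto simp: path_in_iff)
  have "continuous_on ({0..1} \<times> {0..1}) ?h" "?h ` ({0..1} \<times> {0..1}) \<subseteq> X"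
    using g(2) pc(2) by (auto intro!: continuous_on_compose2[OF g(1)] continuous_on_compose2[OF pc(1)] continuous_intros)
  from loop_family(1)[OF this] show ?thesis using g(3) pc(2) p(2,3) by simp
qed

text \<open>Through each \<open>x\<close> runs a loop based at \<open>x\<close> that depends
  continuously on \<open>x\<close>. Its monodromy has a unique fixed point, and transport along a
  path carries the fixed point at one end to that at the other.\<close>

lemma flat_loops:
  assumes g: "continuous_on (S \<times> {0..1}) g" "g ` (S \<times> {0..1}) \<subseteq> X"
      "\<And>x. x \<in> S \<Longrightarrow> g (x, 1) = x" "\<And>x. x \<in> S \<Longrightarrow> g (x, 0::real) = x"
    and ne: "\<And>x. x \<in> S \<Longrightarrow> L (\<lambda>t. g (x, t)) \<noteq> 1"
  shows "flat S (\<lambda>x. C (\<lambda>t. g (x, t)) / (1 - L (\<lambda>t. g (x, t))))"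
  unfolding flat_def
proof (intro allI impI)
  fix p assume p: "path_in S p"
  let ?h = "\<lambda>z. g (p (fst z), snd z)"
  have pc: "continuous_on {0..1} p" "\<And>s. s \<in> {0..1} \<Longrightarrow> p s \<in> S" using p by (auto simp: path_in_iff)
  have h: "continuous_on ({0..1} \<times> {0..1}) ?h" "?h ` ({0..1} \<times> {0..1}) \<subseteq> X"
    using g(2) pc(2) by (auto intro!: continuous_on_compose2[OF g(1)] continuous_on_compose2[OF pc(1)] continuous_intros)
  have "path_in X p" unfolding path_in_iff
  proof (intro conjI ballI pc)
    fix s :: real assume s: "s \<in> {0..1}"
    have "g (p s, 0) \<in> X" using g(2) pc(2)[OF s] by auto
    then show "p s \<in> X" using g(4)[OF pc(2)[OF s]] by simp
  qed
  then have "L (\<lambda>s. g (p s, 0)) = L p" "C (\<lambda>s. g (p s, 0)) = C p"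
    using g(4) pc(2) by (auto intro!: L_cong[symmetric] C_cong[symmetric])
  then show "C (\<lambda>t. g (pathstart p, t)) / (1 - L (\<lambda>t. g (pathstart p, t))) =
       C p + L p * (C (\<lambda>t. g (pathfinish p, t)) / (1 - L (\<lambda>t. g (pathfinish p, t))))"
    using loop_family(2)[OF h] g(3,4) pc(2) ne by (simp add: pathstart_def pathfinish_def)
qed

text \<open>\<open>h\<close> is a torus, so the two loops have commuting monodromies, and commuting
  affine maps with multipliers other than 1 have the same fixed point.\<close>

lemma fixed_points_commuting:
  assumes h: "continuous_on ({0..1} \<times> {0..1}) h" "h ` ({0..1} \<times> {0..1}) \<subseteq> X"
    and "\<And>s. h (s, 1::real) = h (s::real, 0::real)" "\<And>s. h (1, s) = h (0, s)"
    and "L (\<lambda>s. h (s, 0)) \<noteq> 1" "L (\<lambda>s. h (0, s)) \<noteq> 1"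
  shows "C (\<lambda>s. h (s, 0)) / (1 - L (\<lambda>s. h (s, 0))) = C (\<lambda>s. h (0, s)) / (1 - L (\<lambda>s. h (0, s)))"
  using square(2)[OF h] assms(3-6) by (simp add: field_simps)

end

locale affine_system_normed = affine_system X L C for X :: "'a::real_normed_vector set" and L C +
  assumes open_X: "open X"
begin

lemma flat_convex:
  assumes K: "convex K" "K \<subseteq> X" "k0 \<in> K"
  shows "\<exists>s. flat K s \<and> s k0 = v"
proof -
  define D where "D = (\<lambda>(t::real, x). (1 - t) *\<^sub>R x + t *\<^sub>R k0)"
  have "continuous_on ({0..1} \<times> K) D"
    unfolding D_def case_prod_unfold by (intro continuous_intros)
  moreover have "D ` ({0..1} \<times> K) \<subseteq> X"
    using convexD_alt[OF K(1) _ K(3)] K(2) by (auto simp: D_def)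
  moreover have "flat {k0} (\<lambda>_. v)"
    unfolding flat_def
  proof (intro allI impI)
    fix p assume p: "path_in {k0} p"
    have "L p = L (\<lambda>_. k0)" "C p = C (\<lambda>_. k0)"
      by (intro L_cong C_cong; use p K(2,3) in \<open>auto simp: path_in_iff\<close>)+
    then show "v = C p + L p * v" using const_path[of k0] K(2,3) by auto
  qed
  ultimately have "flat K (\<lambda>x. C (\<lambda>t. D (t, x)) + L (\<lambda>t. D (t, x)) * v)"
    by (intro flat_deformation[where S' = "{k0}"]) (auto simp: D_def)
  moreover have "(\<lambda>t. D (t, k0)) = (\<lambda>_. k0)"
    by (auto simp: D_def fun_eq_iff simp flip: scaleR_add_left)
  then have "C (\<lambda>t. D (t, k0)) + L (\<lambda>t. D (t, k0)) * v = v"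
    using const_path[of k0] K(2,3) by auto
  ultimately show ?thesis by blast
qed

text \<open>On a ball a flat section exists with any prescribed value at one point. Prescribing a
  value of \<open>s\<close> makes it agree with \<open>s\<close> on the whole connected set
  \<open>ball x e \<inter> S\<close>, so the local extensions are determined by \<open>s\<close> and
  fit together.\<close>

lemma flat_extend:
  assumes s: "flat S s" "S \<subseteq> X"
    and conn: "\<And>x e. x \<in> X \<Longrightarrow> 0 < e \<Longrightarrow> ball x e \<subseteq> X \<Longrightarrow> ball x e \<inter> S \<noteq> {} \<and> path_connected (ball x e \<inter> S)"
  shows "\<exists>s'. flat X s'"
proof -
  have ball_flat: "\<exists>\<sigma>. flat (ball x e) \<sigma> \<and> \<sigma> y = v" if "ball x e \<subseteq> X" "y \<in> ball x e" for x y e v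
    using flat_convex[OF convex_ball that] .
  have "\<exists>e \<sigma>. 0 < e \<and> ball x e \<subseteq> X \<and> flat (ball x e) \<sigma> \<and> (\<forall>y\<in>ball x e \<inter> S. \<sigma> y = s y)"
    if x: "x \<in> X" for x
  proof -
    obtain e where e: "0 < e" "ball x e \<subseteq> X" using open_X x by (meson openE)
    then obtain y where y: "y \<in> ball x e \<inter> S" using conn[OF x] by blast
    then obtain \<sigma> where \<sigma>: "flat (ball x e) \<sigma>" "\<sigma> y = s y" using ball_flat[OF e(2)] by blast
    have "\<sigma> z = s z" if "z \<in> ball x e \<inter> S" for z
      by (rule flat_eqI[of "ball x e \<inter> S" \<sigma> s y])
         (use that y \<sigma> s e conn[OF x e] in \<open>auto intro: flat_subset\<close>)
    then show ?thesis using e \<sigma> by blast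
  qed
  then obtain e \<sigma> where e: "\<And>x. x \<in> X \<Longrightarrow> 0 < e x" "\<And>x. x \<in> X \<Longrightarrow> ball x (e x) \<subseteq> X"
    and \<sigma>: "\<And>x. x \<in> X \<Longrightarrow> flat (ball x (e x)) (\<sigma> x)"
      "\<And>x y. x \<in> X \<Longrightarrow> y \<in> ball x (e x) \<Longrightarrow> y \<in> S \<Longrightarrow> \<sigma> x y = s y"
    by (metis IntI)
  \<comment> \<open>A smaller ball inside both balls contains a point of \<open>S\<close>, where
    both sections equal \<open>s\<close>; on this ball they therefore agree, in particular at its
    centre \<open>y\<close>.\<close>
  have eq: "\<sigma> y y = \<sigma> x y" if x: "x \<in> X" and y: "y \<in> ball x (e x)" for x y
  proof -
    have yX: "y \<in> X" using e(2)[OF x] y by blast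
    have "open (ball x (e x) \<inter> ball y (e y))" by auto
    moreover have "y \<in> ball x (e x) \<inter> ball y (e y)" using e(1)[OF yX] y by simp
    ultimately obtain d where d: "0 < d" "ball y d \<subseteq> ball x (e x) \<inter> ball y (e y)"
      by (meson openE)
    then have dX: "ball y d \<subseteq> X" using e(2)[OF x] by blast
    obtain z where z: "z \<in> ball y d \<inter> S" using conn[OF yX d(1) dX] by blast
    show ?thesis
    proof (rule flat_eqI[of "ball y d" "\<sigma> y" "\<sigma> x" z])
      show "flat (ball y d) (\<sigma> y)" "flat (ball y d) (\<sigma> x)"
        using \<sigma>(1)[OF yX] \<sigma>(1)[OF x] d(2) by (auto intro: flat_subset)
      show "\<sigma> y z = \<sigma> x z" using \<sigma>(2)[OF x, of z] \<sigma>(2)[OF yX, of z] z d(2) by (auto simp: subset_iff)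
    qed (use z d dX in \<open>auto intro: convex_imp_path_connected\<close>)
  qed
  have "flat X (\<lambda>x. \<sigma> x x)"
  proof (rule flat_local)
    fix x assume x: "x \<in> X"
    have "openin (top_of_set X) (ball x (e x))" using e(2)[OF x] by (simp add: open_subset)
    moreover have "flat (ball x (e x)) (\<lambda>x. \<sigma> x x)"
      using \<sigma>(1)[OF x] by (rule flat_cong) (simp add: eq[OF x])
    ultimately show "\<exists>U. openin (top_of_set X) U \<and> x \<in> U \<and> flat U (\<lambda>x. \<sigma> x x)"
      using e(1)[OF x] by (auto intro!: exI[of _ "ball x (e x)"])
  qed simp
  then show ?thesis by blast
qed

end

text \<open>The coordinates \<open>(b, w)\<close> are adapted to the projection \<open>(b, w) \<mapsto> b\<close>: the hyperplanes in \<open>K\<close> are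
  preimages of lines of the base, those in \<open>J\<close> are graphs. \<open>B\<close> below consists of the points of the base
  over which the graphs do not meet.\<close>

locale pencil =
  fixes K J :: "nat set" and \<kappa> \<phi> :: "nat \<Rightarrow> complex \<times> complex" and t :: "nat \<Rightarrow> complex"
    and X :: "((complex \<times> complex) \<times> complex) set" and L C
  assumes finite_K: "finite K" and finite_J: "finite J"
    and X_def: "X = {(b, w). (\<forall>k\<in>K. lin (\<kappa> k) b \<noteq> 0) \<and> (\<forall>j\<in>J. w \<noteq> lin (\<phi> j) b)}"
    and system: "affine_system X L C"
    and disjoint: "K \<inter> J = {}"
    and meridian: "\<And>i b v w y. i \<in> K \<union> J \<Longrightarrow>
      (\<And>z. cmod z \<le> 1 \<Longrightarrow> (\<forall>k\<in>K. lin (\<kappa> k) (b + sp z v) = 0 \<longleftrightarrow> k = i \<and> z = 0) \<and>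
           (\<forall>j\<in>J. w + z * y = lin (\<phi> j) (b + sp z v) \<longleftrightarrow> j = i \<and> z = 0)) \<Longrightarrow>
      L (\<lambda>s. (b + sp (ee s) v, w + ee s * y)) = t i"
begin

sublocale affine_system X L C by (rule system)

lemma meridian_base:
  assumes "i \<in> K" "\<And>z. cmod z \<le> 1 \<Longrightarrow> (\<forall>k\<in>K. lin (\<kappa> k) (b + sp z v) = 0 \<longleftrightarrow> k = i \<and> z = 0) \<and>
           (\<forall>j\<in>J. w + z * y \<noteq> lin (\<phi> j) (b + sp z v))"
  shows "L (\<lambda>s. (b + sp (ee s) v, w + ee s * y)) = t i"
  by (rule meridian) (use assms disjoint in auto)

lemma meridian_fibre:
  assumes "i \<in> J" "\<And>z. cmod z \<le> 1 \<Longrightarrow> (\<forall>k\<in>K. lin (\<kappa> k) b \<noteq> 0) \<and>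
           (\<forall>j\<in>J. w + z * y = lin (\<phi> j) b \<longleftrightarrow> j = i \<and> z = 0)"
  shows "L (\<lambda>s. (b, w + ee s * y)) = t i"
proof -
  have z: "b + sp z 0 = b" for z by (simp add: sp_def flip: zero_prod_def)
  have "L (\<lambda>s. (b + sp (ee s) 0, w + ee s * y)) = t i"
    by (rule meridian) (unfold z, use assms disjoint in auto)
  then show ?thesis by (simp only: z)
qed

lemma X_iff:
  "x \<in> X \<longleftrightarrow> (\<forall>k\<in>K. lin (\<kappa> k) (fst x) \<noteq> 0) \<and> (\<forall>j\<in>J. snd x \<noteq> lin (\<phi> j) (fst x))"
  unfolding X_def by (simp add: case_prod_unfold)

definition B :: "(complex \<times> complex) set" where
  "B = {b. (\<forall>k\<in>K. lin (\<kappa> k) b \<noteq> 0) \<and> (\<forall>i\<in>J. \<forall>j\<in>J. i \<noteq> j \<longrightarrow> lin (\<phi> i - \<phi> j) b \<noteq> 0)}"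

definition X' :: "((complex \<times> complex) \<times> complex) set" where
  "X' = {x \<in> X. fst x \<in> B}"

definition fib :: "complex \<times> complex \<Rightarrow> ((complex \<times> complex) \<times> complex) set" where
  "fib b = {x \<in> X. fst x = b}"

lemma B_inj: "b \<in> B \<Longrightarrow> i \<in> J \<Longrightarrow> j \<in> J \<Longrightarrow> lin (\<phi> i) b = lin (\<phi> j) b \<Longrightarrow> i = j"
  by (force simp: B_def lin_diff_left)

lemma fib_eq: "b \<in> B \<Longrightarrow> fib b = {b} \<times> (- (\<lambda>j. lin (\<phi> j) b) ` J)"
  by (auto simp: fib_def X_iff B_def)

lemma fib_subset: "fib b \<subseteq> X"
  by (auto simp: fib_def)

lemma open_X: "open X"
proof -
  have "X = (\<Inter>k\<in>K. {x. lin (\<kappa> k) (fst x) \<noteq> 0}) \<inter> (\<Inter>j\<in>J. {x. snd x \<noteq> lin (\<phi> j) (fst x)})"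
    by (auto simp: X_iff)
  also have "open \<dots>"
    by (intro open_Int open_INT ballI finite_K finite_J open_Collect_neq continuous_intros)
  finally show ?thesis .
qed

sublocale affine_system_normed X L C
  by unfold_locales (rule open_X)

lemma open_B: "open B"
proof -
  have "B = (\<Inter>k\<in>K. {b. lin (\<kappa> k) b \<noteq> 0}) \<inter> (\<Inter>i\<in>J. \<Inter>j\<in>J - {i}. {b. lin (\<phi> i - \<phi> j) b \<noteq> 0})"
    by (auto simp: B_def)
  also have "open \<dots>"
    by (intro open_Int open_INT ballI finite_K finite_J finite_Diff open_Collect_neq continuous_intros)
  finally show ?thesis .
qed

lemma path_connected_fib:
  assumes "b \<in> B"
  shows "path_connected (fib b)"
proof -
  have "path_connected (UNIV - (\<lambda>j. lin (\<phi> j) b) ` J)"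
    using finite_J by (intro path_connected_open_diff_countable) (auto intro: countable_finite)
  then show ?thesis
    unfolding fib_eq[OF assms] by (intro path_connected_Times) (auto simp: Compl_eq_Diff_UNIV)
qed

lemma small_circle:
  assumes b: "b \<in> B" and i: "i \<in> J"
  shows "\<exists>d>0. \<forall>h. 0 < h \<and> h < d \<longrightarrow>
    path_in (fib b) (\<lambda>s. (b, lin (\<phi> i) b + ee s * of_real h)) \<and>
    L (\<lambda>s. (b, lin (\<phi> i) b + ee s * of_real h)) = t i"
proof -
  let ?F = "(\<lambda>j. cmod (lin (\<phi> j) b - lin (\<phi> i) b)) ` (J - {i})"
  define d where "d = Min (insert 1 ?F)"
  have fin: "finite (insert 1 ?F)" using finite_J by simp
  have pos: "0 < x" if "x \<in> insert 1 ?F" for x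
    using that B_inj[OF b] i by auto
  have "d \<in> insert 1 ?F" unfolding d_def by (rule Min_in[OF fin]) simp
  then have "0 < d" using pos by blast
  have far: "d \<le> cmod (lin (\<phi> j) b - lin (\<phi> i) b)" if "j \<in> J" "j \<noteq> i" for j
    unfolding d_def by (rule Min_le[OF fin]) (use that in auto)
  show ?thesis
  proof (intro exI[of _ d] conjI allI impI \<open>0 < d\<close>)
    fix h assume h: "0 < h \<and> h < d"
    have iff: "lin (\<phi> i) b + z * of_real h = lin (\<phi> j) b \<longleftrightarrow> j = i \<and> z = 0"
      if z: "cmod z \<le> 1" and j: "j \<in> J" for z j
    proof (cases "j = i")
      case True then show ?thesis using h by auto
    next
      case False
      have "lin (\<phi> i) b + z * of_real h \<noteq> lin (\<phi> j) b"
      proof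
        assume "lin (\<phi> i) b + z * of_real h = lin (\<phi> j) b"
        then have "lin (\<phi> j) b - lin (\<phi> i) b = z * of_real h" by (simp add: algebra_simps)
        then have "cmod (lin (\<phi> j) b - lin (\<phi> i) b) = cmod z * h" using h by (simp add: norm_mult)
        also have "\<dots> \<le> 1 * h" using h z by (intro mult_right_mono) auto
        finally show False using far[OF j False] h by simp
      qed
      with False show ?thesis by simp
    qed
    show "L (\<lambda>s. (b, lin (\<phi> i) b + ee s * of_real h)) = t i"
      by (rule meridian_fibre[OF i]) (use iff b in \<open>auto simp: B_def\<close>)
    show "path_in (fib b) (\<lambda>s. (b, lin (\<phi> i) b + ee s * of_real h))"
      unfolding path_in_iff fib_eq[OF b] using iff[of "ee _"]
      by (auto intro!: continuous_intros)
  qed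
qed

text \<open>A small circle around the puncture of \<open>i\<close> has multiplier
  \<open>t i \<noteq> 1\<close>, which pins down the value of a flat section at one point; the fibre
  is connected.\<close>

lemma flat_fib_unique:
  assumes b: "b \<in> B" and s: "flat (fib b) s" "flat (fib b) s'" and "x \<in> fib b"
    and i: "i \<in> J" "t i \<noteq> 1"
  shows "s x = s' x"
proof -
  obtain h where h: "path_in (fib b) (\<lambda>s. (b, lin (\<phi> i) b + ee s * of_real h))"
    "L (\<lambda>s. (b, lin (\<phi> i) b + ee s * of_real h)) = t i"
    using small_circle[OF b i(1)] by (metis field_lbound_gt_zero)
  let ?p = "\<lambda>s. (b, lin (\<phi> i) b + ee s * of_real h)"
  have cl: "pathfinish ?p = pathstart ?p" by (simp add: pathstart_def pathfinish_def)
  have "s (pathstart ?p) = s' (pathstart ?p)"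
    using flat_loop_unique[OF s(1) h(1) cl] flat_loop_unique[OF s(2) h(1) cl] h(2) i(2) by simp
  moreover have "pathstart ?p \<in> fib b"
    using h(1) by (auto simp: path_in_def)
  ultimately show ?thesis
    using flat_eqI[OF s fib_subset path_connected_fib[OF b] _ assms(4)] by blast
qed

subsection \<open>Neighbouring fibres\<close>

text \<open>The displacement field moving the points \<open>lin (\<phi> j) b\<^sub>1\<close> to \<open>lin (\<phi> j) b\<^sub>0\<close>, supported in
  disjoint discs of radius \<open>r\<close>.\<close>

definition shift :: "real \<Rightarrow> complex \<times> complex \<Rightarrow> complex \<times> complex \<Rightarrow> complex \<Rightarrow> complex" where
  "shift r b0 b1 w = (\<Sum>j\<in>J. of_real (max 0 (1 - cmod (w - lin (\<phi> j) b1) / r)) *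
     (lin (\<phi> j) b0 - lin (\<phi> j) b1))"

text \<open>It is enough that the displacement at \<open>w\<close> differs from that of the puncture
  \<open>i\<close> by less than the distance of \<open>w\<close> from it. At distance less than
  \<open>r\<close> only the bump of \<open>i\<close> acts, and the difference is proportional to
  this distance. Farther away, the bound on the single displacements keeps the sum over
  \<open>J\<close> and that of \<open>i\<close> below \<open>r / 2\<close> each.\<close>

lemma shift_avoids:
  assumes r: "0 < r" and sep: "\<And>i j. i \<in> J \<Longrightarrow> j \<in> J \<Longrightarrow> i \<noteq> j \<Longrightarrow> 2 * r \<le> cmod (lin (\<phi> i) b1 - lin (\<phi> j) b1)"
    and near: "\<And>j. j \<in> J \<Longrightarrow> cmod (lin (\<phi> j) b0 - lin (\<phi> j) b1) < r / (2 * (card J + 1))"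
    and i: "i \<in> J" and \<tau>: "0 \<le> \<tau>" "\<tau> \<le> (1::real)" and w: "w \<noteq> lin (\<phi> i) b1"
  shows "w + of_real \<tau> * shift r b0 b1 w \<noteq> lin (\<phi> i) b1 + of_real \<tau> * (lin (\<phi> i) b0 - lin (\<phi> i) b1)"
proof -
  define d where "d j = lin (\<phi> j) b0 - lin (\<phi> j) b1" for j
  define \<beta> where "\<beta> j = max 0 (1 - cmod (w - lin (\<phi> j) b1) / r)" for j
  have sh: "shift r b0 b1 w = (\<Sum>j\<in>J. of_real (\<beta> j) * d j)"
    by (simp add: shift_def \<beta>_def d_def)
  have N: "real (card J) * (r / (2 * (card J + 1))) < r / 2" "r / (2 * (card J + 1)) \<le> r / 2"
    using r by (auto simp: field_simps)
  have di: "cmod (d i) < r / 2" unfolding d_def using near[OF i] N(2) by linarith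
  let ?e = "w - lin (\<phi> i) b1"
  have e0: "0 < cmod ?e" using w by simp
  have "cmod (of_real \<tau> * (shift r b0 b1 w - d i)) < cmod ?e"
  proof (cases "cmod ?e < r")
    case False
    have "cmod (shift r b0 b1 w) \<le> (\<Sum>j\<in>J. cmod (of_real (\<beta> j) * d j))"
      unfolding sh by (rule norm_sum)
    also have "\<dots> \<le> (\<Sum>j\<in>J. r / (2 * (card J + 1)))"
    proof (rule sum_mono)
      fix j assume j: "j \<in> J"
      have "cmod (of_real (\<beta> j) * d j) = \<beta> j * cmod (d j)" by (simp add: norm_mult \<beta>_def)
      also have "\<dots> \<le> 1 * cmod (d j)" using r by (intro mult_right_mono) (auto simp: \<beta>_def)
      finally show "cmod (of_real (\<beta> j) * d j) \<le> r / (2 * (card J + 1))"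
        using near[OF j] by (simp add: d_def)
    qed
    also have "\<dots> = real (card J) * (r / (2 * (card J + 1)))" by simp
    finally have "cmod (shift r b0 b1 w - d i) < r"
      using N(1) di norm_triangle_ineq4[of "shift r b0 b1 w" "d i"] by linarith
    moreover have "cmod (of_real \<tau> * (shift r b0 b1 w - d i)) \<le> 1 * cmod (shift r b0 b1 w - d i)"
      unfolding norm_mult using \<tau> by (intro mult_right_mono) auto
    ultimately show ?thesis using False by linarith
  next
    case True
    have "\<beta> j = 0" if "j \<in> J - {i}" for j
    proof -
      have "2 * r \<le> cmod (lin (\<phi> i) b1 - lin (\<phi> j) b1)" using sep[of i j] i that by auto
      moreover have "cmod (lin (\<phi> i) b1 - lin (\<phi> j) b1) \<le> cmod (w - lin (\<phi> j) b1) + cmod ?e"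
        using norm_triangle_ineq4[of "w - lin (\<phi> j) b1" ?e] by simp
      ultimately have "r \<le> cmod (w - lin (\<phi> j) b1)" using True by linarith
      then show ?thesis using r by (simp add: \<beta>_def)
    qed
    then have "(\<Sum>j\<in>J - {i}. of_real (\<beta> j) * d j) = 0" by simp
    then have "shift r b0 b1 w = of_real (\<beta> i) * d i"
      unfolding sh using finite_J i by (simp add: sum.remove)
    moreover have "\<beta> i = 1 - cmod ?e / r" using True r by (simp add: \<beta>_def)
    ultimately have "shift r b0 b1 w - d i = of_real (- (cmod ?e / r)) * d i"
      by (simp add: algebra_simps)
    then have "cmod (of_real \<tau> * (shift r b0 b1 w - d i)) = \<tau> * (cmod ?e / r * cmod (d i))"
      using \<tau> r by (simp add: norm_mult norm_divide)
    also have "\<dots> \<le> 1 * (cmod ?e / r * cmod (d i))" using \<tau> r by (intro mult_right_mono) auto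
    also have "\<dots> \<le> cmod ?e / r * (r / 2)"
      unfolding mult_1 using di r by (intro mult_left_mono) auto
    also have "\<dots> < cmod ?e" using e0 r by simp
    finally show ?thesis .
  qed
  then have "?e + of_real \<tau> * (shift r b0 b1 w - d i) \<noteq> 0"
    using norm_minus_cancel by (metis add_eq_0_iff less_irrefl)
  then show ?thesis by (simp add: d_def algebra_simps)
qed

text \<open>All nearby fibres are deformed into the fibre over \<open>b0\<close>. This is claimed
  for every \<open>b0\<close> in the ball, not just for the centre, so that having a flat section
  becomes a locally constant property of the fibre.\<close>

lemma spread:
  assumes b: "b \<in> B"
  shows "\<exists>\<delta>>0. ball b \<delta> \<subseteq> B \<and> (\<forall>b0\<in>ball b \<delta>. \<forall>s. flat (fib b0) s \<longrightarrow>
           (\<exists>s'. flat {x \<in> X. fst x \<in> ball b \<delta>} s'))"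
proof -
  define D where "D = {(i, j). i \<in> J \<and> j \<in> J \<and> i \<noteq> j}"
  have finD: "finite D" unfolding D_def by (rule finite_subset[of _ "J \<times> J"]) (use finite_J in auto)
  define r where "r = Min (insert 1 ((\<lambda>(i, j). cmod (lin (\<phi> i) b - lin (\<phi> j) b)) ` D)) / 4"
  have r: "0 < r"
    unfolding r_def using finD B_inj[OF b] by (auto simp: D_def)
  have r4: "4 * r \<le> cmod (lin (\<phi> i) b - lin (\<phi> j) b)" if "i \<in> J" "j \<in> J" "i \<noteq> j" for i j
    unfolding r_def using finD that by (auto intro!: Min_le simp: D_def)
  \<comment> \<open>Two points of the ball are compared through its centre \<open>b\<close>, which
    doubles the error: \<open>2 * \<eta>\<close> is the bound required in
    \<open>shift_avoids\<close>.\<close>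
  define \<eta> where "\<eta> = r / (4 * (card J + 1))"
  have \<eta>: "0 < \<eta>" using r by (simp add: \<eta>_def)
  have \<eta>r: "2 * \<eta> \<le> r" using r by (simp add: \<eta>_def field_simps)
  have "open (B \<inter> (\<Inter>j\<in>J. {b1. cmod (lin (\<phi> j) b1 - lin (\<phi> j) b) < \<eta>}))"
    using finite_J by (intro open_Int open_B open_INT ballI open_Collect_less continuous_intros) auto
  moreover have "b \<in> B \<inter> (\<Inter>j\<in>J. {b1. cmod (lin (\<phi> j) b1 - lin (\<phi> j) b) < \<eta>})"
    using b \<eta> by auto
  ultimately obtain \<delta> where \<delta>: "0 < \<delta>"
    "ball b \<delta> \<subseteq> B \<inter> (\<Inter>j\<in>J. {b1. cmod (lin (\<phi> j) b1 - lin (\<phi> j) b) < \<eta>})"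
    by (meson openE)
  have ballB: "ball b \<delta> \<subseteq> B" using \<delta>(2) by blast
  have near: "cmod (lin (\<phi> j) b1 - lin (\<phi> j) b) < \<eta>" if "b1 \<in> ball b \<delta>" "j \<in> J" for b1 j
    using \<delta>(2) that by blast
  have near2: "cmod (lin (\<phi> j) b0 - lin (\<phi> j) b1) < r / (2 * (card J + 1))"
    if "b0 \<in> ball b \<delta>" "b1 \<in> ball b \<delta>" "j \<in> J" for b0 b1 j
  proof -
    have "cmod (lin (\<phi> j) b0 - lin (\<phi> j) b1) < 2 * \<eta>"
      using near[OF that(1,3)] near[OF that(2,3)]
        norm_triangle_ineq4[of "lin (\<phi> j) b0 - lin (\<phi> j) b" "lin (\<phi> j) b1 - lin (\<phi> j) b"] by simp
    also have "2 * \<eta> = r / (2 * (card J + 1))" by (simp add: \<eta>_def field_simps)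
    finally show ?thesis .
  qed
  have sep: "2 * r \<le> cmod (lin (\<phi> i) b1 - lin (\<phi> j) b1)"
    if "b1 \<in> ball b \<delta>" "i \<in> J" "j \<in> J" "i \<noteq> j" for b1 i j
  proof -
    have "cmod (lin (\<phi> i) b - lin (\<phi> j) b) \<le> cmod (lin (\<phi> i) b1 - lin (\<phi> j) b1)
       + cmod ((lin (\<phi> i) b1 - lin (\<phi> i) b) - (lin (\<phi> j) b1 - lin (\<phi> j) b))"
      using norm_triangle_ineq4[of "lin (\<phi> i) b1 - lin (\<phi> j) b1"
        "(lin (\<phi> i) b1 - lin (\<phi> i) b) - (lin (\<phi> j) b1 - lin (\<phi> j) b)"] by simp
    moreover have "cmod ((lin (\<phi> i) b1 - lin (\<phi> i) b) - (lin (\<phi> j) b1 - lin (\<phi> j) b)) < 2 * \<eta>"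
      using near[OF that(1,2)] near[OF that(1,3)]
        norm_triangle_ineq4[of "lin (\<phi> i) b1 - lin (\<phi> i) b" "lin (\<phi> j) b1 - lin (\<phi> j) b"] by linarith
    ultimately show ?thesis using r4[OF that(2-4)] \<eta>r r by linarith
  qed
  show ?thesis
  proof (intro exI[of _ \<delta>] conjI ballI allI impI \<delta>(1) ballB)
    fix b0 s assume b0: "b0 \<in> ball b \<delta>" and s: "flat (fib b0) s"
    let ?S = "{x \<in> X. fst x \<in> ball b \<delta>}"
    \<comment> \<open>The base point moves to \<open>b0\<close> along a segment, and the fibre
      coordinate follows the displacement field in proportion.\<close>
    define E where "E = (\<lambda>(\<tau>::real, x). (fst x + \<tau> *\<^sub>R (b0 - fst x),
        snd x + of_real \<tau> * shift r b0 (fst x) (snd x)))"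
    have base: "fst x + \<tau> *\<^sub>R (b0 - fst x) \<in> ball b \<delta>" if "x \<in> ?S" "\<tau> \<in> {0..1}" for x \<tau>
    proof -
      have "(1 - \<tau>) *\<^sub>R fst x + \<tau> *\<^sub>R b0 \<in> ball b \<delta>"
        using that b0 by (intro convexD_alt) auto
      then show ?thesis by (simp add: algebra_simps)
    qed
    have EX: "E (\<tau>, x) \<in> X" if "x \<in> ?S" "\<tau> \<in> {0..1}" for x \<tau>
    proof -
      have x: "fst x \<in> ball b \<delta>" "x \<in> X" using that by auto
      have "snd x + of_real \<tau> * shift r b0 (fst x) (snd x) \<noteq>
          lin (\<phi> i) (fst x) + of_real \<tau> * (lin (\<phi> i) b0 - lin (\<phi> i) (fst x))" if "i \<in> J" for i
        by (rule shift_avoids[OF r sep[OF x(1)] near2[OF b0 x(1)] that])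
           (use x(2) \<open>\<tau> \<in> {0..1}\<close> that in \<open>auto simp: X_iff\<close>)
      moreover have "fst x + \<tau> *\<^sub>R (b0 - fst x) \<in> B" using base[OF that] ballB by blast
      ultimately show ?thesis
        by (auto simp: E_def X_iff B_def lin_add lin_diff lin_scaleR scaleR_conv_of_real)
    qed
    have "continuous_on ({0..1} \<times> ?S) E"
      unfolding E_def case_prod_unfold shift_def using r by (intro continuous_intros) auto
    moreover have "E ` ({0..1} \<times> ?S) \<subseteq> X" using EX by auto
    moreover have "E (0, x) = x" for x by (simp add: E_def)
    moreover have "E (1, x) \<in> fib b0" if "x \<in> ?S" for x
      using EX[OF that, of 1] by (auto simp: fib_def E_def)
    ultimately show "\<exists>s'. flat ?S s'"
      using flat_deformation[OF _ _ _ _ s, of ?S E] by blast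
  qed
qed

section \<open>From a single fibre to the whole complement\<close>

lemma path_connected_hyperplanes:
  assumes "finite Us" "convex U" "open U"
  shows "path_connected {b \<in> U. \<forall>u\<in>Us. lin u b \<noteq> 0}"
proof (rule path_connected_complex_lines[OF assms(2,3)])
  fix a b assume ab: "a \<in> {b \<in> U. \<forall>u\<in>Us. lin u b \<noteq> 0}" "b \<in> {b \<in> U. \<forall>u\<in>Us. lin u b \<noteq> 0}"
  let ?g = "\<lambda>z. sp z (b - a)"
  have "{z. a + ?g z \<notin> {b \<in> U. \<forall>u\<in>Us. lin u b \<noteq> 0} \<and> a + ?g z \<in> U} \<subseteq>
    (\<Union>u\<in>Us. {z. lin u a + z * lin u (b - a) = 0})"
    by (auto simp: lin_add lin_sp)
  moreover have "finite {z. lin u a + z * lin u (b - a) = 0}" if "u \<in> Us" for u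
  proof (rule finite_subset)
    have "z = - lin u a / lin u (b - a)" if z: "lin u a + z * lin u (b - a) = 0" for z
    proof -
      have "lin u (b - a) \<noteq> 0" using z ab \<open>u \<in> Us\<close> by auto
      moreover have "z * lin u (b - a) = - lin u a" using z by (simp add: eq_neg_iff_add_eq_0 add.commute)
      ultimately show ?thesis by (simp add: field_simps)
    qed
    then show "{z. lin u a + z * lin u (b - a) = 0} \<subseteq> {- lin u a / lin u (b - a)}" by auto
  qed simp
  ultimately have "finite {z. a + ?g z \<notin> {b \<in> U. \<forall>u\<in>Us. lin u b \<noteq> 0} \<and> a + ?g z \<in> U}"
    using assms(1) by (meson finite_UN finite_subset)
  moreover have "linear ?g"
    by (rule linearI) (auto simp: sp_def algebra_simps scaleR_conv_of_real)
  moreover have "?g 1 = b - a" by (simp add: sp_def prod_eq_iff)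
  ultimately show "\<exists>g :: complex \<Rightarrow> complex \<times> complex. linear g \<and> g 1 = b - a \<and>
      finite {z. a + g z \<notin> {b \<in> U. \<forall>u\<in>Us. lin u b \<noteq> 0} \<and> a + g z \<in> U}"
    by blast
qed auto

text \<open>Having a flat section is locally constant along the connected base \<open>B\<close>. The
  sections on the fibres can be chosen independently: by \<open>t i \<noteq> 1\<close> each is
  unique, so it agrees with every section defined over a neighbourhood.\<close>

lemma flat_from_fibre:
  assumes b0: "b0 \<in> B" "flat (fib b0) s0" and i: "i \<in> J" "t i \<noteq> 1"
  shows "\<exists>s. flat X' s"
proof -
  let ?Us = "\<kappa> ` K \<union> (\<lambda>(i, j). \<phi> i - \<phi> j) ` {(i, j). i \<in> J \<and> j \<in> J \<and> i \<noteq> j}"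
  have "finite {(i, j). i \<in> J \<and> j \<in> J \<and> i \<noteq> j}"
    by (rule finite_subset[of _ "J \<times> J"]) (use finite_J in auto)
  then have "path_connected {b \<in> UNIV. \<forall>u\<in>?Us. lin u b \<noteq> 0}"
    using finite_K by (intro path_connected_hyperplanes) auto
  moreover have "{b \<in> UNIV. \<forall>u\<in>?Us. lin u b \<noteq> 0} = B"
    by (auto simp: B_def)
  ultimately have conn: "connected B" by (simp add: path_connected_imp_connected)
  define P where "P b \<longleftrightarrow> (\<exists>s. flat (fib b) s)" for b
  have sub: "fib b1 \<subseteq> {x \<in> X. fst x \<in> S}" if "b1 \<in> S" for b1 S
    using that by (auto simp: fib_def)
  have P: "P b" if "b \<in> B" for b
  proof -
    have "P b0 \<longleftrightarrow> P b"
    proof (rule connected_equivalence_relation[OF conn b0(1) that, of "\<lambda>x y. P x \<longleftrightarrow> P y"])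
      fix a assume a: "a \<in> B"
      obtain \<delta> where \<delta>: "0 < \<delta>" "ball a \<delta> \<subseteq> B" "\<And>b0 s. b0 \<in> ball a \<delta> \<Longrightarrow> flat (fib b0) s \<Longrightarrow>
           \<exists>s'. flat {x \<in> X. fst x \<in> ball a \<delta>} s'"
        using spread[OF a] by blast
      have that: "P x \<Longrightarrow> P y" if "x \<in> ball a \<delta>" "y \<in> ball a \<delta>" for x y
        using \<delta>(3)[OF that(1)] flat_subset[OF _ sub[OF that(2)]] by (auto simp: P_def)
      then show "\<exists>T. openin (top_of_set B) T \<and> a \<in> T \<and> (\<forall>x\<in>T. P a \<longleftrightarrow> P x)"
      proof (intro exI[of _ "ball a \<delta>"] conjI ballI)
        show "openin (top_of_set B) (ball a \<delta>)" using \<delta>(2) by (intro open_subset) auto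
        fix x assume "x \<in> ball a \<delta>"
        moreover have "a \<in> ball a \<delta>" using \<delta>(1) by simp
        ultimately show "P a \<longleftrightarrow> P x" using that by blast
      qed (use \<delta>(1) in simp)
    qed auto
    then show ?thesis using b0 by (auto simp: P_def)
  qed
  define \<sigma> where "\<sigma> b = (SOME s. flat (fib b) s)" for b
  have \<sigma>: "flat (fib b) (\<sigma> b)" if "b \<in> B" for b
    unfolding \<sigma>_def using P[OF that] unfolding P_def by (rule someI_ex)
  have "flat X' (\<lambda>x. \<sigma> (fst x) x)"
  proof (rule flat_local)
    fix x assume x: "x \<in> X'"
    then have xB: "fst x \<in> B" by (auto simp: X'_def)
    obtain \<delta> where \<delta>: "0 < \<delta>" "ball (fst x) \<delta> \<subseteq> B" "\<And>b0 s. b0 \<in> ball (fst x) \<delta> \<Longrightarrow> flat (fib b0) s \<Longrightarrow>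
           \<exists>s'. flat {y \<in> X. fst y \<in> ball (fst x) \<delta>} s'"
      using spread[OF xB] by blast
    let ?S = "{y \<in> X. fst y \<in> ball (fst x) \<delta>}"
    obtain s' where s': "flat ?S s'"
      using \<delta>(3)[OF _ \<sigma>[OF xB]] \<delta>(1) by auto
    have "flat ?S (\<lambda>x. \<sigma> (fst x) x)"
    proof (rule flat_cong[OF s'])
      fix y assume y: "y \<in> ?S"
      then have "fst y \<in> B" using \<delta>(2) by auto
      then show "s' y = \<sigma> (fst y) y"
        using flat_fib_unique[OF _ flat_subset[OF s' sub[of "fst y"]] \<sigma> _ i] y by (auto simp: fib_def)
    qed
    moreover have "?S = X' \<inter> (ball (fst x) \<delta> \<times> UNIV)"
      using \<delta>(2) by (auto simp: X'_def)
    then have "openin (top_of_set X') ?S"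
      by (metis openin_open_Int open_Times open_ball open_UNIV)
    ultimately show "\<exists>U. openin (top_of_set X') U \<and> x \<in> U \<and> flat U (\<lambda>x. \<sigma> (fst x) x)"
      using x \<delta>(1) by (intro exI[of _ ?S]) (auto simp: X'_def)
  qed (auto simp: X'_def)
  then show ?thesis by blast
qed

text \<open>None of the finitely many forms vanishes on \<open>v\<close>, so on the line through
  \<open>b\<close> in direction \<open>v\<close> each has at most one zero.\<close>

lemma ball_B_nonempty:
  assumes "v \<in> B" "0 < e"
  shows "\<exists>b1. dist b b1 < e \<and> b1 \<in> B"
proof -
  let ?Us = "\<kappa> ` K \<union> (\<lambda>(i, j). \<phi> i - \<phi> j) ` {(i, j). i \<in> J \<and> j \<in> J \<and> i \<noteq> j}"
  have "finite {(i, j). i \<in> J \<and> j \<in> J \<and> i \<noteq> j}"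
    by (rule finite_subset[of _ "J \<times> J"]) (use finite_J in auto)
  then have fin: "finite ?Us" using finite_K by auto
  have B_eq: "b \<in> B \<longleftrightarrow> (\<forall>u\<in>?Us. lin u b \<noteq> 0)" for b
    by (auto simp: B_def)
  have "finite ((\<lambda>u. - lin u b / lin u v) ` ?Us)" using fin by blast
  moreover have "infinite {0<..<e / (norm v + 1)}"
  proof -
    have "0 < e / (norm v + 1)" using assms(2) by (intro divide_pos_pos) (auto intro: add_nonneg_pos)
    then show ?thesis by (simp add: infinite_Ioo)
  qed
  then have "infinite (complex_of_real ` {0<..<e / (norm v + 1)})"
    by (simp add: finite_image_iff inj_on_def)
  ultimately obtain z where z: "z \<in> complex_of_real ` {0<..<e / (norm v + 1)}"
    "z \<notin> (\<lambda>u. - lin u b / lin u v) ` ?Us"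
    by (meson finite_subset subsetI)
  obtain x where x: "z = of_real x" "0 < x" "x < e / (norm v + 1)" using z(1) by auto
  have "lin u (b + sp z v) \<noteq> 0" if u: "u \<in> ?Us" for u
  proof
    assume "lin u (b + sp z v) = 0"
    then have "z * lin u v = - lin u b" by (simp add: lin_add lin_sp eq_neg_iff_add_eq_0 add.commute)
    moreover have "lin u v \<noteq> 0" using assms(1) u by (auto simp: B_eq)
    ultimately have "z = - lin u b / lin u v" by (simp add: field_simps)
    then show False using z(2) u by blast
  qed
  then have "b + sp z v \<in> B" by (simp add: B_eq)
  moreover have "sp z v = x *\<^sub>R v" by (simp add: sp_def x(1) prod_eq_iff scaleR_conv_of_real)
  then have "dist b (b + sp z v) = x * norm v" using x(2) by (simp add: dist_norm)
  moreover have "x * norm v < e"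
  proof -
    have "x * (norm v + 1) < e" using x(3) by (simp add: pos_less_divide_eq add_nonneg_pos)
    moreover have "x * norm v \<le> x * (norm v + 1)" using x(2) by simp
    ultimately show ?thesis by linarith
  qed
  ultimately show ?thesis by metis
qed

lemma path_connected_ball_X':
  assumes "ball x e \<subseteq> X"
  shows "path_connected (ball x e \<inter> X')"
proof -
  let ?Us = "\<kappa> ` K \<union> (\<lambda>(i, j). \<phi> i - \<phi> j) ` {(i, j). i \<in> J \<and> j \<in> J \<and> i \<noteq> j}"
  have "finite {(i, j). i \<in> J \<and> j \<in> J \<and> i \<noteq> j}"
    by (rule finite_subset[of _ "J \<times> J"]) (use finite_J in auto)
  then have fin: "finite ?Us" using finite_K by auto
  have B_eq: "b \<in> B \<longleftrightarrow> (\<forall>u\<in>?Us. lin u b \<noteq> 0)" for b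
    by (auto simp: B_def)
  show ?thesis
  proof (rule path_connected_complex_lines[of "ball x e"])
    fix a b assume ab: "a \<in> ball x e \<inter> X'" "b \<in> ball x e \<inter> X'"
    let ?g = "\<lambda>z. (sp z (fst b - fst a), z * (snd b - snd a))"
    have lin_g: "linear ?g"
      by (rule linearI) (auto simp: sp_def algebra_simps scaleR_conv_of_real)
    have g1: "?g 1 = b - a" by (simp add: sp_def prod_eq_iff)
    have "{z. a + ?g z \<notin> ball x e \<inter> X' \<and> a + ?g z \<in> ball x e} \<subseteq>
       (\<Union>u\<in>?Us. {z. lin u (fst a) + z * lin u (fst b - fst a) = 0})" (is "?bad \<subseteq> ?un")
    proof
      fix z assume z: "z \<in> ?bad"
      then have "a + ?g z \<in> X" "a + ?g z \<notin> X'" using assms by auto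
      then have "fst (a + ?g z) \<notin> B" by (simp add: X'_def)
      then obtain u where u: "u \<in> ?Us" "lin u (fst (a + ?g z)) = 0" unfolding B_eq by blast
      then have "lin u (fst a) + z * lin u (fst b - fst a) = 0" by (simp add: lin_add lin_sp)
      then show "z \<in> ?un" using u(1) by blast
    qed
    moreover have "finite {z. lin u (fst a) + z * lin u (fst b - fst a) = 0}" if u: "u \<in> ?Us" for u
    proof (rule finite_subset)
      have a0: "lin u (fst a) \<noteq> 0" using ab(1) u by (auto simp: X'_def B_eq)
      have "z = - lin u (fst a) / lin u (fst b - fst a)"
        if z: "lin u (fst a) + z * lin u (fst b - fst a) = 0" for z
      proof -
        have "lin u (fst b - fst a) \<noteq> 0" using z a0 by auto
        moreover have "z * lin u (fst b - fst a) = - lin u (fst a)"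
          using z by (simp add: eq_neg_iff_add_eq_0 add.commute)
        ultimately show ?thesis by (simp add: field_simps)
      qed
      then show "{z. lin u (fst a) + z * lin u (fst b - fst a) = 0} \<subseteq> {- lin u (fst a) / lin u (fst b - fst a)}"
        by auto
    qed simp
    ultimately have "finite ?bad" using fin by (meson finite_UN finite_subset)
    with lin_g g1 show "\<exists>g :: complex \<Rightarrow> (complex \<times> complex) \<times> complex. linear g \<and> g 1 = b - a \<and>
        finite {z. a + g z \<notin> ball x e \<inter> X' \<and> a + g z \<in> ball x e}" by blast
  qed auto
qed

text \<open>The points of \<open>X\<close> outside \<open>X'\<close> lie on finitely many complex
  planes where two graphs meet. Removing these neither empties nor disconnects a ball in
  \<open>X\<close>.\<close>

lemma flat_from_X':
  assumes s: "flat X' s" and v: "v \<in> B"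
  shows "\<exists>s. flat X s"
proof (rule flat_extend[OF s])
  show "X' \<subseteq> X" by (auto simp: X'_def)
  fix x e assume x: "x \<in> X" "0 < (e::real)" "ball x e \<subseteq> X"
  obtain b1 where b1: "dist (fst x) b1 < e" "b1 \<in> B" using ball_B_nonempty[OF v x(2)] by blast
  have "(b1, snd x) \<in> ball x e" using b1(1) by (cases x) (simp add: dist_Pair_Pair)
  then have "(b1, snd x) \<in> ball x e \<inter> X'" using x(3) b1(2) by (auto simp: X'_def)
  then show "ball x e \<inter> X' \<noteq> {} \<and> path_connected (ball x e \<inter> X')"
    using path_connected_ball_X'[OF x(3)] by blast
qed

end

section \<open>A flat section on one fibre close to the plane of \<open>H\<close>\<close>

locale degenerate_fibre = pencil K J \<kappa> \<phi> t X L C for K J \<kappa> \<phi> t X L C +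
  fixes H :: nat and b0 v :: "complex \<times> complex" and M \<rho> \<epsilon> :: real
  assumes H: "H \<in> K" "lin (\<kappa> H) b0 = 0" and others: "\<And>k. k \<in> K \<Longrightarrow> k \<noteq> H \<Longrightarrow> lin (\<kappa> k) b0 \<noteq> 0"
    and v: "v \<in> B"
    and M: "\<And>j. j \<in> J \<Longrightarrow> cmod (lin (\<phi> j) v) < M" "0 < M"
    and \<rho>: "0 < \<rho>" "\<And>i j. i \<in> J \<Longrightarrow> j \<in> J \<Longrightarrow> lin (\<phi> i) b0 \<noteq> lin (\<phi> j) b0 \<Longrightarrow>
          4 * \<rho> \<le> cmod (lin (\<phi> i) b0 - lin (\<phi> j) b0)"
    and \<epsilon>: "0 < \<epsilon>" "\<epsilon> * M < \<rho> / 8" "\<And>k. k \<in> K \<Longrightarrow> k \<noteq> H \<Longrightarrow> \<epsilon> * cmod (lin (\<kappa> k) v) < cmod (lin (\<kappa> k) b0)"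
begin

text \<open>For \<open>cmod z \<le> 1\<close> each puncture \<open>lin (\<phi> j) (bz z)\<close>
  stays within \<open>m\<close> of \<open>lin (\<phi> j) b0\<close>. Different such limits are at
  least \<open>4 * \<rho>\<close> apart and \<open>m < \<rho> / 8\<close>, so the punctures form
  well separated clusters.\<close>

definition m :: real where "m = \<epsilon> * M"

text \<open>A disc in the base with centre \<open>b0\<close> on the line of \<open>H\<close>. Its
  direction \<open>v\<close> is transverse to this line, and \<open>\<epsilon>\<close> is so small
  that the disc stays off the other lines of \<open>K\<close>.\<close>

definition bz :: "complex \<Rightarrow> complex \<times> complex" where
  "bz z = b0 + sp (z * of_real \<epsilon>) v"

lemma m: "0 < m" "m < \<rho> / 8"
  using M(2) \<epsilon> by (auto simp: m_def)

lemma lin_bz: "lin u (bz z) = lin u b0 + z * of_real \<epsilon> * lin u v"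
  by (simp add: bz_def lin_add lin_sp)

lemma bz_near: "j \<in> J \<Longrightarrow> cmod z \<le> 1 \<Longrightarrow> cmod (lin (\<phi> j) (bz z) - lin (\<phi> j) b0) < m"
proof -
  assume j: "j \<in> J" and z: "cmod z \<le> 1"
  have "cmod (lin (\<phi> j) (bz z) - lin (\<phi> j) b0) = cmod z * (\<epsilon> * cmod (lin (\<phi> j) v))"
    using \<epsilon>(1) by (simp add: lin_bz norm_mult)
  also have "\<dots> \<le> 1 * (\<epsilon> * cmod (lin (\<phi> j) v))" using z \<epsilon>(1) by (intro mult_right_mono) auto
  also have "\<dots> < m" unfolding m_def using M(1)[OF j] \<epsilon>(1) by simp
  finally show ?thesis .
qed

lemma base_nonzero: "k \<in> K \<Longrightarrow> cmod z \<le> 1 \<Longrightarrow> lin (\<kappa> k) (bz z) = 0 \<longleftrightarrow> k = H \<and> z = 0"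
proof -
  assume k: "k \<in> K" and z: "cmod z \<le> 1"
  show ?thesis
  proof (cases "k = H")
    case True
    have "lin (\<kappa> H) v \<noteq> 0" using v H(1) by (auto simp: B_def)
    then show ?thesis using True H(2) \<epsilon>(1) by (simp add: lin_bz)
  next
    case False
    have "cmod (z * of_real \<epsilon> * lin (\<kappa> k) v) = cmod z * (\<epsilon> * cmod (lin (\<kappa> k) v))"
      using \<epsilon>(1) by (simp add: norm_mult)
    also have "\<dots> \<le> 1 * (\<epsilon> * cmod (lin (\<kappa> k) v))" using z \<epsilon>(1) by (intro mult_right_mono) auto
    also have "\<dots> < cmod (lin (\<kappa> k) b0)" using \<epsilon>(3)[OF k False] by simp
    finally have "lin (\<kappa> k) b0 + z * of_real \<epsilon> * lin (\<kappa> k) v \<noteq> 0"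
      by (metis add_eq_0_iff less_irrefl norm_minus_cancel)
    then show ?thesis using False by (simp add: lin_bz)
  qed
qed

lemma in_X: "cmod z \<le> 1 \<Longrightarrow> z \<noteq> 0 \<Longrightarrow> (bz z, w) \<in> X \<longleftrightarrow> (\<forall>j\<in>J. w \<noteq> lin (\<phi> j) (bz z))"
  using base_nonzero by (auto simp: X_iff)

lemma bz_1_in_B: "bz 1 \<in> B"
  unfolding B_def
proof (intro CollectI conjI ballI impI)
  fix i j assume ij: "i \<in> J" "j \<in> J" "i \<noteq> j"
  show "lin (\<phi> i - \<phi> j) (bz 1) \<noteq> 0"
  proof (cases "lin (\<phi> i) b0 = lin (\<phi> j) b0")
    case True
    moreover have "lin (\<phi> i - \<phi> j) v \<noteq> 0" using v ij by (auto simp: B_def)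
    ultimately show ?thesis using \<epsilon>(1) by (simp add: lin_bz lin_diff_left)
  next
    case False
    have "cmod (lin (\<phi> i) b0 - lin (\<phi> j) b0) \<le> cmod (lin (\<phi> i - \<phi> j) (bz 1)) +
      cmod (lin (\<phi> i) (bz 1) - lin (\<phi> i) b0) + cmod (lin (\<phi> j) (bz 1) - lin (\<phi> j) b0)"
      using norm_triangle_ineq4[of "lin (\<phi> i - \<phi> j) (bz 1)"
          "(lin (\<phi> i) (bz 1) - lin (\<phi> i) b0) - (lin (\<phi> j) (bz 1) - lin (\<phi> j) b0)"]
        norm_triangle_ineq4[of "lin (\<phi> i) (bz 1) - lin (\<phi> i) b0" "lin (\<phi> j) (bz 1) - lin (\<phi> j) b0"]
      by (simp add: lin_diff_left)
    then show ?thesis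
      using bz_near[OF ij(1), of 1] bz_near[OF ij(2), of 1] \<rho>(2)[OF ij(1,2) False] m \<rho>(1) by auto
  qed
qed (use base_nonzero in auto)

lemma far_avoid: "m \<le> cmod (w - lin (\<phi> j) b0) \<Longrightarrow> j \<in> J \<Longrightarrow> cmod z \<le> 1 \<Longrightarrow> w \<noteq> lin (\<phi> j) (bz z)"
  using bz_near by fastforce

text \<open>The margin \<open>3 * m\<close> leaves room for the motion \<open>trans\<close>, which
  shifts points by less than \<open>2 * m\<close>: they stay at distance more than \<open>m\<close>
  from all cluster centres and so avoid the moving punctures.\<close>

definition outer :: "complex set" where
  "outer = {w. \<forall>j\<in>J. 3 * m < cmod (w - lin (\<phi> j) b0)}"

text \<open>Discs of radius \<open>2 * \<rho>\<close> around different centres are disjoint. As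
  \<open>3 * m < 2 * \<rho>\<close>, these sets and \<open>outer\<close> together cover the fibre
  over \<open>bz 1\<close>.\<close>

definition inner :: "complex \<Rightarrow> complex set" where
  "inner q = ball q (2 * \<rho>) - (\<lambda>j. lin (\<phi> j) (bz 1)) ` J"

lemma other_centre:
  assumes "lin (\<phi> j) b0 \<noteq> q" "q \<in> (\<lambda>j. lin (\<phi> j) b0) ` J" "j \<in> J" "cmod (w - q) < 2 * \<rho>"
  shows "2 * \<rho> < cmod (w - lin (\<phi> j) b0)"
proof -
  obtain i where "i \<in> J" "q = lin (\<phi> i) b0" using assms(2) by blast
  then have "4 * \<rho> \<le> cmod (q - lin (\<phi> j) b0)" using \<rho>(2)[of i j] assms(1,3) by auto
  moreover have "cmod (q - lin (\<phi> j) b0) \<le> cmod (w - lin (\<phi> j) b0) + cmod (w - q)"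
    using norm_triangle_ineq4[of "w - lin (\<phi> j) b0" "w - q"] by simp
  ultimately show ?thesis using assms(4) by linarith
qed

text \<open>Loops turning once around the hyperplane \<open>H\<close>, above the circle \<open>bz (ee s)\<close>; \<open>g\<close> describes the
  simultaneous motion in the fibre direction.\<close>

definition turn :: "(complex \<Rightarrow> real \<Rightarrow> complex) \<Rightarrow> complex \<Rightarrow> real \<Rightarrow> (complex \<times> complex) \<times> complex" where
  "turn g w = (\<lambda>s. (bz (ee s), g w s))"

definition fixpt :: "(complex \<Rightarrow> real \<Rightarrow> complex) \<Rightarrow> complex \<Rightarrow> complex" where
  "fixpt g w = C (turn g w) / (1 - L (turn g w))"

lemma continuous_on_bz [continuous_intros]:
  "continuous_on S f \<Longrightarrow> continuous_on S (\<lambda>x. bz (f x))"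
  unfolding bz_def by (intro continuous_intros)

lemma flat_turn:
  assumes g: "continuous_on (S \<times> {0..1}) (\<lambda>(w, s). g w s)"
    and gX: "\<And>w s. w \<in> S \<Longrightarrow> 0 \<le> s \<Longrightarrow> s \<le> 1 \<Longrightarrow> (bz (ee s), g w s) \<in> X"
    and ends: "\<And>w. w \<in> S \<Longrightarrow> g w 0 = w" "\<And>w. w \<in> S \<Longrightarrow> g w 1 = w"
    and ne: "\<And>w. w \<in> S \<Longrightarrow> L (turn g w) \<noteq> 1"
  shows "flat ({bz 1} \<times> S) (\<lambda>x. fixpt g (snd x))"
proof -
  let ?G = "\<lambda>(x, s). (bz (ee s), g (snd x) s)"
  have "flat ({bz 1} \<times> S) (\<lambda>x. C (\<lambda>t. ?G (x, t)) / (1 - L (\<lambda>t. ?G (x, t))))"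
  proof (rule flat_loops)
    have "continuous_on (({bz 1} \<times> S) \<times> {0..1}) (\<lambda>z. (\<lambda>(w, s). g w s) (snd (fst z), snd z))"
      by (rule continuous_on_compose2[OF g]) (auto intro!: continuous_intros)
    then show "continuous_on (({bz 1} \<times> S) \<times> {0..1}) ?G"
      by (auto simp: case_prod_unfold intro!: continuous_intros)
    show "?G ` (({bz 1} \<times> S) \<times> {0..1}) \<subseteq> X" using gX by auto
    show "L (\<lambda>t. ?G (x, t)) \<noteq> 1" if "x \<in> {bz 1} \<times> S" for x
      using ne[of "snd x"] that by (auto simp: turn_def)
  qed (use ends in auto)
  then show ?thesis by (simp add: fixpt_def turn_def)
qed

lemma L_turn_const:
  assumes g: "continuous_on (S \<times> {0..1}) (\<lambda>(w, s). g w s)"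
    and gX: "\<And>w s. w \<in> S \<Longrightarrow> 0 \<le> s \<Longrightarrow> s \<le> 1 \<Longrightarrow> (bz (ee s), g w s) \<in> X"
    and ends: "\<And>w. w \<in> S \<Longrightarrow> g w 0 = w" "\<And>w. w \<in> S \<Longrightarrow> g w 1 = w"
    and S: "path_connected S" "w \<in> S" "w' \<in> S"
  shows "L (turn g w) = L (turn g w')"
proof -
  have c: "continuous_on (S \<times> {0..1}) (\<lambda>(w, s). (bz (ee s), g w s))"
    using g by (auto simp: case_prod_unfold intro!: continuous_intros)
  have "L (\<lambda>s. (\<lambda>(w, s). (bz (ee s), g w s)) (w, s)) = L (\<lambda>s. (\<lambda>(w, s). (bz (ee s), g w s)) (w', s))"
    by (rule L_loop_const[OF S c]) (use gX ends in auto)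
  then show ?thesis by (simp add: turn_def)
qed

text \<open>With \<open>w\<close> held fixed far from the clusters, the disc over \<open>bz\<close>
  meets the arrangement only in its centre on \<open>H\<close>, so the loop is a meridian of
  \<open>H\<close>.\<close>

lemma L_turn_outer:
  assumes "w \<in> outer"
  shows "L (turn (\<lambda>w s. w) w) = t H"
proof -
  have "w + z * 0 \<noteq> lin (\<phi> j) (b0 + sp z (sp (of_real \<epsilon>) v))" if "cmod z \<le> 1" "j \<in> J" for z j
  proof -
    have "3 * m < cmod (w - lin (\<phi> j) b0)" using assms that by (auto simp: outer_def)
    then show ?thesis using far_avoid[of w j z] that m(1) by (auto simp: bz_def sp_def mult.assoc)
  qed
  moreover have "lin (\<kappa> k) (b0 + sp z (sp (of_real \<epsilon>) v)) = 0 \<longleftrightarrow> k = H \<and> z = 0"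
    if "cmod z \<le> 1" "k \<in> K" for z k
    using base_nonzero[OF that(2,1)] by (simp add: bz_def sp_def mult.assoc)
  ultimately have "L (\<lambda>s. (b0 + sp (ee s) (sp (of_real \<epsilon>) v), w + ee s * 0)) = t H"
    using H(1) by (intro meridian_base) auto
  then show ?thesis by (simp add: turn_def bz_def sp_def mult.assoc)
qed

lemma flat_outer:
  assumes "t H \<noteq> 1"
  shows "flat ({bz 1} \<times> outer) (\<lambda>x. fixpt (\<lambda>w s. w) (snd x))"
proof (rule flat_turn)
  show "(bz (ee s), w) \<in> X" if "w \<in> outer" for w s
  proof (subst in_X)
    show "\<forall>j\<in>J. w \<noteq> lin (\<phi> j) (bz (ee s))"
      using that m(1) by (intro ballI far_avoid) (fastforce simp: outer_def)+
  qed auto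
qed (use assms L_turn_outer in \<open>auto simp: case_prod_unfold intro!: continuous_intros\<close>)

text \<open>The motions used near a cluster of points: rotation about its centre \<open>q\<close>, and, for a single
  point \<open>lin (\<phi> j) b\<close>, translation along with it.\<close>

definition rot :: "complex \<Rightarrow> complex \<Rightarrow> real \<Rightarrow> complex" where
  "rot q w s = q + ee s * (w - q)"

definition trans :: "nat \<Rightarrow> complex \<Rightarrow> real \<Rightarrow> complex" where
  "trans j w s = w + (ee s - 1) * of_real \<epsilon> * lin (\<phi> j) v"

lemma trans_shift: "j \<in> J \<Longrightarrow> cmod ((z - 1) * of_real \<epsilon> * lin (\<phi> j) v) < 2 * m" if "cmod z \<le> 1"
proof -
  assume j: "j \<in> J"
  have "cmod ((z - 1) * of_real \<epsilon> * lin (\<phi> j) v) = cmod (z - 1) * (\<epsilon> * cmod (lin (\<phi> j) v))"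
    using \<epsilon>(1) by (simp add: norm_mult)
  also have "\<dots> \<le> 2 * (\<epsilon> * cmod (lin (\<phi> j) v))"
    using norm_triangle_ineq4[of z 1] \<epsilon>(1) that by (intro mult_right_mono) auto
  also have "\<dots> < 2 * m" unfolding m_def using M(1)[OF j] \<epsilon>(1) by simp
  finally show ?thesis .
qed

text \<open>The punctures of the cluster at \<open>q\<close> are
  \<open>q + z * \<epsilon> * lin (\<phi> j) v\<close>: they rotate rigidly with \<open>z\<close>,
  and \<open>w\<close> rotates along with them.\<close>

lemma rot_in_X:
  assumes q: "q \<in> (\<lambda>j. lin (\<phi> j) b0) ` J" and w: "w \<in> inner q"
  shows "(bz (ee s), rot q w s) \<in> X"
proof (subst in_X)
  show "\<forall>j\<in>J. rot q w s \<noteq> lin (\<phi> j) (bz (ee s))"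
  proof
    fix j assume j: "j \<in> J"
    show "rot q w s \<noteq> lin (\<phi> j) (bz (ee s))"
    proof (cases "lin (\<phi> j) b0 = q")
      case True
      have "w \<noteq> q + of_real \<epsilon> * lin (\<phi> j) v" using w j True by (auto simp: inner_def lin_bz)
      then have "w - q \<noteq> of_real \<epsilon> * lin (\<phi> j) v" by (metis add.commute diff_add_cancel)
      then show ?thesis using True by (simp add: rot_def lin_bz mult.assoc)
    next
      case False
      have "cmod (rot q w s - q) < 2 * \<rho>"
        using w by (simp add: rot_def norm_mult inner_def dist_norm norm_minus_commute)
      from other_centre[OF False q j this] show ?thesis
        using far_avoid[OF _ j, of "rot q w s" "ee s"] m \<rho>(1) by auto
    qed
  qed
qed auto

lemma trans_in_X:
  assumes i: "{j \<in> J. lin (\<phi> j) b0 = q} = {i}" and w: "w \<in> ball q (2 * \<rho>)" "w \<noteq> lin (\<phi> i) (bz 1)"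
    and z: "cmod z \<le> 1" and j: "j \<in> J"
  shows "w + (z - 1) * of_real \<epsilon> * lin (\<phi> i) v \<noteq> lin (\<phi> j) (bz z)"
proof (cases "j = i")
  case True
  then show ?thesis using w(2) by (auto simp: lin_bz algebra_simps)
next
  case False
  have iJ: "i \<in> J" "lin (\<phi> i) b0 = q" using i by auto
  have ne: "lin (\<phi> j) b0 \<noteq> q" using False i j by auto
  have "cmod (w - q) < 2 * \<rho>" using w(1) by (simp add: dist_norm norm_minus_commute)
  from other_centre[OF ne _ j this] have "2 * \<rho> < cmod (w - lin (\<phi> j) b0)" using iJ by auto
  moreover have "cmod (w - lin (\<phi> j) b0) \<le> cmod (w + (z - 1) * of_real \<epsilon> * lin (\<phi> i) v - lin (\<phi> j) b0)
      + cmod ((z - 1) * of_real \<epsilon> * lin (\<phi> i) v)"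
    using norm_triangle_ineq4[of "w + (z - 1) * of_real \<epsilon> * lin (\<phi> i) v - lin (\<phi> j) b0"
        "(z - 1) * of_real \<epsilon> * lin (\<phi> i) v"] by (simp add: algebra_simps)
  ultimately show ?thesis
    using trans_shift[OF z iJ(1)] m \<rho>(1) by (intro far_avoid[OF _ j z]) linarith
qed

lemma path_connected_inner: "path_connected (inner q)"
  unfolding inner_def using finite_J
  by (intro path_connected_open_diff_countable) (auto intro: countable_finite)

text \<open>Moving parallel to the single graph \<open>i\<close>, the loop bounds a disc that meets
  \<open>H\<close> and no graph. This is the normal crossing case, with a meridian of
  \<open>H\<close> again.\<close>

lemma L_turn_trans:
  assumes i: "{j \<in> J. lin (\<phi> j) b0 = q} = {i}" and w: "w \<in> inner q"
  shows "L (turn (trans i) w) = t H"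
proof -
  let ?y = "of_real \<epsilon> * lin (\<phi> i) v"
  have iJ: "i \<in> J" using i by auto
  have w': "w \<in> ball q (2 * \<rho>)" "w \<noteq> lin (\<phi> i) (bz 1)" using w iJ by (auto simp: inner_def)
  have "w - ?y + z * ?y \<noteq> lin (\<phi> j) (b0 + sp z (sp (of_real \<epsilon>) v))" if "cmod z \<le> 1" "j \<in> J" for z j
    using trans_in_X[OF i w' that] by (simp add: bz_def sp_def algebra_simps)
  moreover have "lin (\<kappa> k) (b0 + sp z (sp (of_real \<epsilon>) v)) = 0 \<longleftrightarrow> k = H \<and> z = 0"
    if "cmod z \<le> 1" "k \<in> K" for z k
    using base_nonzero[OF that(2,1)] by (simp add: bz_def sp_def mult.assoc)
  ultimately have "L (\<lambda>s. (b0 + sp (ee s) (sp (of_real \<epsilon>) v), w - ?y + ee s * ?y)) = t H"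
    using H(1) by (intro meridian_base) auto
  moreover have "turn (trans i) w = (\<lambda>s. (b0 + sp (ee s) (sp (of_real \<epsilon>) v), w - ?y + ee s * ?y))"
    by (simp add: turn_def bz_def sp_def trans_def fun_eq_iff algebra_simps)
  ultimately show ?thesis by simp
qed

lemma flat_trans:
  assumes i: "{j \<in> J. lin (\<phi> j) b0 = q} = {i}" and "t H \<noteq> 1"
  shows "flat ({bz 1} \<times> inner q) (\<lambda>x. fixpt (trans i) (snd x))"
proof (rule flat_turn)
  have iJ: "i \<in> J" using i by auto
  show "(bz (ee s), trans i w s) \<in> X" if "w \<in> inner q" for w s
    unfolding trans_def using that trans_in_X[OF i, of w "ee s"] iJ
    by (subst in_X) (auto simp: inner_def)
  show "continuous_on (inner q \<times> {0..1}) (\<lambda>(w, s). trans i w s)"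
    unfolding trans_def case_prod_unfold by (intro continuous_intros)
qed (use assms L_turn_trans in \<open>auto simp: trans_def\<close>)

text \<open>On the overlap the outer loop commutes with the inner one, so their fixed points agree.\<close>

lemma fixpt_agree:
  assumes g: "continuous_on {0..1} (g w)" "g w 0 = w" "g w 1 = w"
    and far: "\<And>s j. j \<in> J \<Longrightarrow> m \<le> cmod (g w s - lin (\<phi> j) b0)"
    and ne: "L (turn (\<lambda>w s. w) w) \<noteq> 1" "L (turn g w) \<noteq> 1"
  shows "fixpt (\<lambda>w s. w) w = fixpt g w"
proof -
  \<comment> \<open>One parameter turns the base alone, the other turns the base and moves the fibre
    coordinate. Together they span a torus, which lies in \<open>X\<close> because
    \<open>g w\<close> stays at distance at least \<open>m\<close> from the cluster centres.\<close>
  let ?h = "\<lambda>(s, \<tau>). (bz (ee s * ee \<tau>), g w \<tau>)"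
  have "continuous_on ({0..1} \<times> {0..1}) ?h"
    unfolding case_prod_unfold
    by (intro continuous_intros continuous_on_compose2[OF g(1)]) auto
  moreover have "?h ` ({0..1} \<times> {0..1}) \<subseteq> X"
    using far far_avoid by (auto simp: in_X norm_mult)
  ultimately show ?thesis
    using fixed_points_commuting[of ?h] ne g(2,3) by (simp add: fixpt_def turn_def)
qed

text \<open>The central loop of the local group. Far out in \<open>inner q\<close> it is the
  diagonal of a torus: the turn in the base contributes \<open>t H\<close>, the circle in the fibre
  encloses the cluster and contributes its product. Connectedness of \<open>inner q\<close> carries
  the value to all \<open>w\<close>.\<close>

lemma L_turn_rot:
  assumes q: "q \<in> (\<lambda>j. lin (\<phi> j) b0) ` J" and w: "w \<in> inner q"
  shows "L (turn (rot q) w) = t H * (\<Prod>j | j \<in> J \<and> lin (\<phi> j) b0 = q. t j)"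
proof -
  let ?I = "{j \<in> J. lin (\<phi> j) b0 = q}"
  define A where "A = (\<lambda>j. lin (\<phi> j) (bz 1)) ` ?I"
  have inj: "inj_on (\<lambda>j. lin (\<phi> j) (bz 1)) ?I"
    using B_inj[OF bz_1_in_B] by (auto intro!: inj_onI)
  have emb: "(bz 1, w) \<in> X" if "w \<in> ball q (2 * \<rho>) - A" for w
  proof (subst in_X)
    show "\<forall>j\<in>J. w \<noteq> lin (\<phi> j) (bz 1)"
    proof
      fix j assume j: "j \<in> J"
      show "w \<noteq> lin (\<phi> j) (bz 1)"
      proof (cases "lin (\<phi> j) b0 = q")
        case True then show ?thesis using that j by (auto simp: A_def)
      next
        case False
        have "cmod (w - q) < 2 * \<rho>" using that by (simp add: dist_norm norm_minus_commute)
        from other_centre[OF False q j this] show ?thesis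
          using m \<rho>(1) by (intro far_avoid[OF _ j]) auto
      qed
    qed
  qed auto
  interpret P: planar_system "ball q (2 * \<rho>)" A "\<lambda>p. L ((\<lambda>w. (bz 1, w)) \<circ> p)" "\<lambda>p. C ((\<lambda>w. (bz 1, w)) \<circ> p)"
  proof (intro planar_system.intro planar_system_axioms.intro pullback)
    show "finite A" using finite_J by (simp add: A_def)
    show "(\<lambda>w. (bz 1, w)) ` (ball q (2 * \<rho>) - A) \<subseteq> X" using emb by auto
  qed (auto intro!: continuous_intros)
  have Aball: "A \<subseteq> ball q m"
  proof
    fix a assume "a \<in> A"
    then obtain j where j: "j \<in> J" "lin (\<phi> j) b0 = q" "a = lin (\<phi> j) (bz 1)" by (auto simp: A_def)
    then show "a \<in> ball q m" using bz_near[OF j(1), of 1] by (simp add: dist_norm norm_minus_commute)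
  qed
  \<comment> \<open>More than \<open>3 * m\<close>, which puts \<open>w0\<close> into
    \<open>outer\<close>; at least \<open>2 * m\<close>, as \<open>circle_prod\<close> requires; and
    less than \<open>2 * \<rho>\<close> since \<open>m < \<rho> / 8\<close>.\<close>
  define R where "R = 4 * m"
  have R: "2 * m \<le> R" "R < 2 * \<rho>" "0 < R" "3 * m < R" using m \<rho>(1) by (auto simp: R_def)
  define w0 where "w0 = q + of_real R"
  have "L ((\<lambda>w. (bz 1, w)) \<circ> circlepath q R) = (\<Prod>a\<in>A. t (the_inv_into ?I (\<lambda>j. lin (\<phi> j) (bz 1)) a))"
  proof (rule P.circle_prod[OF Aball R(1) m(1)])
    show "cball q R \<subseteq> ball q (2 * \<rho>)" using R(2) by auto
    fix a assume "a \<in> A"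
    then obtain j where j: "j \<in> ?I" "a = lin (\<phi> j) (bz 1)" by (auto simp: A_def)
    obtain d where "d > 0" "\<And>h. 0 < h \<Longrightarrow> h < d \<Longrightarrow> L (\<lambda>s. (bz 1, lin (\<phi> j) (bz 1) + ee s * of_real h)) = t j"
      using small_circle[OF bz_1_in_B, of j] j(1) by auto
    moreover have "(\<lambda>w. (bz 1, w)) \<circ> circlepath a h = (\<lambda>s. (bz 1, lin (\<phi> j) (bz 1) + ee s * of_real h))" for h
      by (simp add: circlepath j(2) fun_eq_iff mult.commute)
    moreover have "the_inv_into ?I (\<lambda>j. lin (\<phi> j) (bz 1)) a = j"
      unfolding j(2) by (rule the_inv_into_f_f[OF inj j(1)])
    ultimately show "\<exists>d>0. \<forall>h. 0 < h \<and> h < d \<longrightarrow> L ((\<lambda>w. (bz 1, w)) \<circ> circlepath a h) =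
        t (the_inv_into ?I (\<lambda>j. lin (\<phi> j) (bz 1)) a)" by auto
  qed auto
  also have "\<dots> = (\<Prod>j\<in>?I. t j)"
    unfolding A_def prod.reindex[OF inj]
    by (intro prod.cong) (simp_all add: the_inv_into_f_f[OF inj])
  finally have circ: "L (\<lambda>s. (bz 1, rot q w0 s)) = (\<Prod>j\<in>?I. t j)"
    by (simp add: rot_def w0_def circlepath comp_def mult.commute)
  have far0: "3 * m < cmod (rot q w0 s - lin (\<phi> j) b0)" if j: "j \<in> J" for s j
  proof (cases "lin (\<phi> j) b0 = q")
    case True then show ?thesis using R by (simp add: rot_def w0_def norm_mult)
  next
    case False
    have "cmod (rot q w0 s - q) < 2 * \<rho>" using R by (simp add: rot_def w0_def norm_mult)
    from other_centre[OF False q j this] show ?thesis using m \<rho>(1) by linarith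
  qed
  have w0: "w0 \<in> inner q"
  proof -
    have "rot q w0 0 = w0" by (simp add: rot_def)
    then have "w0 \<noteq> lin (\<phi> j) (bz 1)" if "j \<in> J" for j
      using far0[OF that, of 0] far_avoid[OF _ that, of w0 1] m(1) by auto
    moreover have "w0 \<in> ball q (2 * \<rho>)" using R by (simp add: w0_def dist_norm)
    ultimately show ?thesis by (auto simp: inner_def)
  qed
  have out: "w0 \<in> outer"
    using far0[of _ 0] by (auto simp: outer_def rot_def)
  let ?h = "\<lambda>(s, \<tau>). (bz (ee s), rot q w0 \<tau>)"
  have "continuous_on ({0..1} \<times> {0..1}) ?h"
    unfolding case_prod_unfold rot_def by (intro continuous_intros)
  moreover have "?h ` ({0..1} \<times> {0..1}) \<subseteq> X"
  proof -
    have "rot q w0 \<tau> \<noteq> lin (\<phi> j) (bz (ee s))" if "j \<in> J" for s \<tau> j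
      using far_avoid[OF _ that, of "rot q w0 \<tau>" "ee s"] far0[OF that, of \<tau>] m(1) by simp
    then show ?thesis by (auto simp: in_X)
  qed
  ultimately have "L (\<lambda>s. ?h (s, s)) = L (\<lambda>s. ?h (s, 0)) * L (\<lambda>s. ?h (1, s))"
    by (rule square(3))
  moreover have "L (\<lambda>s. ?h (s, 0)) = t H"
    using L_turn_outer[OF out] by (simp add: turn_def rot_def)
  ultimately have "L (turn (rot q) w0) = t H * (\<Prod>j\<in>?I. t j)"
    using circ by (simp add: turn_def)
  moreover have "L (turn (rot q) w) = L (turn (rot q) w0)"
  proof (rule L_turn_const[OF _ _ _ _ path_connected_inner w w0])
    show "continuous_on (inner q \<times> {0..1}) (\<lambda>(w, s). rot q w s)"
      unfolding rot_def case_prod_unfold by (intro continuous_intros)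
  qed (use rot_in_X[OF q] in \<open>auto simp: rot_def\<close>)
  ultimately show ?thesis by simp
qed

lemma flat_rot:
  assumes q: "q \<in> (\<lambda>j. lin (\<phi> j) b0) ` J"
    and ne: "t H * (\<Prod>j | j \<in> J \<and> lin (\<phi> j) b0 = q. t j) \<noteq> 1"
  shows "flat ({bz 1} \<times> inner q) (\<lambda>x. fixpt (rot q) (snd x))"
proof (rule flat_turn)
  show "continuous_on (inner q \<times> {0..1}) (\<lambda>(w, s). rot q w s)"
    unfolding rot_def case_prod_unfold by (intro continuous_intros)
qed (use L_turn_rot[OF q] ne rot_in_X[OF q] in \<open>auto simp: rot_def\<close>)

text \<open>The fixed points of the meridian of \<open>H\<close> give a section on
  \<open>outer\<close>. Each cluster contributes one on its disc, from \<open>trans\<close> for a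
  single graph and from \<open>rot\<close> otherwise, and they agree on the overlaps.\<close>

lemma flat_fibre:
  assumes tH: "t H \<noteq> 1"
    and cluster: "\<And>q. q \<in> (\<lambda>j. lin (\<phi> j) b0) ` J \<Longrightarrow> (\<exists>i. {j \<in> J. lin (\<phi> j) b0 = q} = {i}) \<or>
       t H * (\<Prod>j | j \<in> J \<and> lin (\<phi> j) b0 = q. t j) \<noteq> 1"
  shows "\<exists>s. flat (fib (bz 1)) s"
proof -
  let ?Q = "(\<lambda>j. lin (\<phi> j) b0) ` J"
  have "\<exists>\<sigma>. flat ({bz 1} \<times> inner q) (\<lambda>x. \<sigma> (snd x)) \<and>
     (\<forall>w\<in>inner q \<inter> outer. fixpt (\<lambda>w s. w) w = \<sigma> w)" if q: "q \<in> ?Q" for q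
  proof (cases "\<exists>i. {j \<in> J. lin (\<phi> j) b0 = q} = {i}")
    case True
    then obtain i where i: "{j \<in> J. lin (\<phi> j) b0 = q} = {i}" by blast
    then have iJ: "i \<in> J" by auto
    have "fixpt (\<lambda>w s. w) w = fixpt (trans i) w" if w: "w \<in> inner q \<inter> outer" for w
    proof (rule fixpt_agree)
      show "continuous_on {0..1} (trans i w)" unfolding trans_def by (intro continuous_intros)
      fix s j assume j: "j \<in> J"
      have "3 * m < cmod (w - lin (\<phi> j) b0)" using w j by (auto simp: outer_def)
      moreover have "cmod (w - lin (\<phi> j) b0) \<le> cmod (trans i w s - lin (\<phi> j) b0)
        + cmod ((ee s - 1) * of_real \<epsilon> * lin (\<phi> i) v)"
        using norm_triangle_ineq4[of "trans i w s - lin (\<phi> j) b0" "(ee s - 1) * of_real \<epsilon> * lin (\<phi> i) v"]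
        by (simp add: trans_def algebra_simps)
      ultimately show "m \<le> cmod (trans i w s - lin (\<phi> j) b0)"
        using trans_shift[of "ee s" i] iJ by simp
    qed (use tH L_turn_outer L_turn_trans[OF i] w in \<open>auto simp: trans_def\<close>)
    then show ?thesis using flat_trans[OF i tH] by (intro exI[of _ "fixpt (trans i)"]) auto
  next
    case False
    then have ne: "t H * (\<Prod>j | j \<in> J \<and> lin (\<phi> j) b0 = q. t j) \<noteq> 1" using cluster[OF q] by blast
    have "fixpt (\<lambda>w s. w) w = fixpt (rot q) w" if w: "w \<in> inner q \<inter> outer" for w
    proof (rule fixpt_agree)
      show "continuous_on {0..1} (rot q w)" unfolding rot_def by (intro continuous_intros)
      fix s j assume j: "j \<in> J"
      have wq: "cmod (w - q) < 2 * \<rho>" using w by (auto simp: inner_def dist_norm norm_minus_commute)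
      show "m \<le> cmod (rot q w s - lin (\<phi> j) b0)"
      proof (cases "lin (\<phi> j) b0 = q")
        case True
        have "3 * m < cmod (w - q)" using w j True by (auto simp: outer_def)
        then show ?thesis using True m(1) by (simp add: rot_def norm_mult)
      next
        case False
        have "cmod (rot q w s - q) < 2 * \<rho>" using wq by (simp add: rot_def norm_mult)
        from other_centre[OF False q j this] show ?thesis using m \<rho>(1) by linarith
      qed
    qed (use tH L_turn_outer L_turn_rot[OF q] ne w in \<open>auto simp: rot_def\<close>)
    then show ?thesis using flat_rot[OF q ne] by (intro exI[of _ "fixpt (rot q)"]) auto
  qed
  then obtain \<sigma> where \<sigma>: "\<And>q. q \<in> ?Q \<Longrightarrow> flat ({bz 1} \<times> inner q) (\<lambda>x. \<sigma> q (snd x))"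
    "\<And>q w. q \<in> ?Q \<Longrightarrow> w \<in> inner q \<Longrightarrow> w \<in> outer \<Longrightarrow> fixpt (\<lambda>w s. w) w = \<sigma> q w"
    by (metis IntI)
  \<comment> \<open>The discs are disjoint, so the choice of \<open>q\<close> is forced; on a disc
    that meets \<open>outer\<close> both prescriptions coincide.\<close>
  define s where "s x = (if snd x \<in> outer then fixpt (\<lambda>w s. w) (snd x)
     else \<sigma> (SOME q. q \<in> ?Q \<and> snd x \<in> inner q) (snd x))" for x :: "(complex \<times> complex) \<times> complex"
  have uniq: "q = q'" if qq: "q \<in> ?Q" "q' \<in> ?Q" "w \<in> inner q" "w \<in> inner q'" for q q' w
  proof (rule ccontr)
    assume "q \<noteq> q'"
    then obtain j where j: "j \<in> J" "q' = lin (\<phi> j) b0" "lin (\<phi> j) b0 \<noteq> q" using qq(2) by auto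
    have "cmod (w - q) < 2 * \<rho>" "cmod (w - q') < 2 * \<rho>"
      using qq by (auto simp: inner_def dist_norm norm_minus_commute)
    then show False using other_centre[OF j(3) qq(1) j(1)] j(2) by fastforce
  qed
  have s_inner: "s x = \<sigma> q (snd x)" if q: "q \<in> ?Q" "snd x \<in> inner q" for x q
  proof (cases "snd x \<in> outer")
    case True then show ?thesis using \<sigma>(2)[OF q] by (simp add: s_def)
  next
    case False
    have "(SOME q. q \<in> ?Q \<and> snd x \<in> inner q) = q"
      using q uniq by (intro some_equality) auto
    then show ?thesis using False by (simp add: s_def)
  qed
  have "flat (fib (bz 1)) s"
  proof (rule flat_local[OF fib_subset])
    fix x assume x: "x \<in> fib (bz 1)"
    then have x': "fst x = bz 1" "\<And>j. j \<in> J \<Longrightarrow> snd x \<noteq> lin (\<phi> j) (bz 1)"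
      by (auto simp: fib_def X_iff)
    show "\<exists>U. openin (top_of_set (fib (bz 1))) U \<and> x \<in> U \<and> flat U s"
    proof (cases "snd x \<in> outer")
      case True
      have "open (\<Inter>j\<in>J. {w. 3 * m < cmod (w - lin (\<phi> j) b0)})"
        using finite_J by (intro open_INT ballI open_Collect_less continuous_intros) auto
      moreover have "outer = (\<Inter>j\<in>J. {w. 3 * m < cmod (w - lin (\<phi> j) b0)})" by (auto simp: outer_def)
      ultimately have "open (UNIV \<times> outer :: ((complex \<times> complex) \<times> complex) set)" by (simp add: open_Times)
      then have "openin (top_of_set (fib (bz 1))) (fib (bz 1) \<inter> UNIV \<times> outer)"
        by (rule openin_open_Int)
      moreover have "flat ({bz 1} \<times> outer) s"
        using flat_outer[OF tH] by (rule flat_cong) (auto simp: s_def)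
      then have "flat (fib (bz 1) \<inter> UNIV \<times> outer) s"
        by (rule flat_subset) (auto simp: fib_def)
      ultimately show ?thesis using x True by (intro exI conjI) (auto simp: mem_Times_iff)
    next
      case False
      then obtain j where j: "j \<in> J" "cmod (snd x - lin (\<phi> j) b0) \<le> 3 * m" by (auto simp: outer_def)
      let ?q = "lin (\<phi> j) b0"
      have q: "?q \<in> ?Q" using j by auto
      have "open (inner ?q)"
        unfolding inner_def using finite_J by (intro open_Diff finite_imp_closed) auto
      then have "open (UNIV \<times> inner ?q :: ((complex \<times> complex) \<times> complex) set)" by (simp add: open_Times)
      then have "openin (top_of_set (fib (bz 1))) (fib (bz 1) \<inter> UNIV \<times> inner ?q)"
        by (rule openin_open_Int)
      moreover have "flat ({bz 1} \<times> inner ?q) s"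
        using \<sigma>(1)[OF q] by (rule flat_cong) (metis s_inner[OF q] mem_Times_iff)
      then have "flat (fib (bz 1) \<inter> UNIV \<times> inner ?q) s"
        by (rule flat_subset) (auto simp: fib_def)
      moreover have "snd x \<in> inner ?q"
        using j(2) x'(2) m \<rho>(1) by (auto simp: inner_def dist_norm norm_minus_commute)
      ultimately show ?thesis using x by (intro exI conjI) (auto simp: mem_Times_iff)
    qed
  qed
  then show ?thesis by blast
qed

end

context pencil begin

text \<open>For \<open>b0 \<noteq> 0\<close> the plane of \<open>H\<close> consists of the points
  over multiples of \<open>b0\<close>. Graphs with equal \<open>lin (\<phi> j) b0\<close> meet it in
  the same line, so the clusters are its codimension two strata, except for the axis
  \<open>b = 0\<close> on which no condition is imposed.\<close>

theorem flat_section: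
  assumes H: "H \<in> K" "lin (\<kappa> H) b0 = 0" and others: "\<And>k. k \<in> K \<Longrightarrow> k \<noteq> H \<Longrightarrow> lin (\<kappa> k) b0 \<noteq> 0"
    and v: "v \<in> B" and tH: "t H \<noteq> 1" and i: "i \<in> J" "t i \<noteq> 1"
    and cluster: "\<And>q. q \<in> (\<lambda>j. lin (\<phi> j) b0) ` J \<Longrightarrow> (\<exists>i. {j \<in> J. lin (\<phi> j) b0 = q} = {i}) \<or>
       t H * (\<Prod>j | j \<in> J \<and> lin (\<phi> j) b0 = q. t j) \<noteq> 1"
  shows "\<exists>s. flat X s"
proof -
  define M where "M = Max (insert 1 ((\<lambda>j. cmod (lin (\<phi> j) v) + 1) ` J))"
  have fin: "finite (insert 1 ((\<lambda>j. cmod (lin (\<phi> j) v) + 1) ` J))" using finite_J by simp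
  have M: "cmod (lin (\<phi> j) v) < M" if "j \<in> J" for j
    using Max_ge[OF fin, of "cmod (lin (\<phi> j) v) + 1"] that by (auto simp: M_def)
  have M0: "0 < M" using Max_ge[OF fin, of 1] by (auto simp: M_def)
  define D where "D = {(i, j). i \<in> J \<and> j \<in> J \<and> lin (\<phi> i) b0 \<noteq> lin (\<phi> j) b0}"
  have finD: "finite D" unfolding D_def by (rule finite_subset[of _ "J \<times> J"]) (use finite_J in auto)
  define \<rho> where "\<rho> = Min (insert 1 ((\<lambda>(i, j). cmod (lin (\<phi> i) b0 - lin (\<phi> j) b0)) ` D)) / 4"
  have \<rho>: "0 < \<rho>"
    unfolding \<rho>_def using finD by (auto simp: D_def)
  have \<rho>4: "4 * \<rho> \<le> cmod (lin (\<phi> i) b0 - lin (\<phi> j) b0)"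
    if "i \<in> J" "j \<in> J" "lin (\<phi> i) b0 \<noteq> lin (\<phi> j) b0" for i j
    unfolding \<rho>_def using finD that by (auto intro!: Min_le simp: D_def)
  \<comment> \<open>\<open>Min_le\<close> gives weak inequalities; the additional factors 2 make
    them strict.\<close>
  define \<epsilon> where "\<epsilon> = Min (insert (\<rho> / (16 * M))
    ((\<lambda>k. cmod (lin (\<kappa> k) b0) / (2 * cmod (lin (\<kappa> k) v))) ` (K - {H})))"
  have finE: "finite (insert (\<rho> / (16 * M))
    ((\<lambda>k. cmod (lin (\<kappa> k) b0) / (2 * cmod (lin (\<kappa> k) v))) ` (K - {H})))" using finite_K by simp
  have vk: "lin (\<kappa> k) v \<noteq> 0" if "k \<in> K" for k using v that by (auto simp: B_def)
  have \<epsilon>: "0 < \<epsilon>"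
    unfolding \<epsilon>_def using finE M0 \<rho> others vk by (subst Min_gr_iff) auto
  have "\<epsilon> \<le> \<rho> / (16 * M)" unfolding \<epsilon>_def by (rule Min_le[OF finE]) simp
  then have "\<epsilon> * M \<le> \<rho> / 16" using M0 by (simp add: field_simps)
  then have \<epsilon>M: "\<epsilon> * M < \<rho> / 8" using \<rho> by linarith
  have \<epsilon>k: "\<epsilon> * cmod (lin (\<kappa> k) v) < cmod (lin (\<kappa> k) b0)" if k: "k \<in> K" "k \<noteq> H" for k
  proof -
    have "\<epsilon> \<le> cmod (lin (\<kappa> k) b0) / (2 * cmod (lin (\<kappa> k) v))"
      unfolding \<epsilon>_def by (rule Min_le[OF finE]) (use k in auto)
    then have "\<epsilon> * cmod (lin (\<kappa> k) v) \<le> cmod (lin (\<kappa> k) b0) / 2"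
      using vk[OF k(1)] by (simp add: field_simps)
    moreover have "0 < cmod (lin (\<kappa> k) b0)" using others[OF k] by simp
    ultimately show ?thesis by linarith
  qed
  interpret D: degenerate_fibre K J \<kappa> \<phi> t X L C H b0 v M \<rho> \<epsilon>
    by unfold_locales (use H others v M M0 \<rho> \<rho>4 \<epsilon> \<epsilon>M \<epsilon>k in auto)
  obtain s0 where "flat (fib (D.bz 1)) s0" using D.flat_fibre[OF tH cluster] by blast
  then obtain s where "flat X' s" using flat_from_fibre[OF D.bz_1_in_B _ i] by blast
  then show ?thesis using flat_from_X'[OF _ v] by blast
qed

end

text \<open>A form of the criterion that \<open>simp\<close> can evaluate for explicit
  \<open>J\<close>: the products run over all of \<open>J\<close> with a conditional factor.\<close>

lemma (in pencil) flat_section_clusters: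
  assumes H: "H \<in> K" "lin (\<kappa> H) b0 = 0" and others: "\<And>k. k \<in> K \<Longrightarrow> k \<noteq> H \<Longrightarrow> lin (\<kappa> k) b0 \<noteq> 0"
    and v: "v \<in> B" and tH: "t H \<noteq> 1" and i: "i \<in> J" "t i \<noteq> 1"
    and cluster: "\<And>i. i \<in> J \<Longrightarrow> (\<forall>j\<in>J. lin (\<phi> j) b0 = lin (\<phi> i) b0 \<longrightarrow> j = i) \<or>
       t H * (\<Prod>j\<in>J. if lin (\<phi> j) b0 = lin (\<phi> i) b0 then t j else 1) \<noteq> 1"
  shows "\<exists>s. flat X s"
proof (rule flat_section[OF H others v tH i])
  fix q assume "q \<in> (\<lambda>j. lin (\<phi> j) b0) ` J"
  then obtain i where i: "i \<in> J" "q = lin (\<phi> i) b0" by blast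
  show "(\<exists>i. {j \<in> J. lin (\<phi> j) b0 = q} = {i}) \<or> t H * (\<Prod>j | j \<in> J \<and> lin (\<phi> j) b0 = q. t j) \<noteq> 1"
    using cluster[OF i(1)]
  proof
    assume "\<forall>j\<in>J. lin (\<phi> j) b0 = lin (\<phi> i) b0 \<longrightarrow> j = i"
    then have "{j \<in> J. lin (\<phi> j) b0 = q} = {i}" using i by auto
    then show ?thesis by blast
  qed (simp add: i(2) prod.inter_filter finite_J)
qed

section \<open>The central loop of the whole arrangement\<close>

context pencil begin

definition form :: "nat \<Rightarrow> (complex \<times> complex) \<times> complex \<Rightarrow> complex" where
  "form i x = (if i \<in> K then lin (\<kappa> i) (fst x) else snd x - lin (\<phi> i) (fst x))"

definition sv :: "complex \<Rightarrow> (complex \<times> complex) \<times> complex \<Rightarrow> (complex \<times> complex) \<times> complex" where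
  "sv z x = (sp z (fst x), z * snd x)"

lemma X_form: "x \<in> X \<longleftrightarrow> (\<forall>i\<in>K \<union> J. form i x \<noteq> 0)"
  using disjoint by (auto simp: X_iff form_def)

lemma form_add: "form i (x + y) = form i x + form i y"
  and form_sv: "form i (sv z x) = z * form i x"
  by (auto simp: form_def sv_def lin_add lin_sp algebra_simps)

lemma continuous_on_sv [continuous_intros]:
  "continuous_on S f \<Longrightarrow> continuous_on S g \<Longrightarrow> continuous_on S (\<lambda>x. sv (f x) (g x))"
  unfolding sv_def by (intro continuous_intros)

lemma path_connected_X: "path_connected X"
proof (rule path_connected_complex_lines[of UNIV])
  fix a b assume ab: "a \<in> X" "b \<in> X"
  let ?g = "\<lambda>z. sv z (b - a)"
  have lin_g: "linear ?g"
    by (rule linearI) (auto simp: sv_def sp_def algebra_simps scaleR_conv_of_real)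
  have g1: "?g 1 = b - a" by (simp add: sv_def sp_def prod_eq_iff)
  have "{z. a + ?g z \<notin> X \<and> a + ?g z \<in> UNIV} \<subseteq>
      (\<lambda>i. - form i a / form i (b - a)) ` (K \<union> J)"
  proof
    fix z assume "z \<in> {z. a + ?g z \<notin> X \<and> a + ?g z \<in> UNIV}"
    then obtain i where i: "i \<in> K \<union> J" "form i a + z * form i (b - a) = 0"
      by (auto simp: X_form form_add form_sv)
    then have "form i (b - a) \<noteq> 0" "z * form i (b - a) = - form i a"
      using ab by (auto simp: X_form eq_neg_iff_add_eq_0 add.commute)
    then have "z = - form i a / form i (b - a)" by (simp add: field_simps)
    then show "z \<in> (\<lambda>i. - form i a / form i (b - a)) ` (K \<union> J)" using i(1) by blast
  qed
  then have "finite {z. a + ?g z \<notin> X \<and> a + ?g z \<in> UNIV}"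
    by (rule finite_subset) (use finite_K finite_J in auto)
  with lin_g g1 show "\<exists>g :: complex \<Rightarrow> (complex \<times> complex) \<times> complex. linear g \<and> g 1 = b - a \<and>
      finite {z. a + g z \<notin> X \<and> a + g z \<in> UNIV}" by blast
qed auto

text \<open>The loop \<open>sv (ee s) x\<close> is pushed off the origin into a line which meets the hyperplanes in
  distinct points.\<close>

lemma L_central:
  assumes x1: "x1 \<in> X" and inj: "inj_on (\<lambda>i. form i y1 / form i x1) (K \<union> J)"
  shows "L (\<lambda>s. sv (ee s) x1) = (\<Prod>i\<in>K \<union> J. t i)"
proof -
  let ?I = "K \<union> J"
  have fin: "finite ?I" using finite_K finite_J by simp
  have x1': "form i x1 \<noteq> 0" if "i \<in> ?I" for i using x1 that by (auto simp: X_form)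
  define N where "N = (\<Sum>i\<in>?I. cmod (form i y1 / form i x1)) + 1"
  have N0: "N > 0" unfolding N_def by (intro add_nonneg_pos sum_nonneg) auto
  have N: "cmod (form i y1 / form i x1) < N" if "i \<in> ?I" for i
    unfolding N_def using member_le_sum[of i ?I "\<lambda>i. cmod (form i y1 / form i x1)"] that fin by auto
  define \<delta> where "\<delta> = 1 / (2 * N)"
  have \<delta>: "\<delta> > 0" using N0 by (simp add: \<delta>_def)
  \<comment> \<open>The line \<open>\<delta> y1 + z x1\<close> meets the plane \<open>i\<close> at
    the parameter \<open>a i\<close>. The choice of \<open>\<delta>\<close> puts these parameters
    within distance 1/2 of the origin, hence inside the unit circle, and \<open>inj\<close> makes
    them distinct.\<close>
  define a where "a i = - of_real \<delta> * (form i y1 / form i x1)" for i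
  have a: "cmod (a i) < 1 / 2" if "i \<in> ?I" for i
  proof -
    have "cmod (a i) = \<delta> * cmod (form i y1 / form i x1)"
      unfolding a_def norm_mult using \<delta> by simp
    also have "\<dots> < \<delta> * N" using N[OF that] \<delta> by simp
    finally show ?thesis using N0 by (simp add: \<delta>_def)
  qed
  define A where "A = a ` ?I"
  have inj_a: "inj_on a ?I"
  proof (rule inj_onI)
    fix i j assume ij: "i \<in> ?I" "j \<in> ?I" "a i = a j"
    then have "form i y1 / form i x1 = form j y1 / form j x1"
      using \<delta> by (simp add: a_def del: times_divide_eq_right)
    then show "i = j" using inj ij(1,2) by (auto dest: inj_onD)
  qed
  define l where "l z = sv (of_real \<delta>) y1 + sv z x1" for z
  have form_l: "form i (l z) = (z - a i) * form i x1" if "i \<in> ?I" for i z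
    using x1'[OF that] by (simp add: l_def form_add form_sv a_def algebra_simps)
  have lX: "l z \<in> X" if "z \<notin> A" for z
    using that x1' form_l by (auto simp: X_form A_def)
  interpret P: planar_system UNIV A "\<lambda>p. L (l \<circ> p)" "\<lambda>p. C (l \<circ> p)"
  proof (intro planar_system.intro planar_system_axioms.intro pullback)
    show "finite A" using fin by (simp add: A_def)
    show "l ` (UNIV - A) \<subseteq> X" using lX by auto
    show "continuous_on (UNIV - A) l" unfolding l_def by (intro continuous_intros)
  qed
  have "L (l \<circ> circlepath 0 1) = (\<Prod>z\<in>A. t (the_inv_into ?I a z))"
  proof (rule P.circle_prod[of 0 "1/2"])
    show "A \<subseteq> ball 0 (1 / 2)" using a by (auto simp: A_def)
    fix z assume "z \<in> A"
    then obtain i where i: "i \<in> ?I" "z = a i" by (auto simp: A_def)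
    have "open (UNIV - (A - {z}))"
      using fin by (intro open_Diff finite_imp_closed) (auto simp: A_def)
    then obtain d where d: "d > 0" "cball z d \<subseteq> UNIV - (A - {z})"
      unfolding open_contains_cball by blast
    have "L (l \<circ> circlepath z h) = t i" if h: "0 < h" "h < d" for h
    proof -
      let ?b = "sv (of_real \<delta>) y1 + sv z x1" and ?v = "sv (of_real h) x1"
      have zero: "form k (?b + sv z' ?v) = 0 \<longleftrightarrow> k = i \<and> z' = 0" if k: "k \<in> ?I" and z': "cmod z' \<le> 1" for k z'
      proof -
        have "?b + sv z' ?v = l (z + z' * of_real h)"
          by (simp add: l_def sv_def sp_def prod_eq_iff algebra_simps)
        then have "form k (?b + sv z' ?v) = 0 \<longleftrightarrow> z + z' * of_real h = a k"
          using form_l[OF k] x1'[OF k] by simp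
        also have "\<dots> \<longleftrightarrow> k = i \<and> z' = 0"
        proof
          assume eq: "z + z' * of_real h = a k"
          have "cmod (z' * of_real h) \<le> d"
          proof -
            have "cmod (z' * of_real h) = cmod z' * h" using h by (simp add: norm_mult)
            also have "\<dots> \<le> 1 * h" using z' h by (intro mult_right_mono) auto
            finally show ?thesis using h by simp
          qed
          then have "a k \<in> cball z d"
            unfolding eq[symmetric] by (simp add: dist_norm)
          then have "a k = z" using d(2) k by (auto simp: A_def)
          then show "k = i \<and> z' = 0"
            using eq h i k inj_onD[OF inj_a _ k i(1)] by simp
        qed (use i in auto)
        finally show ?thesis .
      qed
      have "L (\<lambda>s. (fst ?b + sp (ee s) (fst ?v), snd ?b + ee s * snd ?v)) = t i"
      proof (rule meridian[OF i(1)])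
        fix z' :: complex assume z': "cmod z' \<le> 1"
        have form_eq: "form k (?b + sv z' ?v) =
            (if k \<in> K then lin (\<kappa> k) (fst ?b + sp z' (fst ?v))
             else (snd ?b + z' * snd ?v) - lin (\<phi> k) (fst ?b + sp z' (fst ?v)))" for k
          by (simp add: form_def sv_def)
        show "(\<forall>k\<in>K. lin (\<kappa> k) (fst ?b + sp z' (fst ?v)) = 0 \<longleftrightarrow> k = i \<and> z' = 0) \<and>
          (\<forall>j\<in>J. snd ?b + z' * snd ?v = lin (\<phi> j) (fst ?b + sp z' (fst ?v)) \<longleftrightarrow> j = i \<and> z' = 0)"
        proof (intro conjI ballI)
          fix k assume "k \<in> K"
          then show "lin (\<kappa> k) (fst ?b + sp z' (fst ?v)) = 0 \<longleftrightarrow> k = i \<and> z' = 0"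
            using zero[OF _ z', of k] form_eq[of k] by simp
        next
          fix j assume "j \<in> J"
          then have "j \<notin> K" using disjoint by blast
          then show "snd ?b + z' * snd ?v = lin (\<phi> j) (fst ?b + sp z' (fst ?v)) \<longleftrightarrow> j = i \<and> z' = 0"
            using zero[OF _ z', of j] form_eq[of j] \<open>j \<in> J\<close> by simp
        qed
      qed
      moreover have "l \<circ> circlepath z h = (\<lambda>s. (fst ?b + sp (ee s) (fst ?v), snd ?b + ee s * snd ?v))"
        by (simp add: l_def circlepath sv_def sp_def fun_eq_iff prod_eq_iff algebra_simps)
      ultimately show ?thesis by simp
    qed
    moreover have "the_inv_into ?I a z = i" unfolding i(2) by (rule the_inv_into_f_f[OF inj_a i(1)])
    ultimately show "\<exists>d>0. \<forall>h. 0 < h \<and> h < d \<longrightarrow> L (l \<circ> circlepath z h) = t (the_inv_into ?I a z)"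
      using d(1) by auto
  qed auto
  also have "\<dots> = (\<Prod>i\<in>?I. t i)"
    unfolding A_def prod.reindex[OF inj_a]
    by (intro prod.cong) (simp_all add: the_inv_into_f_f[OF inj_a])
  finally have circ: "L (l \<circ> circlepath 0 1) = (\<Prod>i\<in>?I. t i)" .
  \<comment> \<open>While the displacement shrinks to 0, the zeros sit at
    \<open>\<sigma> * a i\<close>, so none of them reaches the unit circle.\<close>
  let ?h = "\<lambda>(\<sigma>::real, s). sv (of_real (\<sigma> * \<delta>)) y1 + sv (ee s) x1"
  have "L (\<lambda>s. ?h (0, s)) = L (\<lambda>s. ?h (1, s))"
  proof (rule loop_family(1))
    show "continuous_on ({0..1} \<times> {0..1}) ?h"
      unfolding case_prod_unfold by (intro continuous_intros)
    have "form i (?h (\<sigma>, s)) \<noteq> 0" if i: "i \<in> ?I" and \<sigma>: "\<sigma> \<in> {0..1}" for \<sigma> s i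
    proof
      assume "form i (?h (\<sigma>, s)) = 0"
      then have "(ee s - of_real \<sigma> * a i) * form i x1 = 0"
        using x1'[OF i] by (simp add: form_add form_sv a_def algebra_simps)
      then have eq: "ee s = of_real \<sigma> * a i" using x1'[OF i] by simp
      have "1 = cmod (ee s)" by simp
      also have "\<dots> = \<sigma> * cmod (a i)" unfolding eq using \<sigma> by (simp add: norm_mult)
      also have "\<dots> \<le> 1 * cmod (a i)" using \<sigma> by (intro mult_right_mono) auto
      finally show False using a[OF i] by simp
    qed
    then show "?h ` ({0..1} \<times> {0..1}) \<subseteq> X" by (auto simp: X_form)
  qed auto
  then show ?thesis
    using circ by (simp add: l_def circlepath comp_def sv_def sp_def flip: zero_prod_def)
qed

text \<open>Multiplication by unit complex numbers preserves \<open>X\<close>, so a central loop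
  starts at every point. All of them have the same multiplier, and their fixed points form a global
  flat section.\<close>

theorem flat_section_central:
  assumes x1: "x1 \<in> X" and inj: "inj_on (\<lambda>i. form i y1 / form i x1) (K \<union> J)"
    and ne: "(\<Prod>i\<in>K \<union> J. t i) \<noteq> 1"
  shows "\<exists>s. flat X s"
proof -
  let ?g = "\<lambda>(x, s). sv (ee s) x"
  have c: "continuous_on (X \<times> {0..1}) ?g"
    unfolding case_prod_unfold by (intro continuous_intros)
  have gX: "?g ` (X \<times> {0..1}) \<subseteq> X" by (auto simp: X_form form_sv)
  have ends: "?g (x, 0) = x" "?g (x, 1) = x" for x by (auto simp: sv_def sp_def)
  have "L (\<lambda>s. ?g (x, s)) = L (\<lambda>s. ?g (x1, s))" if "x \<in> X" for x
    by (rule L_loop_const[OF path_connected_X that x1 c gX]) (simp only: ends)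
  then have "L (\<lambda>s. ?g (x, s)) \<noteq> 1" if "x \<in> X" for x
    using L_central[OF x1 inj] ne that by simp
  from flat_loops[OF c gX ends(2,1) this] show ?thesis by blast
qed

end

section \<open>Twisted one-cocycles and affine systems\<close>

lemma singular_simplex_top_of_set_iff:
  "singular_simplex p (top_of_set X) f \<longleftrightarrow>
     continuous_on (standard_simplex p) f \<and> f ` standard_simplex p \<subseteq> X \<and> f \<in> extensional (standard_simplex p)"
  for f :: "(nat \<Rightarrow> real) \<Rightarrow> 'a::topological_space"
  by (auto simp: singular_simplex_def continuous_map_in_subtopology image_subset_iff_funcset
      euclidean_product_topology)

lemma continuous_on_proj: "continuous_on S (\<lambda>x :: nat \<Rightarrow> 'c::topological_space. x i)"
  by (rule continuous_on_product_then_coordinatewise[OF continuous_on_id])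

text \<open>The path parameter is the barycentric coordinate of vertex 1. \<open>restrict\<close> is
  there because singular simplices are extensional.\<close>

definition edge :: "(real \<Rightarrow> 'a) \<Rightarrow> (nat \<Rightarrow> real) \<Rightarrow> 'a" where
  "edge p = restrict (\<lambda>v. p (v 1)) (standard_simplex 1)"

definition triangle :: "(real \<times> real) set" where
  "triangle = {(a, b). 0 \<le> a \<and> 0 \<le> b \<and> a + b \<le> 1}"

lemma convex_triangle: "convex triangle"
proof (rule convexI)
  fix x y :: "real \<times> real" and u v :: real
  assume xy: "x \<in> triangle" "y \<in> triangle" and uv: "0 \<le> u" "0 \<le> v" "u + v = 1"
  have "u * (fst x + snd x) + v * (fst y + snd y) \<le> u * 1 + v * 1"
    using xy uv by (intro add_mono mult_left_mono) (auto simp: triangle_def)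
  then have "u * fst x + v * fst y + (u * snd x + v * snd y) \<le> 1"
    using uv(3) by (simp add: algebra_simps)
  then show "u *\<^sub>R x + v *\<^sub>R y \<in> triangle"
    using xy uv by (simp add: triangle_def case_prod_unfold)
qed

definition filled :: "(real \<times> real \<Rightarrow> 'a) \<Rightarrow> (nat \<Rightarrow> real) \<Rightarrow> 'a" where
  "filled g = restrict (\<lambda>v. g (v 1, v 2)) (standard_simplex 2)"

lemma standard_simplex_1: "v \<in> standard_simplex (Suc 0) \<longleftrightarrow>
    0 \<le> v 0 \<and> 0 \<le> v (Suc 0) \<and> v 0 + v (Suc 0) = 1 \<and> (\<forall>i>Suc 0. v i = 0)"
  (is "?l \<longleftrightarrow> ?r")
proof
  assume ?l
  then show ?r by (auto simp: standard_simplex_def)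
next
  assume r: ?r
  have "0 \<le> v i \<and> v i \<le> 1" for i
  proof -
    consider "i = 0" | "i = Suc 0" | "i > Suc 0" by linarith
    then show ?thesis using r by cases auto
  qed
  then show ?l using r by (auto simp: standard_simplex_def)
qed

lemma standard_simplex_2: "v \<in> standard_simplex 2 \<longleftrightarrow>
    0 \<le> v 0 \<and> 0 \<le> v 1 \<and> 0 \<le> v 2 \<and> v 0 + v 1 + v 2 = 1 \<and> (\<forall>i>2. v i = 0)"
  (is "?l \<longleftrightarrow> ?r")
proof
  assume ?l
  then show ?r by (auto simp: standard_simplex_def numeral_2_eq_2)
next
  assume r: ?r
  have "0 \<le> v i \<and> v i \<le> 1" for i
  proof -
    consider "i = 0" | "i = 1" | "i = 2" | "i > 2" by linarith
    then show ?thesis using r by cases auto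
  qed
  then show ?l using r by (auto simp: standard_simplex_def numeral_2_eq_2)
qed

lemma edge_cong: "(\<And>s. s \<in> {0..1} \<Longrightarrow> p s = q s) \<Longrightarrow> edge p = edge q"
  unfolding edge_def by (rule restrict_ext) (auto simp: standard_simplex_1)

lemma singular_edge: "path_in X p \<Longrightarrow> singular_simplex 1 (top_of_set X) (edge p)"
proof -
  assume p: "path_in X p"
  have "continuous_on (standard_simplex 1) (\<lambda>v. p (v 1))"
    by (rule continuous_on_compose2[of "{0..1}" p])
       (use p in \<open>auto simp: path_in_iff standard_simplex_1 intro!: continuous_on_proj\<close>)
  then have "continuous_on (standard_simplex 1) (edge p)"
    by (rule continuous_on_eq) (simp add: edge_def)
  then show ?thesis
    using p by (auto simp: singular_simplex_top_of_set_iff edge_def path_in_iff standard_simplex_1)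
qed

lemma leading_edge_edge: "s \<in> {0..1} \<Longrightarrow> leading_edge (edge p) s = p s"
  by (simp add: leading_edge_def edge_def standard_simplex_1)

lemma edge_leading_edge:
  assumes "singular_simplex 1 X f"
  shows "edge (leading_edge f) = f"
proof
  fix v
  show "edge (leading_edge f) v = f v"
  proof (cases "v \<in> standard_simplex 1")
    case True
    then have "(\<lambda>j. if j = 0 then 1 - v 1 else if j = 1 then v 1 else 0) = v"
      by (auto simp: standard_simplex_1 fun_eq_iff)
    then show ?thesis using True by (simp add: edge_def leading_edge_def)
  next
    case False
    then show ?thesis using assms by (simp add: edge_def singular_simplex_def extensional_def)
  qed
qed

lemma path_in_leading_edge:
  assumes "singular_simplex p (top_of_set X) f" "p \<ge> 1"
  shows "path_in X (leading_edge f)"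
proof -
  let ?e = "\<lambda>s (j::nat). if j = 0 then 1 - s else if j = 1 then s else (0::real)"
  have sub: "?e s \<in> standard_simplex p" if "s \<in> {0..1}" for s
    by (rule subsetD[OF standard_simplex_mono[OF assms(2)]]) (use that in \<open>simp add: standard_simplex_1\<close>)
  have f: "continuous_on (standard_simplex p) f" "f ` standard_simplex p \<subseteq> X"
    using assms(1) by (auto simp: singular_simplex_top_of_set_iff)
  have "continuous_on {0..1} ?e"
  proof (rule continuous_on_coordinatewise_then_product)
    fix j :: nat
    consider "j = 0" | "j = 1" | "j > 1" by linarith
    then show "continuous_on {0..1} (\<lambda>s. if j = 0 then 1 - s else if j = 1 then s else (0::real))"
      by cases (auto intro!: continuous_intros)
  qed
  then have "continuous_on {0..1} (\<lambda>s. f (?e s))"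
    using sub by (intro continuous_on_compose2[OF f(1)]) auto
  then show ?thesis
    unfolding path_in_iff leading_edge_def using sub f(2) by auto
qed

lemma singular_filled:
  assumes "continuous_on triangle g" "g ` triangle \<subseteq> X"
  shows "singular_simplex 2 (top_of_set X) (filled g)"
proof -
  have in_tri: "(v 1, v 2) \<in> triangle" if "v \<in> standard_simplex 2" for v
    using that by (auto simp: standard_simplex_2 triangle_def)
  have "continuous_on (standard_simplex 2) (\<lambda>v. g (v 1, v 2))"
    by (rule continuous_on_compose2[OF assms(1)]) (use in_tri in \<open>auto intro!: continuous_on_Pair continuous_on_proj simp del: One_nat_def\<close>)
  then have "continuous_on (standard_simplex 2) (filled g)"
    by (rule continuous_on_eq) (simp add: filled_def)
  then show ?thesis
    using assms(2) in_tri by (auto simp: singular_simplex_top_of_set_iff filled_def)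
qed

lemma faces_filled:
  "singular_face 2 0 (filled g) = edge (\<lambda>s. g (1 - s, s))"
  "singular_face 2 1 (filled g) = edge (\<lambda>s. g (0, s))"
  "singular_face 2 2 (filled g) = edge (\<lambda>s. g (s, 0))"
proof -
  have face: "singular_face 2 k (filled g) = restrict (\<lambda>v. g (simplical_face k v 1, simplical_face k v 2)) (standard_simplex 1)"
    if "k \<le> 2" for k
  proof -
    have "simplical_face k v \<in> standard_simplex 2" if "v \<in> standard_simplex 1" for v
      using simplical_face_in_standard_simplex[of 2 k v] \<open>k \<le> 2\<close> that by simp
    then show ?thesis
      by (auto simp: singular_face_def filled_def restrict_def fun_eq_iff)
  qed
  have v0: "v 0 = 1 - v 1" if "v \<in> standard_simplex 1" for v
    using that by (auto simp: standard_simplex_1)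
  show "singular_face 2 0 (filled g) = edge (\<lambda>s. g (1 - s, s))"
    "singular_face 2 1 (filled g) = edge (\<lambda>s. g (0, s))"
    "singular_face 2 2 (filled g) = edge (\<lambda>s. g (s, 0))"
    by (auto simp: face edge_def restrict_def fun_eq_iff simplical_face_def v0 simp flip: numeral_2_eq_2)
qed

lemma leading_edge_filled: "s \<in> {0..1} \<Longrightarrow> leading_edge (filled g) s = g (s, 0)"
  by (simp add: leading_edge_def filled_def standard_simplex_2)

lemma local_system_eq:
  assumes "rank_one_local_system X L" "path_in X p" "\<And>s. s \<in> {0..1} \<Longrightarrow> p s = q s"
  shows "L p = L q"
  using assms homotopic_paths_eq[of p X q] unfolding rank_one_local_system_def path_in_def by blast

lemma cocycle_triangle:
  assumes L: "rank_one_local_system X L" and c: "c \<in> twisted_cocycles X L 1"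
    and g: "continuous_on triangle g" "g ` triangle \<subseteq> X"
  shows "c (edge (\<lambda>s. g (0, s))) = c (edge (\<lambda>s. g (s, 0))) + L (\<lambda>s. g (s, 0)) * c (edge (\<lambda>s. g (1 - s, s)))"
proof -
  have f: "singular_simplex (Suc 1) (top_of_set X) (filled g)"
    using singular_filled[OF g] by (simp add: numeral_2_eq_2)
  then have "twisted_coboundary L 1 c (filled g) = 0"
    using c by (auto simp: twisted_cocycles_def)
  moreover have "{1..Suc 1} = {1, 2::nat}" by auto
  moreover have "L (leading_edge (filled g)) = L (\<lambda>s. g (s, 0))"
    using path_in_leading_edge[OF f] by (intro local_system_eq[OF L]) (auto simp: leading_edge_filled)
  ultimately show ?thesis
    using faces_filled[of g] by (simp add: twisted_coboundary_def numeral_2_eq_2 algebra_simps)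
qed

text \<open>Each law is the cocycle identity on suitable 2-simplices. The converse passage is
  \<open>cocycle_of_system\<close>.\<close>

lemma cocycle_affine_system:
  assumes L: "rank_one_local_system X L" and c: "c \<in> twisted_cocycles X L 1"
  shows "affine_system X L (\<lambda>p. c (edge p))"
proof
  note L' = L[unfolded rank_one_local_system_def]
  show "L p \<noteq> 0" if "path_in X p" for p using L' that by (auto simp: path_in_def)
  show "L p = L q" if "homotopic_paths X p q" for p q using L' that by auto
  show "L (p +++ q) = L p * L q" if "path_in X p" "path_in X q" "pathfinish p = pathstart q" for p q
    using L' that by (auto simp: path_in_def)
  show join: "c (edge (p +++ q)) = c (edge p) + L p * c (edge q)"
    if pq: "path_in X p" "path_in X q" "pathfinish p = pathstart q" for p q
  proof -
    \<comment> \<open>A degenerate triangle, mapped into the path \<open>p +++ q\<close>; its three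
      edges are \<open>p\<close>, \<open>q\<close> and \<open>p +++ q\<close>.\<close>
    let ?g = "\<lambda>(a, b). (p +++ q) (a / 2 + b)"
    have j: "path_in X (p +++ q)" using pq by (rule path_in_join)
    then have jc: "continuous_on {0..1} (p +++ q)" "\<And>s. s \<in> {0..1} \<Longrightarrow> (p +++ q) s \<in> X"
      by (auto simp: path_in_iff)
    have t: "a / 2 + b \<in> {0..1}" if "(a, b) \<in> triangle" for a b :: real
      using that by (auto simp: triangle_def)
    have "continuous_on triangle ?g"
      unfolding case_prod_unfold using t
      by (intro continuous_on_compose2[OF jc(1)] continuous_intros) auto
    moreover have "?g ` triangle \<subseteq> X" using jc(2) t by fastforce
    ultimately have "c (edge (\<lambda>s. ?g (0, s))) = c (edge (\<lambda>s. ?g (s, 0)))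
        + L (\<lambda>s. ?g (s, 0)) * c (edge (\<lambda>s. ?g (1 - s, s)))"
      by (rule cocycle_triangle[OF L c])
    moreover have "edge (\<lambda>s. ?g (s, 0)) = edge p"
      by (rule edge_cong) (auto simp: joinpaths_def)
    moreover have "edge (\<lambda>s. ?g (1 - s, s)) = edge q"
    proof (rule edge_cong)
      fix s :: real assume "s \<in> {0..1}"
      moreover have e: "(1 - s) / 2 + s = (1 + s) / 2" by (simp add: field_simps)
      have "(p +++ q) ((1 + s) / 2) = q s" if "0 \<le> s"
        using pq(3) that by (cases "s = 0") (simp_all add: joinpaths_def pathstart_def pathfinish_def field_simps)
      ultimately show "?g (1 - s, s) = q s" by (simp add: e)
    qed
    moreover have "L p = L (\<lambda>s. ?g (s, 0))"
      by (rule local_system_eq[OF L pq(1)]) (auto simp: joinpaths_def)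
    ultimately show ?thesis by simp
  qed
  have const: "L (\<lambda>_. x) = 1" "c (edge (\<lambda>_. x)) = 0" if "x \<in> X" for x
  proof -
    let ?c = "\<lambda>_::real. x"
    have k: "path_in X ?c" "pathfinish ?c = pathstart ?c" "?c +++ ?c = ?c"
      unfolding path_in_iff using that by (auto simp: pathfinish_def pathstart_def joinpaths_def)
    have "L ?c = L ?c * L ?c" "L ?c \<noteq> 0"
      using L' k by (metis path_in_def)+
    then show "L ?c = 1" by simp
    then show "c (edge ?c) = 0" using join[OF k(1,1,2)] k(3) by simp
  qed
  show "c (edge p) = c (edge q)" if hom: "homotopic_paths X p q" for p q
  proof -
    obtain h where h: "continuous_on ({0..1::real} \<times> {0..1::real}) h" "h ` ({0..1} \<times> {0..1}) \<subseteq> X"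
      "\<And>x. x \<in> {0..1} \<Longrightarrow> h (0, x) = p x" "\<And>x. x \<in> {0..1} \<Longrightarrow> h (1, x) = q x"
      "\<And>t. t \<in> {0..1} \<Longrightarrow> h (t, 0) = pathstart p" "\<And>t. t \<in> {0..1} \<Longrightarrow> h (t, 1) = pathfinish p"
      using hom unfolding homotopic_paths by (auto simp: pathfinish_def pathstart_def image_subset_iff_funcset)
    have ends: "pathstart p \<in> X" "pathfinish p \<in> X"
      using homotopic_paths_imp_subset[OF hom] by auto
    have pX: "path_in X p"
      using homotopic_paths_imp_subset[OF hom] homotopic_paths_imp_path[OF hom] by (auto simp: path_in_def)
    \<comment> \<open>The square of the homotopy is cut along its diagonal, the common edge
      \<open>(0, s)\<close> of both triangles. The sides over the fixed end points are constant
      paths, on which the cocycle vanishes.\<close>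
    let ?g1 = "\<lambda>(a, b). h (b, a + b)" and ?g2 = "\<lambda>(a, b). h (a + b, b)"
    have t: "(b, a + b) \<in> {0..1} \<times> {0..1}" "(a + b, b) \<in> {0..1} \<times> {0..1}" if "(a, b) \<in> triangle" for a b
      using that by (auto simp: triangle_def)
    have g: "continuous_on triangle ?g1" "continuous_on triangle ?g2"
      unfolding case_prod_unfold using t
      by (intro continuous_on_compose2[OF h(1)] continuous_intros; force)+
    have "?g1 ` triangle \<subseteq> X" "?g2 ` triangle \<subseteq> X" using h(2) t by fast+
    note tri = cocycle_triangle[OF L c g(1) this(1)] cocycle_triangle[OF L c g(2) this(2)]
    have "edge (\<lambda>s. ?g1 (s, 0)) = edge p" "edge (\<lambda>s. ?g2 (1 - s, s)) = edge q"
      "edge (\<lambda>s. ?g1 (1 - s, s)) = edge (\<lambda>_. pathfinish p)" "edge (\<lambda>s. ?g2 (s, 0)) = edge (\<lambda>_. pathstart p)"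
      by (rule edge_cong; use h in simp)+
    moreover have "edge (\<lambda>s. ?g1 (0, s)) = edge (\<lambda>s. ?g2 (0, s))" by simp
    moreover have "L (\<lambda>_. pathstart p) = L (\<lambda>s. ?g2 (s, 0))"
      by (rule local_system_eq[OF L]) (use ends h in \<open>auto simp: path_in_iff\<close>)
    ultimately show ?thesis using tri const[OF ends(1)] const[OF ends(2)] by simp
  qed
qed

abbreviation vertex :: "'a \<Rightarrow> (nat \<Rightarrow> real) \<Rightarrow> 'a" where
  "vertex x \<equiv> restrict (\<lambda>_. x) (standard_simplex 0)"

lemma faces_edge:
  assumes "singular_simplex 1 X f"
  shows "singular_face 1 0 f = vertex (leading_edge f 1)" "singular_face 1 1 f = vertex (leading_edge f 0)"
proof -
  let ?v = "\<lambda>j::nat. if j = 0 then 1 else (0::real)"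
  have 0: "simplical_face 0 ?v = (\<lambda>j. if j = 0 then 1 - 1 else if j = 1 then 1 else 0)"
    "simplical_face 1 ?v = (\<lambda>j. if j = 0 then 1 - 0 else if j = 1 then 0 else 0)"
    by (auto simp: simplical_face_def fun_eq_iff)
  show "singular_face 1 0 f = vertex (leading_edge f 1)" "singular_face 1 1 f = vertex (leading_edge f 0)"
    unfolding singular_face_def leading_edge_def 0[symmetric]
    by (simp_all add: standard_simplex_0 restrict_def cong: if_cong)
qed

lemma flat_coboundary:
  assumes L: "rank_one_local_system X L" and c: "c \<in> twisted_cocycles X L 1"
    and s: "affine_system.flat L (\<lambda>p. c (edge p)) X s"
  shows "c \<in> twisted_coboundaries X L 1"
proof -
  interpret affine_system X L "\<lambda>p. c (edge p)" by (rule cocycle_affine_system[OF L c])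
  \<comment> \<open>The sign comes from the coboundary of a 0-cochain,
    \<open>L * b(end) - b(start)\<close>, whereas flatness gives
    \<open>s(start) - L * s(end)\<close>.\<close>
  define b where "b f = - s (f (\<lambda>j. if j = 0 then 1 else 0))" for f :: "(nat \<Rightarrow> real) \<Rightarrow> 'a"
  have bv: "b (vertex x) = - s x" for x by (simp add: b_def standard_simplex_0)
  have "c f = twisted_coboundary L 0 b f" if f: "singular_simplex 1 (top_of_set X) f" for f
  proof -
    have "path_in X (leading_edge f)" using path_in_leading_edge[OF f] by simp
    from flatD[OF s this] have "s (leading_edge f 0) = c f + L (leading_edge f) * s (leading_edge f 1)"
      using edge_leading_edge[OF f] by (simp add: pathstart_def pathfinish_def)
    then show ?thesis
      using faces_edge[OF f] bv by (simp add: twisted_coboundary_def)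
  qed
  then show ?thesis unfolding twisted_coboundaries_def by auto
qed

text \<open>The edge from vertex 0 to vertex 2 is homotopic, across the triangle, to the join of the
  other two edges.\<close>

lemma (in affine_system) cocycle_of_system:
  "(\<lambda>f. C (leading_edge f)) \<in> twisted_cocycles X L 1"
  unfolding twisted_cocycles_def
proof (intro CollectI allI impI)
  fix f assume f: "singular_simplex (Suc 1) (top_of_set X) f"
  then have f2: "singular_simplex 2 (top_of_set X) f" by (simp add: numeral_2_eq_2)
  let ?g = "\<lambda>z :: real \<times> real. f (\<lambda>j. if j = 0 then 1 - fst z - snd z else if j = 1 then fst z else if j = 2 then snd z else 0)"
  have fc: "continuous_on (standard_simplex 2) f" "f ` standard_simplex 2 \<subseteq> X"
    using f2 by (auto simp: singular_simplex_top_of_set_iff)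
  have tri: "(\<lambda>j. if j = 0 then 1 - fst z - snd z else if j = 1 then fst z else if j = 2 then snd z else 0) \<in> standard_simplex 2"
    if "z \<in> triangle" for z :: "real \<times> real"
    using that by (auto simp: triangle_def standard_simplex_2)
  have g: "continuous_on triangle ?g" "?g ` triangle \<subseteq> X"
  proof -
    have "continuous_on triangle (\<lambda>z :: real \<times> real. \<lambda>j::nat. if j = 0 then 1 - fst z - snd z else if j = 1 then fst z else if j = 2 then snd z else 0)"
    proof (rule continuous_on_coordinatewise_then_product)
      fix j :: nat
      consider "j = 0" | "j = 1" | "j = 2" | "j > 2" by linarith
      then show "continuous_on triangle (\<lambda>z :: real \<times> real. if j = 0 then 1 - fst z - snd z
          else if j = 1 then fst z else if j = 2 then snd z else 0)"
        by cases (auto intro!: continuous_intros)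
    qed
    then show "continuous_on triangle ?g"
      using tri by (intro continuous_on_compose2[OF fc(1)]) auto
    show "?g ` triangle \<subseteq> X" using tri fc(2) by auto
  qed
  let ?a = "linepath (0::real, 0::real) (1, 0)" and ?b = "linepath (1::real, 0::real) (0, 1)" and ?d = "linepath (0::real, 0::real) (0, 1)"
  have lines: "path_in triangle ?a" "path_in triangle ?b" "path_in triangle ?d"
    by (rule path_in_linepath[OF convex_triangle]; simp add: triangle_def)+
  have face: "singular_face 2 k f = restrict (f \<circ> simplical_face k) (standard_simplex 1)" for k
    by (simp add: singular_face_def)
  have ef: "leading_edge (singular_face 2 0 f) s = (?g \<circ> ?b) s"
    "leading_edge (singular_face 2 1 f) s = (?g \<circ> ?d) s"
    "leading_edge (singular_face 2 2 f) s = (?g \<circ> ?a) s" "leading_edge f s = (?g \<circ> ?a) s"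
    if s: "s \<in> {0..1}" for s
  proof -
    have e1: "(\<lambda>j. if j = 0 then 1 - s else if j = 1 then s else 0) \<in> standard_simplex 1"
      using s by (simp add: standard_simplex_1)
    show "leading_edge (singular_face 2 0 f) s = (?g \<circ> ?b) s"
      "leading_edge (singular_face 2 1 f) s = (?g \<circ> ?d) s"
      "leading_edge (singular_face 2 2 f) s = (?g \<circ> ?a) s" "leading_edge f s = (?g \<circ> ?a) s"
      unfolding face leading_edge_def restrict_apply'[OF e1] comp_apply
      by (rule arg_cong[of _ _ f]; auto simp: simplical_face_def linepath_def fun_eq_iff)+
  qed
  have pin: "path_in X (leading_edge (singular_face 2 k f))" if "k \<le> 2" for k
    by (rule path_in_leading_edge[of 1])
       (use singular_simplex_singular_face[OF f2, of k] that in auto)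
  have C_eq: "C (leading_edge (singular_face 2 0 f)) = C (?g \<circ> ?b)" "C (leading_edge (singular_face 2 1 f)) = C (?g \<circ> ?d)"
    "C (leading_edge (singular_face 2 2 f)) = C (?g \<circ> ?a)"
    by (rule C_cong[OF pin]; simp only: ef)+
  have L_eq: "L (leading_edge f) = L (?g \<circ> ?a)"
    by (rule L_cong[OF path_in_leading_edge[OF f2]]) (use ef(4) in auto)
  have pa: "path_in X (?g \<circ> ?a)" "path_in X (?g \<circ> ?b)"
    by (rule path_in_compose[OF _ g], rule lines)+
  have "homotopic_paths X (?g \<circ> ?d) (?g \<circ> (?a +++ ?b))"
    by (rule homotopic_paths_convex_image[OF convex_triangle g]) (use lines in \<open>auto intro: path_in_join\<close>)
  then have hom: "C (?g \<circ> ?d) = C (?g \<circ> (?a +++ ?b))" by (rule C_homotopic)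
  have ends: "pathfinish (?g \<circ> ?a) = pathstart (?g \<circ> ?b)"
    by (simp only: pathfinish_compose pathstart_compose pathfinish_linepath pathstart_linepath)
  have "C (?g \<circ> ?d) = C (?g \<circ> ?a) + L (?g \<circ> ?a) * C (?g \<circ> ?b)"
    unfolding hom path_compose_join by (rule C_join[OF pa ends])
  moreover have "{1..Suc 1} = {1, 2::nat}" by auto
  ultimately show "twisted_coboundary L 1 (\<lambda>f. C (leading_edge f)) f = 0"
    using C_eq L_eq by (simp add: twisted_coboundary_def numeral_2_eq_2)
qed

lemma (in affine_system) coboundary_of_system:
  assumes "(\<lambda>f. a * C (leading_edge f)) \<in> twisted_coboundaries X L 1"
  shows "\<exists>s. \<forall>p. path_in X p \<longrightarrow> s (pathstart p) = a * C p + L p * s (pathfinish p)"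
proof -
  obtain b where b: "\<And>f. singular_simplex 1 (top_of_set X) f \<Longrightarrow> a * C (leading_edge f) = twisted_coboundary L 0 b f"
    using assms unfolding twisted_coboundaries_def by auto
  have "- b (vertex (pathstart p)) = a * C p + L p * - b (vertex (pathfinish p))" if p: "path_in X p" for p
  proof -
    note e = singular_edge[OF p]
    have "C p = C (leading_edge (edge p))" "L p = L (leading_edge (edge p))"
      by (rule C_cong[OF p] L_cong[OF p]; simp add: leading_edge_edge)+
    then show ?thesis
      using b[OF e] faces_edge[OF e] leading_edge_edge[of 0 p] leading_edge_edge[of 1 p]
      by (simp add: twisted_coboundary_def pathstart_def pathfinish_def)
  qed
  then show ?thesis by (intro exI[of _ "\<lambda>x. - b (vertex x)"]) blast
qed

section \<open>The deleted $B_3$ arrangement\<close>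

definition lform :: "nat \<Rightarrow> (nat \<Rightarrow> complex) \<Rightarrow> complex" where
  "lform i x = [x 1, x 2, x 0 - x 1, x 0 + x 1, x 0 - x 2, x 0 + x 2, x 1 - x 2, x 1 + x 2] ! i"

definition dB3 :: "nat \<Rightarrow> (nat \<Rightarrow> complex) set" where
  "dB3 i = {x \<in> cspace 3. lform i x = 0}"

lemma less_8: "i < 8 \<longleftrightarrow> i = 0 \<or> i = 1 \<or> i = 2 \<or> i = 3 \<or> i = 4 \<or> i = 5 \<or> i = 6 \<or> i = (7::nat)"
  by linarith

lemma lform_simps [simp]:
  "lform 0 x = x 1" "lform 1 x = x 2" "lform (Suc 0) x = x 2" "lform 2 x = x 0 - x 1" "lform 3 x = x 0 + x 1"
  "lform 4 x = x 0 - x 2" "lform 5 x = x 0 + x 2" "lform 6 x = x 1 - x 2" "lform 7 x = x 1 + x 2"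
  by (simp_all add: lform_def)

definition point :: "complex \<Rightarrow> complex \<Rightarrow> complex \<Rightarrow> nat \<Rightarrow> complex" where
  "point x y z j = (if j = 0 then x else if j = 1 then y else if j = 2 then z else 0)"

lemma point_simps [simp]:
  "point x y z 0 = x" "point x y z (Suc 0) = y" "point x y z 1 = y" "point x y z 2 = z"
  by (simp_all add: point_def)

lemma point_cspace: "point x y z \<in> cspace 3"
  by (simp add: point_def cspace_def)

lemma arrangement_dB3: "hyperplane_arrangement 3 8 dB3"
  unfolding hyperplane_arrangement_def
proof (intro conjI allI impI)
  fix i :: nat assume i: "i < 8"
  \<comment> \<open>The coefficients are read off at the unit vectors.\<close>
  define a where "a j = lform i (point (of_bool (j = 0)) (of_bool (j = 1)) (of_bool (j = 2)))" for j :: nat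
  have 3: "{..<3} = {0, 1, 2::nat}" by auto
  have "lform i x = a 0 * x 0 + a 1 * x 1 + a 2 * x 2" for x
    using i unfolding less_8 a_def by (elim disjE) simp_all
  then have "(\<Sum>j<3. a j * x j) = lform i x" for x
    unfolding 3 by (simp add: add.assoc)
  moreover have "a 0 \<noteq> 0 \<or> a 1 \<noteq> 0 \<or> a 2 \<noteq> 0"
    using i unfolding less_8 a_def by (elim disjE) simp_all
  then have "\<exists>j<3. a j \<noteq> 0" by (auto intro: exI[of _ 0] exI[of _ 1] exI[of _ 2])
  ultimately show "hyperplane 3 (dB3 i)"
    unfolding hyperplane_def dB3_def by (intro exI[of _ a] exI[of _ 0]) auto
next
  \<comment> \<open>The point \<open>w k\<close> lies on the plane \<open>k\<close> and on no other,
    so it tells the planes apart.\<close>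
  define w where "w k = [point 1 0 5, point 1 5 0, point 1 1 5, point 1 (-1) 5, point 1 5 1, point 1 5 (-1),
     point 5 1 1, point 5 1 (-1)] ! k" for k :: nat
  have w_simps: "w 0 = point 1 0 5" "w 1 = point 1 5 0" "w 2 = point 1 1 5" "w 3 = point 1 (-1) 5"
    "w 4 = point 1 5 1" "w 5 = point 1 5 (-1)" "w 6 = point 5 1 1" "w 7 = point 5 1 (-1)"
    by (simp_all add: w_def)
  have "w k \<in> cspace 3" if "k < 8" for k
    using that unfolding less_8 by (elim disjE) (simp_all only: w_simps point_cspace)
  moreover have "lform i (w k) = 0 \<longleftrightarrow> i = k" if "i < 8" "k < 8" for i k
    using that unfolding less_8
    by (elim disjE; hypsubst; simp only: w_simps lform_simps point_simps; simp)
  ultimately have w: "w k \<in> dB3 i \<longleftrightarrow> i = k" if "i < 8" "k < 8" for i k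
    using that by (simp add: dB3_def)
  show "inj_on dB3 {..<8}"
    by (rule inj_onI) (metis w lessThan_iff)
qed

lemma complement_dB3: "complement 3 8 dB3 = {x \<in> cspace 3. \<forall>i<8. lform i x \<noteq> 0}"
  by (auto simp: complement_def dB3_def)

definition emb :: "nat \<Rightarrow> nat \<Rightarrow> nat \<Rightarrow> (complex \<times> complex) \<times> complex \<Rightarrow> nat \<Rightarrow> complex" where
  "emb i1 i2 i3 x = (\<lambda>j. if j = i1 then fst (fst x) else if j = i2 then snd (fst x) else if j = i3 then snd x else 0)"

text \<open>\<open>i3\<close> is the coordinate projected away: \<open>K\<close> holds the forms
  that do not involve it, \<open>J\<close> those that can be solved for it.\<close>

locale dB3_pencil =
  fixes t :: "nat \<Rightarrow> complex" and L :: "(real \<Rightarrow> nat \<Rightarrow> complex) \<Rightarrow> complex" and c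
    and i1 i2 i3 :: nat and K J :: "nat set" and \<kappa> \<phi> :: "nat \<Rightarrow> complex \<times> complex"
  assumes L: "arrangement_local_system 3 8 dB3 t L"
    and c: "c \<in> twisted_cocycles (complement 3 8 dB3) L 1"
    and idx: "{i1, i2, i3} = {0, 1, 2}" "distinct [i1, i2, i3]"
    and KJ: "K \<union> J = {..<8}" "K \<inter> J = {}"
    and base: "\<And>k x. k \<in> K \<Longrightarrow> lform k (emb i1 i2 i3 x) = 0 \<longleftrightarrow> lin (\<kappa> k) (fst x) = 0"
    and fibre: "\<And>j x. j \<in> J \<Longrightarrow> lform j (emb i1 i2 i3 x) = 0 \<longleftrightarrow> snd x = lin (\<phi> j) (fst x)"
begin

abbreviation e where "e \<equiv> emb i1 i2 i3"

definition XV :: "((complex \<times> complex) \<times> complex) set" where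
  "XV = {(b, w). (\<forall>k\<in>K. lin (\<kappa> k) b \<noteq> 0) \<and> (\<forall>j\<in>J. w \<noteq> lin (\<phi> j) b)}"

lemma e_cspace: "e x \<in> cspace 3"
proof -
  have "i1 \<in> {0, 1, 2}" "i2 \<in> {0, 1, 2}" "i3 \<in> {0, 1, 2}" unfolding idx(1)[symmetric] by simp_all
  then have "i1 < 3" "i2 < 3" "i3 < 3" by auto
  then show ?thesis by (auto simp: emb_def cspace_def)
qed

lemma continuous_e: "continuous_on S e"
  unfolding emb_def
proof (rule continuous_on_coordinatewise_then_product)
  fix j
  show "continuous_on S (\<lambda>x. if j = i1 then fst (fst x) else if j = i2 then snd (fst x) else if j = i3 then snd x else 0)"
    by (cases "j = i1"; cases "j = i2"; cases "j = i3") (auto intro!: continuous_intros)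
qed

lemma e_in_X: "e x \<in> complement 3 8 dB3 \<longleftrightarrow> x \<in> XV"
proof -
  have "(\<forall>i<8. lform i (e x) \<noteq> 0) \<longleftrightarrow> (\<forall>i\<in>K \<union> J. lform i (e x) \<noteq> 0)"
    unfolding KJ(1) by auto
  also have "\<dots> \<longleftrightarrow> x \<in> XV"
    by (simp add: XV_def case_prod_unfold ball_Un base fibre)
  finally show ?thesis using e_cspace by (simp add: complement_dB3)
qed

lemma e_inverse: "x \<in> cspace 3 \<Longrightarrow> e ((x i1, x i2), x i3) = x"
proof -
  assume x: "x \<in> cspace 3"
  have "x j = 0" if "j \<noteq> i1" "j \<noteq> i2" "j \<noteq> i3" for j
  proof -
    have "j \<notin> {0, 1, 2}" unfolding idx(1)[symmetric] using that by auto
    then have "j \<ge> 3" by auto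
    then show ?thesis using x by (simp add: cspace_def)
  qed
  then have "e ((x i1, x i2), x i3) j = x j" for j
    by (cases "j = i1"; cases "j = i2"; cases "j = i3") (simp_all add: emb_def)
  then show ?thesis by (rule ext)
qed

sublocale sys: affine_system "complement 3 8 dB3" L "\<lambda>p. c (edge p)"
  using L unfolding arrangement_local_system_def by (intro cocycle_affine_system[OF _ c]) simp

sublocale pencil K J \<kappa> \<phi> t XV "\<lambda>p. L (e \<circ> p)" "\<lambda>p. c (edge (e \<circ> p))"
proof (rule pencil.intro)
  have "finite (K \<union> J)" unfolding KJ(1) by simp
  then show "finite K" "finite J" unfolding finite_Un by blast+
  show "XV = {(b, w). (\<forall>k\<in>K. lin (\<kappa> k) b \<noteq> 0) \<and> (\<forall>j\<in>J. w \<noteq> lin (\<phi> j) b)}" by (rule XV_def)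
  show "affine_system XV (\<lambda>p. L (e \<circ> p)) (\<lambda>p. c (edge (e \<circ> p)))"
    by (rule sys.pullback[OF continuous_e]) (use e_in_X in auto)
  show "K \<inter> J = {}" by (rule KJ(2))
  fix i b v w y
  assume i: "i \<in> K \<union> J" and disc: "\<And>z. cmod z \<le> 1 \<Longrightarrow> (\<forall>k\<in>K. lin (\<kappa> k) (b + sp z v) = 0 \<longleftrightarrow> k = i \<and> z = 0) \<and>
           (\<forall>j\<in>J. w + z * y = lin (\<phi> j) (b + sp z v) \<longleftrightarrow> j = i \<and> z = 0)"
  have line: "(\<lambda>j. e (b, w) j + z * e (v, y) j) = e (b + sp z v, w + z * y)" for z
    by (auto simp: emb_def sp_def fun_eq_iff)
  have disc': "\<forall>z. cmod z \<le> 1 \<longrightarrow>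
     (\<forall>k<8. (\<lambda>j. e (b, w) j + z * e (v, y) j) \<in> dB3 k \<longleftrightarrow> k = i \<and> z = 0)"
  proof (intro allI impI)
    fix z :: complex and k assume z: "cmod z \<le> 1" and k: "k < (8::nat)"
    then have "k \<in> K \<union> J" unfolding KJ(1) by simp
    then have "lform k (e (b + sp z v, w + z * y)) = 0 \<longleftrightarrow> k = i \<and> z = 0"
    proof
      assume "k \<in> K"
      then show ?thesis using disc[OF z] base[of k "(b + sp z v, w + z * y)"] by simp
    next
      assume "k \<in> J"
      then show ?thesis using disc[OF z] fibre[of k "(b + sp z v, w + z * y)"] by simp
    qed
    then show "(\<lambda>j. e (b, w) j + z * e (v, y) j) \<in> dB3 k \<longleftrightarrow> k = i \<and> z = 0"
      unfolding line by (simp add: dB3_def e_cspace)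
  qed
  have "is_meridian 3 8 dB3 i (\<lambda>s j. e (b, w) j + ee s * e (v, y) j)"
    unfolding is_meridian_def
    by (rule bexI[of _ "e (b, w)"], rule bexI[of _ "e (v, y)"], rule conjI[OF disc' refl]) (rule e_cspace)+
  moreover have "i < 8" using i unfolding KJ(1) by simp
  ultimately have "L (\<lambda>s j. e (b, w) j + ee s * e (v, y) j) = t i"
    using L unfolding arrangement_local_system_def by blast
  then show "L (e \<circ> (\<lambda>s. (b + sp (ee s) v, w + ee s * y))) = t i"
    unfolding line comp_def .
qed

lemma coboundary_if_flat:
  assumes "\<exists>s. flat XV s"
  shows "c \<in> twisted_coboundaries (complement 3 8 dB3) L 1"
proof -
  obtain s where s: "flat XV s" using assms by blast
  have "sys.flat (complement 3 8 dB3) (\<lambda>x. s ((x i1, x i2), x i3))"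
    unfolding sys.flat_def
  proof (intro allI impI)
    fix p assume p: "path_in (complement 3 8 dB3) p"
    let ?q = "\<lambda>s. ((p s i1, p s i2), p s i3)"
    have pc: "continuous_on {0..1} p" "\<And>s. s \<in> {0..1} \<Longrightarrow> p s \<in> complement 3 8 dB3"
      using p by (auto simp: path_in_iff)
    have inv: "(e \<circ> ?q) s = p s" if "s \<in> {0..1}" for s
      using e_inverse[of "p s"] pc(2)[OF that] by (simp add: complement_dB3)
    have "continuous_on {0..1} ?q"
      by (intro continuous_on_Pair) (rule continuous_on_product_then_coordinatewise[OF pc(1)])+
    moreover have "?q s \<in> XV" if "s \<in> {0..1}" for s
      using inv[OF that] pc(2)[OF that] e_in_X[of "?q s"] by simp
    ultimately have q: "path_in XV ?q" by (auto simp: path_in_iff)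
    have "L p = L (e \<circ> ?q)" by (rule sys.L_cong[OF p inv[symmetric]])
    moreover have "c (edge p) = c (edge (e \<circ> ?q))" by (rule sys.C_cong[OF p inv[symmetric]])
    ultimately show "s ((pathstart p i1, pathstart p i2), pathstart p i3) =
        c (edge p) + L p * s ((pathfinish p i1, pathfinish p i2), pathfinish p i3)"
      using flatD[OF s q] by (simp add: pathstart_def pathfinish_def)
  qed
  moreover have "rank_one_local_system (complement 3 8 dB3) L"
    using L unfolding arrangement_local_system_def by simp
  ultimately show ?thesis by (intro flat_coboundary[OF _ c])
qed

end

section \<open>Three projections and the relations they force\<close>

lemma lin_pair [simp]: "lin (a, b) (x, y) = a * x + b * y"
  by (simp add: lin_def)

text \<open>The suffix names the coordinate projected away; the base coordinates are
  \<open>(y, z)\<close> for \<open>x\<close>, \<open>(x, y)\<close> for \<open>z\<close> and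
  \<open>(x, z)\<close> for \<open>y\<close>.\<close>

definition \<kappa>x :: "nat \<Rightarrow> complex \<times> complex" where
  "\<kappa>x k = (if k = 0 then (1, 0) else if k = 1 then (0, 1) else if k = 6 then (1, -1) else (1, 1))"
definition \<phi>x :: "nat \<Rightarrow> complex \<times> complex" where
  "\<phi>x j = (if j = 2 then (1, 0) else if j = 3 then (-1, 0) else if j = 4 then (0, 1) else (0, -1))"
definition \<kappa>z :: "nat \<Rightarrow> complex \<times> complex" where
  "\<kappa>z k = (if k = 0 then (0, 1) else if k = 2 then (1, -1) else (1, 1))"
definition \<phi>z :: "nat \<Rightarrow> complex \<times> complex" where
  "\<phi>z j = (if j = 1 then (0, 0) else if j = 4 then (1, 0) else if j = 5 then (-1, 0) else if j = 6 then (0, 1) else (0, -1))"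
definition \<kappa>y :: "nat \<Rightarrow> complex \<times> complex" where
  "\<kappa>y k = (if k = 1 then (0, 1) else if k = 4 then (1, -1) else (1, 1))"
definition \<phi>y :: "nat \<Rightarrow> complex \<times> complex" where
  "\<phi>y j = (if j = 0 then (0, 0) else if j = 2 then (1, 0) else if j = 3 then (-1, 0) else if j = 6 then (0, 1) else (0, -1))"

lemmas pencil_simps = \<kappa>x_def \<phi>x_def \<kappa>y_def \<phi>y_def \<kappa>z_def \<phi>z_def

locale nontrivial_cocycle =
  fixes t :: "nat \<Rightarrow> complex" and L :: "(real \<Rightarrow> nat \<Rightarrow> complex) \<Rightarrow> complex" and c
  assumes L: "arrangement_local_system 3 8 dB3 t L"
    and c: "c \<in> twisted_cocycles (complement 3 8 dB3) L 1"
    and nontrivial: "c \<notin> twisted_coboundaries (complement 3 8 dB3) L 1"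
    and t: "\<And>i. i < 8 \<Longrightarrow> t i \<noteq> 1"
begin

interpretation x: dB3_pencil t L c 1 2 0 "{0, 1, 6, 7}" "{2, 3, 4, 5}" \<kappa>x \<phi>x
proof
  show "lform k (emb 1 2 0 x) = 0 \<longleftrightarrow> lin (\<kappa>x k) (fst x) = 0" if "k \<in> {0, 1, 6, 7}" for k x
    using that by (auto simp: emb_def pencil_simps lin_def)
  show "lform j (emb 1 2 0 x) = 0 \<longleftrightarrow> snd x = lin (\<phi>x j) (fst x)" if "j \<in> {2, 3, 4, 5}" for j x
    using that by (auto simp: emb_def pencil_simps lin_def eq_neg_iff_add_eq_0)
qed (use L c in auto)

interpretation z: dB3_pencil t L c 0 1 2 "{0, 2, 3}" "{1, 4, 5, 6, 7}" \<kappa>z \<phi>z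
proof
  show "lform k (emb 0 1 2 x) = 0 \<longleftrightarrow> lin (\<kappa>z k) (fst x) = 0" if "k \<in> {0, 2, 3}" for k x
    using that by (auto simp: emb_def pencil_simps lin_def)
  show "lform j (emb 0 1 2 x) = 0 \<longleftrightarrow> snd x = lin (\<phi>z j) (fst x)" if "j \<in> {1, 4, 5, 6, 7}" for j x
    using that by (elim insertE emptyE; hypsubst; simp add: emb_def pencil_simps lin_def)
      (metis add.commute add_eq_0_iff eq_commute)+
qed (use L c in auto)

interpretation y: dB3_pencil t L c 0 2 1 "{1, 4, 5}" "{0, 2, 3, 6, 7}" \<kappa>y \<phi>y
proof
  show "lform k (emb 0 2 1 x) = 0 \<longleftrightarrow> lin (\<kappa>y k) (fst x) = 0" if "k \<in> {1, 4, 5}" for k x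
    using that by (auto simp: emb_def pencil_simps lin_def)
  show "lform j (emb 0 2 1 x) = 0 \<longleftrightarrow> snd x = lin (\<phi>y j) (fst x)" if "j \<in> {0, 2, 3, 6, 7}" for j x
    using that by (elim insertE emptyE; hypsubst; simp add: emb_def pencil_simps lin_def)
      (metis add.commute add_eq_0_iff eq_commute)+
qed (use L c in auto)

lemma x_B: "(1, 2) \<in> x.B" and z_B: "(1, 2) \<in> z.B" and y_B: "(1, 2) \<in> y.B"
  unfolding x.B_def y.B_def z.B_def by (simp_all add: pencil_simps lin_diff_left)

text \<open>Over \<open>y = 0\<close>, \<open>z = 1\<close> the graphs \<open>x = y\<close> and
  \<open>x = -y\<close> meet, while \<open>x = z\<close> and \<open>x = -z\<close> stay apart. The
  triple line of the planes 0, 2, 3 is thus the only stratum that can obstruct a flat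
  section.\<close>

lemma rel_x0: "t 0 * (t 2 * t 3) = 1"
proof (rule ccontr)
  assume "t 0 * (t 2 * t 3) \<noteq> 1"
  then have "\<exists>s. x.flat x.XV s"
    by (intro x.flat_section_clusters[where H = 0 and i = 2 and ?b0.0 = "(0, 1)", OF _ _ _ x_B])
       (use t in \<open>auto simp: pencil_simps ac_simps\<close>)
  then show False using nontrivial x.coboundary_if_flat by blast
qed

lemma rel_x1: "t 1 * (t 4 * t 5) = 1"
proof (rule ccontr)
  assume "t 1 * (t 4 * t 5) \<noteq> 1"
  then have "\<exists>s. x.flat x.XV s"
    by (intro x.flat_section_clusters[where H = 1 and i = 2 and ?b0.0 = "(1, 0)", OF _ _ _ x_B])
       (use t in \<open>auto simp: pencil_simps ac_simps\<close>)
  then show False using nontrivial x.coboundary_if_flat by blast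
qed

text \<open>Over \<open>y = z = 1\<close> the four graphs meet in pairs, which leaves two triple
  lines and hence only a disjunction.\<close>

lemma rel_x6: "t 6 * (t 2 * t 4) = 1 \<or> t 6 * (t 3 * t 5) = 1"
proof (rule ccontr)
  assume "\<not> ?thesis"
  then have "\<exists>s. x.flat x.XV s"
    by (intro x.flat_section_clusters[where H = 6 and i = 2 and ?b0.0 = "(1, 1)", OF _ _ _ x_B])
       (use t in \<open>auto simp: pencil_simps ac_simps\<close>)
  then show False using nontrivial x.coboundary_if_flat by blast
qed

lemma rel_x7: "t 7 * (t 2 * t 5) = 1 \<or> t 7 * (t 3 * t 4) = 1"
proof (rule ccontr)
  assume "\<not> ?thesis"
  then have "\<exists>s. x.flat x.XV s"
    by (intro x.flat_section_clusters[where H = 7 and i = 2 and ?b0.0 = "(1, -1)", OF _ _ _ x_B])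
       (use t in \<open>auto simp: pencil_simps ac_simps\<close>)
  then show False using nontrivial x.coboundary_if_flat by blast
qed

text \<open>Projected along \<open>z\<close>, the plane \<open>y = 0\<close> shows its other
  multiple line \<open>y = z = 0\<close>, which lies on the four planes 0, 1, 6, 7.\<close>

lemma rel_z0: "t 0 * (t 1 * (t 6 * t 7)) = 1"
proof (rule ccontr)
  assume "\<not> ?thesis"
  then have "\<exists>s. z.flat z.XV s"
    by (intro z.flat_section_clusters[where H = 0 and i = 1 and ?b0.0 = "(1, 0)", OF _ _ _ z_B])
       (use t in \<open>auto simp: pencil_simps ac_simps\<close>)
  then show False using nontrivial z.coboundary_if_flat by blast
qed

lemma rel_z2: "t 2 * (t 4 * t 6) = 1 \<or> t 2 * (t 5 * t 7) = 1"
proof (rule ccontr)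
  assume "\<not> ?thesis"
  then have "\<exists>s. z.flat z.XV s"
    by (intro z.flat_section_clusters[where H = 2 and i = 1 and ?b0.0 = "(1, 1)", OF _ _ _ z_B])
       (use t in \<open>auto simp: pencil_simps ac_simps\<close>)
  then show False using nontrivial z.coboundary_if_flat by blast
qed

lemma rel_z3: "t 3 * (t 4 * t 7) = 1 \<or> t 3 * (t 5 * t 6) = 1"
proof (rule ccontr)
  assume "\<not> ?thesis"
  then have "\<exists>s. z.flat z.XV s"
    by (intro z.flat_section_clusters[where H = 3 and i = 1 and ?b0.0 = "(1, -1)", OF _ _ _ z_B])
       (use t in \<open>auto simp: pencil_simps ac_simps\<close>)
  then show False using nontrivial z.coboundary_if_flat by blast
qed

lemma rel_y4: "t 4 * (t 2 * t 6) = 1 \<or> t 4 * (t 3 * t 7) = 1"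
proof (rule ccontr)
  assume "\<not> ?thesis"
  then have "\<exists>s. y.flat y.XV s"
    by (intro y.flat_section_clusters[where H = 4 and i = 0 and ?b0.0 = "(1, 1)", OF _ _ _ y_B])
       (use t in \<open>auto simp: pencil_simps ac_simps\<close>)
  then show False using nontrivial y.coboundary_if_flat by blast
qed

lemma rel_y5: "t 5 * (t 2 * t 7) = 1 \<or> t 5 * (t 3 * t 6) = 1"
proof (rule ccontr)
  assume "\<not> ?thesis"
  then have "\<exists>s. y.flat y.XV s"
    by (intro y.flat_section_clusters[where H = 5 and i = 0 and ?b0.0 = "(1, -1)", OF _ _ _ y_B])
       (use t in \<open>auto simp: pencil_simps ac_simps\<close>)
  then show False using nontrivial y.coboundary_if_flat by blast
qed

lemma rel_central: "t 0 * t 1 * t 2 * t 3 * t 4 * t 5 * t 6 * t 7 = 1"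
proof (rule ccontr)
  assume ne: "\<not> ?thesis"
  have U: "{0, 1, 6, 7} \<union> {2, 3, 4, 5} = {..<8::nat}" by auto
  have "\<exists>s. x.flat x.XV s"
  proof (rule x.flat_section_central)
    \<comment> \<open>The two points only have to be generic: the eight quotients of the forms are
      distinct, among them 21/2, 20, 19/2, 61/6, 20/3, 12, 1, 41/3.\<close>
    show "((2, 1), 4) \<in> x.XV" unfolding x.XV_def by (simp add: pencil_simps)
    show "inj_on (\<lambda>i. x.form i ((21, 20), 40) / x.form i ((2, 1), 4)) ({0, 1, 6, 7} \<union> {2, 3, 4, 5})"
      unfolding x.form_def inj_on_def by (simp add: pencil_simps)
    show "(\<Prod>i\<in>{0, 1, 6, 7} \<union> {2, 3, 4, 5}. t i) \<noteq> 1"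
      using ne unfolding U by (simp add: eval_nat_numeral mult_ac)
  qed
  then show False using nontrivial x.coboundary_if_flat by blast
qed

text \<open>\<open>\<alpha>\<close>, \<open>\<beta>\<close>, \<open>\<gamma>\<close>,
  \<open>\<delta>\<close> belong to the four triple lines spanned by
  \<open>(1, \<plusminus>1, \<plusminus>1)\<close>. The remaining relations make their product 1 and
  force \<open>t 0 * t 1 = 1\<close> and \<open>t 6 * t 7 = 1\<close>.\<close>

theorem relations:
  "t 0 = t 4 ^ 2" "t 1 * t 4 ^ 2 = 1" "t 2 * t 4 = -1" "t 3 * t 4 = -1" "t 5 = t 4" "t 6 = -1" "t 7 = -1"
proof -
  define \<alpha> \<beta> \<gamma> \<delta> where "\<alpha> = t 2 * t 4 * t 6" "\<beta> = t 2 * t 5 * t 7" "\<gamma> = t 3 * t 4 * t 7" "\<delta> = t 3 * t 5 * t 6"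
  note defs = this
  have pPqQ: "t 2 * t 3 * t 4 * t 5 = 1"
  proof -
    have "(t 0 * (t 1 * (t 6 * t 7))) * (t 2 * t 3 * t 4 * t 5) = t 0 * t 1 * t 2 * t 3 * t 4 * t 5 * t 6 * t 7"
      by (simp only: ac_simps)
    then show ?thesis unfolding rel_central rel_z0 by simp
  qed
  have yz: "t 0 * t 1 = 1"
  proof -
    have "t 0 * t 1 * (t 2 * t 3 * t 4 * t 5) = (t 0 * (t 2 * t 3)) * (t 1 * (t 4 * t 5))" by (simp only: ac_simps)
    then show ?thesis unfolding rel_x0 rel_x1 pPqQ by simp
  qed
  have rR: "t 6 * t 7 = 1" using rel_z0 unfolding mult.assoc[symmetric] yz by simp
  have "\<alpha> * \<beta> * \<gamma> * \<delta> = (t 2 * t 3 * t 4 * t 5)\<^sup>2 * (t 6 * t 7)\<^sup>2"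
    by (simp add: defs power2_eq_square ac_simps)
  then have prod: "\<alpha> * \<beta> * \<gamma> * \<delta> = 1" using pPqQ rR by simp
  have "\<alpha> = 1 \<or> \<delta> = 1" "\<beta> = 1 \<or> \<gamma> = 1" "\<alpha> = 1 \<or> \<beta> = 1" "\<gamma> = 1 \<or> \<delta> = 1" "\<alpha> = 1 \<or> \<gamma> = 1" "\<beta> = 1 \<or> \<delta> = 1"
    using rel_x6 rel_x7 rel_z2 rel_z3 rel_y4 rel_y5 by (simp_all add: defs ac_simps)
  \<comment> \<open>The six disjunctions run over all pairs, so at most one of the four values can
    differ from 1; as their product is 1, none does.\<close>
  then have one: "\<alpha> = 1" "\<beta> = 1" "\<gamma> = 1" "\<delta> = 1" using prod by auto
  \<comment> \<open>Only \<open>t 6\<close> occurs twice in \<open>\<alpha> * \<delta>\<close>, so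
    its square is 1. The sign -1, and with it the translation, comes from
    \<open>t 6 \<noteq> 1\<close>.\<close>
  have "\<alpha> * \<delta> = (t 2 * t 3 * t 4 * t 5) * (t 6)\<^sup>2" by (simp add: defs power2_eq_square ac_simps)
  then have "(t 6)\<^sup>2 = 1" using one pPqQ by simp
  then show t6: "t 6 = -1" using t[of 6] by (simp add: power2_eq_1_iff)
  then show t7: "t 7 = -1" using rR by (simp add: minus_equation_iff)
  have "t 2 * t 4 * (-1) = 1" "t 2 * t 5 * (-1) = 1" "t 3 * t 4 * (-1) = 1"
    using one t6 t7 by (simp_all add: defs)
  then have m: "t 2 * t 4 = -1" "t 2 * t 5 = -1" "t 3 * t 4 = -1"
    by (metis minus_minus mult_minus1_right)+
  show "t 2 * t 4 = -1" "t 3 * t 4 = -1" by (rule m)+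
  have "t 2 \<noteq> 0" using m(1) by auto
  then show t5: "t 5 = t 4" using m(1,2) by (metis mult_left_cancel)
  show t1: "t 1 * t 4 ^ 2 = 1" using rel_x1 t5 by (simp add: power2_eq_square)
  have "t 0 * (t 1 * t 4 ^ 2) = t 4 ^ 2" unfolding mult.assoc[symmetric] yz by simp
  then show "t 0 = t 4 ^ 2" unfolding t1 by simp
qed

end

section \<open>Affine systems from local cocycles\<close>

lemma path_neighbourhood:
  assumes "continuous_on S h" "h ` S \<subseteq> X" "openin (top_of_set X) U" "x \<in> S" "h x \<in> U"
  shows "\<exists>d>0. \<forall>y\<in>S. dist y x < d \<longrightarrow> h y \<in> U"
proof -
  have "openin (top_of_set S) (S \<inter> h -` U)"
    using assms by (intro continuous_openin_preimage[of S h X]) auto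
  then have "\<exists>d>0. \<forall>y\<in>S. dist y x < d \<longrightarrow> y \<in> S \<inter> h -` U"
    unfolding openin_euclidean_subtopology_iff using assms(4,5) by simp
  then show ?thesis by auto
qed

text \<open>Transport is given for pairs of points in a common good set and multiplied along
  subdivisions of a path. \<open>E\<close> and \<open>k\<close> are total functions, but composition
  is required only inside good sets.\<close>

locale local_cocycle =
  fixes X :: "'a::topological_space set" and good :: "'a set \<Rightarrow> bool" and E k :: "'a \<Rightarrow> 'a \<Rightarrow> complex"
  assumes cover: "x \<in> X \<Longrightarrow> \<exists>U. openin (top_of_set X) U \<and> x \<in> U \<and> good U"
    and E_trans: "good U \<Longrightarrow> x \<in> U \<Longrightarrow> y \<in> U \<Longrightarrow> z \<in> U \<Longrightarrow> E x y * E y z = E x z"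
    and k_trans: "good U \<Longrightarrow> x \<in> U \<Longrightarrow> y \<in> U \<Longrightarrow> z \<in> U \<Longrightarrow> k x y + E x y * k y z = k x z"
    and E_nonzero: "E x y \<noteq> 0"
begin

lemma E_refl: "good U \<Longrightarrow> x \<in> U \<Longrightarrow> E x x = 1"
  using E_trans[of U x x x] E_nonzero[of x x] by simp

lemma k_refl: "good U \<Longrightarrow> x \<in> U \<Longrightarrow> k x x = 0"
  using k_trans[of U x x x] E_refl[of U x] by simp

text \<open>\<open>tr p u v l c\<close> says that some subdivision of the interval from
  \<open>u\<close> to \<open>v\<close> yields the transport \<open>(l, c)\<close>. That the result
  does not depend on the subdivision is shown only afterwards.\<close>

inductive tr :: "(real \<Rightarrow> 'a) \<Rightarrow> real \<Rightarrow> real \<Rightarrow> complex \<Rightarrow> complex \<Rightarrow> bool" for p where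
  small: "u \<le> v \<Longrightarrow> good U \<Longrightarrow> p ` {u..v} \<subseteq> U \<Longrightarrow> tr p u v (E (p u) (p v)) (k (p u) (p v))"
| join: "tr p u v l c \<Longrightarrow> tr p v w l' c' \<Longrightarrow> tr p u w (l * l') (c + l * c')"

lemma tr_le: "tr p u v l c \<Longrightarrow> u \<le> v"
  by (induction rule: tr.induct) auto

lemma tr_nonzero: "tr p u v l c \<Longrightarrow> l \<noteq> 0"
  by (induction rule: tr.induct) (auto simp: E_nonzero)

lemma tr_split:
  assumes "tr p u w l c" "u \<le> v" "v \<le> w"
  shows "\<exists>l1 c1 l2 c2. tr p u v l1 c1 \<and> tr p v w l2 c2 \<and> l = l1 * l2 \<and> c = c1 + l1 * c2"
  using assms
proof (induction arbitrary: v rule: tr.induct)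
  case (small u w U)
  have sub: "p ` {u..v} \<subseteq> U" "p ` {v..w} \<subseteq> U" using small by force+
  have "p u \<in> U" "p v \<in> U" "p w \<in> U" using small by auto
  then show ?case
    using tr.small[OF _ small(2) sub(1)] tr.small[OF _ small(2) sub(2)] small.prems
      E_trans[OF small(2)] k_trans[OF small(2)] by metis
next
  case (join u m l c w l' c')
  show ?case
  proof (cases "v \<le> m")
    case True
    then obtain l1 c1 l2 c2 where "tr p u v l1 c1" "tr p v m l2 c2" "l = l1 * l2" "c = c1 + l1 * c2"
      using join.IH(1) join.prems by blast
    moreover from this join have "tr p v w (l2 * l') (c2 + l2 * c')" by (blast intro: tr.join)
    ultimately show ?thesis
      by (intro exI[of _ l1] exI[of _ c1] exI[of _ "l2 * l'"] exI[of _ "c2 + l2 * c'"])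
         (simp add: algebra_simps)
  next
    case False
    then obtain l1 c1 l2 c2 where "tr p m v l1 c1" "tr p v w l2 c2" "l' = l1 * l2" "c' = c1 + l1 * c2"
      using join.IH(2)[of v] join.prems False by auto
    moreover from this join have "tr p u v (l * l1) (c + l * c1)" by (blast intro: tr.join)
    ultimately show ?thesis
      by (intro exI[of _ "l * l1"] exI[of _ "c + l * c1"] exI[of _ l2] exI[of _ c2])
         (simp add: algebra_simps)
  qed
qed

lemma tr_local:
  assumes "tr p u v l c" "good U" "p ` {u..v} \<subseteq> U"
  shows "l = E (p u) (p v) \<and> c = k (p u) (p v)"
  using assms
proof (induction rule: tr.induct)
  case (join u m l c w l' c')
  have le: "u \<le> m" "m \<le> w" using join.hyps tr_le by auto
  then have "p ` {u..m} \<subseteq> U" "p ` {m..w} \<subseteq> U" using join.prems(2) by force+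
  moreover have "p u \<in> U" "p m \<in> U" "p w \<in> U" using join.prems(2) le by auto
  ultimately show ?case using join.IH join.prems(1) E_trans k_trans by simp
qed auto

lemma tr_exists:
  assumes p: "path_in X p"
  shows "\<exists>l c. tr p 0 1 l c"
proof -
  have pc: "continuous_on {0..1} p" "p ` {0..1} \<subseteq> X" using p by (auto simp: path_in_iff)
  define P where "P u v \<longleftrightarrow> (0 \<le> u \<and> v \<le> 1 \<longrightarrow> (\<exists>l c. tr p u v l c))" for u v
  have "P 0 1"
  proof (rule Bolzano[of 0 1 P])
    fix a b c assume P: "P a b" "P b c" and le: "a \<le> b" "b \<le> c"
    show "P a c" unfolding P_def
    proof
      assume "0 \<le> a \<and> c \<le> 1"
      then obtain l m l' m' where "tr p a b l m" "tr p b c l' m'" using P le unfolding P_def by auto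
      then show "\<exists>l m. tr p a c l m" using tr.join by blast
    qed
  next
    fix x :: real assume x: "0 \<le> x" "x \<le> 1"
    then obtain U where U: "openin (top_of_set X) U" "p x \<in> U" "good U" 
      using cover[of "p x"] pc(2) by (metis atLeastAtMost_iff imageI subsetD)
    obtain d where d: "d > 0" "\<And>y. y \<in> {0..1} \<Longrightarrow> dist y x < d \<Longrightarrow> p y \<in> U"
      using path_neighbourhood[OF pc U(1) _ U(2)] x by auto
    have "P a b" if "a \<le> x" "x \<le> b" "b - a < d" for a b
      unfolding P_def
    proof
      assume "0 \<le> a \<and> b \<le> 1"
      then have "p ` {a..b} \<subseteq> U" using that by (auto intro!: d(2) simp: dist_real_def)
      moreover have "a \<le> b" using that by linarith
      ultimately show "\<exists>l c. tr p a b l c" using tr.small[OF _ U(3)] by blast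
    qed
    then show "\<exists>d>0. \<forall>a b. a \<le> x \<and> x \<le> b \<and> b - a < d \<longrightarrow> P a b" using d(1) by blast
  qed simp
  then show ?thesis by (simp add: P_def)
qed

text \<open>Comparison of the transports along two nearby rows of a homotopy.\<close>

lemma tr_rows:
  fixes h :: "real \<times> real \<Rightarrow> 'a" and r :: real
  assumes h: "continuous_on ({0..1} \<times> {0..1}) h" "h ` ({0..1} \<times> {0..1}) \<subseteq> X" and r: "r \<in> {0..1}"
  shows "\<exists>d>0. \<forall>r'\<in>{0..1}. \<bar>r' - r\<bar> < d \<longrightarrow> (\<forall>l c l' c'.
    tr (\<lambda>s. h (r, s)) 0 1 l c \<and> tr (\<lambda>s. h (r', s)) 0 1 l' c' \<longrightarrow>
    l * E (h (r, 1)) (h (r', 1)) = E (h (r, 0)) (h (r', 0)) * l' \<and>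
    c + l * k (h (r, 1)) (h (r', 1)) = k (h (r, 0)) (h (r', 0)) + E (h (r, 0)) (h (r', 0)) * c')"
proof -
  \<comment> \<open>The rows \<open>r\<close> and \<open>r'\<close> and the short segments between
    them form a ladder; \<open>Q\<close> says that it commutes between \<open>u\<close> and
    \<open>v\<close>.\<close>
  define Q where "Q r' u v \<longleftrightarrow> (\<forall>l c l' c'.
    tr (\<lambda>s. h (r, s)) u v l c \<and> tr (\<lambda>s. h (r', s)) u v l' c' \<longrightarrow>
    l * E (h (r, v)) (h (r', v)) = E (h (r, u)) (h (r', u)) * l' \<and>
    c + l * k (h (r, v)) (h (r', v)) = k (h (r, u)) (h (r', u)) + E (h (r, u)) (h (r', u)) * c')" for r' u v :: real
  define P where "P u v \<longleftrightarrow> (0 \<le> u \<and> v \<le> 1 \<longrightarrow> (\<exists>d>0. \<forall>r'\<in>{0..1}. \<bar>r' - r\<bar> < d \<longrightarrow> Q r' u v))" for u v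
  have Q_trans: "Q r' a c" if Q: "Q r' a b" "Q r' b c" and le: "a \<le> b" "b \<le> c" for r' a b c
    unfolding Q_def
  proof (intro allI impI)
    fix l m l' m' assume as: "tr (\<lambda>s. h (r, s)) a c l m \<and> tr (\<lambda>s. h (r', s)) a c l' m'"
    obtain l1 m1 l2 m2 where 1: "tr (\<lambda>s. h (r, s)) a b l1 m1" "tr (\<lambda>s. h (r, s)) b c l2 m2"
      "l = l1 * l2" "m = m1 + l1 * m2" using tr_split[OF conjunct1[OF as] le] by blast
    obtain l1' m1' l2' m2' where 2: "tr (\<lambda>s. h (r', s)) a b l1' m1'" "tr (\<lambda>s. h (r', s)) b c l2' m2'"
      "l' = l1' * l2'" "m' = m1' + l1' * m2'" using tr_split[OF conjunct2[OF as] le] by blast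
    let ?E = "\<lambda>s. E (h (r, s)) (h (r', s))" and ?k = "\<lambda>s. k (h (r, s)) (h (r', s))"
    have q1: "l1 * ?E b = ?E a * l1'" "m1 + l1 * ?k b = ?k a + ?E a * m1'"
      using Q(1) 1(1) 2(1) unfolding Q_def by blast+
    have q2: "l2 * ?E c = ?E b * l2'" "m2 + l2 * ?k c = ?k b + ?E b * m2'"
      using Q(2) 1(2) 2(2) unfolding Q_def by blast+
    have "l * ?E c = l1 * (l2 * ?E c)" by (simp add: 1(3))
    also have "\<dots> = (l1 * ?E b) * l2'" by (simp add: q2(1))
    also have "\<dots> = ?E a * l'" by (simp add: q1(1) 2(3))
    finally have 3: "l * ?E c = ?E a * l'" .
    have "m + l * ?k c = m1 + l1 * (m2 + l2 * ?k c)" by (simp add: 1(3,4) algebra_simps)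
    also have "\<dots> = (m1 + l1 * ?k b) + (l1 * ?E b) * m2'" unfolding q2(2) by (simp add: algebra_simps)
    also have "\<dots> = ?k a + ?E a * m'" unfolding q1 2(4) by (simp add: algebra_simps)
    finally show "l * ?E c = ?E a * l' \<and> m + l * ?k c = ?k a + ?E a * m'" using 3 by simp
  qed
  have "P 0 1"
  proof (rule Bolzano[of 0 1 P])
    fix a b c assume P: "P a b" "P b c" and le: "a \<le> b" "b \<le> c"
    show "P a c" unfolding P_def
    proof
      assume "0 \<le> a \<and> c \<le> 1"
      then obtain d1 d2 where "d1 > 0" "d2 > 0" "\<forall>r'\<in>{0..1}. \<bar>r' - r\<bar> < d1 \<longrightarrow> Q r' a b"
        "\<forall>r'\<in>{0..1}. \<bar>r' - r\<bar> < d2 \<longrightarrow> Q r' b c"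
        using P le unfolding P_def by auto
      then show "\<exists>d>0. \<forall>r'\<in>{0..1}. \<bar>r' - r\<bar> < d \<longrightarrow> Q r' a c"
        using Q_trans[OF _ _ le] by (intro exI[of _ "min d1 d2"]) auto
    qed
  next
    fix x :: real assume x: "0 \<le> x" "x \<le> 1"
    then have rx: "(r, x) \<in> {0..1} \<times> {0..1}" using r by auto
    then obtain U where U: "openin (top_of_set X) U" "h (r, x) \<in> U" "good U"
      using cover[of "h (r, x)"] h(2) by blast
    obtain d where d: "d > 0" "\<And>y. y \<in> {0..1} \<times> {0..1} \<Longrightarrow> dist y (r, x) < d \<Longrightarrow> h y \<in> U"
      using path_neighbourhood[OF h U(1) rx U(2)] by blast
    have near: "h (r', s) \<in> U" if "r' \<in> {0..1}" "s \<in> {0..1}" "\<bar>r' - r\<bar> < d / 2" "\<bar>s - x\<bar> < d / 2" for r' s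
    proof (rule d(2))
      have "dist (r', s) (r, x) \<le> \<bar>r' - r\<bar> + \<bar>s - x\<bar>"
        unfolding dist_Pair_Pair dist_real_def by (rule order_trans[OF sqrt_sum_squares_le_sum_abs]) simp
      then show "dist (r', s) (r, x) < d" using that by linarith
    qed (use that in auto)
    have "P a b" if ab: "a \<le> x" "x \<le> b" "b - a < d / 2" for a b
      unfolding P_def
    proof
      assume ab': "0 \<le> a \<and> b \<le> 1"
      have "Q r' a b" if r': "r' \<in> {0..1}" "\<bar>r' - r\<bar> < d / 2" for r'
      proof -
        have sx: "s \<in> {0..1} \<and> \<bar>s - x\<bar> < d / 2" if "s \<in> {a..b}" for s
        proof -
          have "a \<le> s" "s \<le> b" using that by auto
          then have "- (s - x) < d / 2" "s - x < d / 2" using ab by argo+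
          then show ?thesis using that ab' unfolding abs_less_iff by auto
        qed
        have sub: "(\<lambda>s. h (r, s)) ` {a..b} \<subseteq> U" "(\<lambda>s. h (r', s)) ` {a..b} \<subseteq> U"
          using sx r r' d(1) near by auto
        then have "h (r, a) \<in> U" "h (r, b) \<in> U" "h (r', a) \<in> U" "h (r', b) \<in> U" using ab by auto
        then show ?thesis
          unfolding Q_def using tr_local[OF _ U(3) sub(1)] tr_local[OF _ U(3) sub(2)]
            E_trans[OF U(3)] k_trans[OF U(3)] by metis
      qed
      then show "\<exists>d>0. \<forall>r'\<in>{0..1}. \<bar>r' - r\<bar> < d \<longrightarrow> Q r' a b"
        using d(1) by (intro exI[of _ "d / 2"]) auto
    qed
    then show "\<exists>d>0. \<forall>a b. a \<le> x \<and> x \<le> b \<and> b - a < d \<longrightarrow> P a b"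
      using d(1) by (intro exI[of _ "d / 2"]) auto
  qed simp
  then show ?thesis by (simp add: P_def Q_def)
qed

text \<open>The homotopy that is constant in its first variable compares two subdivisions of the
  same path.\<close>

lemma tr_unique:
  assumes p: "path_in X p" and "tr p 0 1 l c" "tr p 0 1 l' c'"
  shows "l = l' \<and> c = c'"
proof -
  let ?h = "\<lambda>z :: real \<times> real. p (snd z)"
  have pc: "continuous_on {0..1} p" "p ` {0..1} \<subseteq> X" using p by (auto simp: path_in_iff)
  have "continuous_on ({0..1} \<times> {0..1}) ?h" "?h ` ({0..1} \<times> {0..1}) \<subseteq> X"
    using pc by (auto intro!: continuous_on_compose2[OF pc(1)] continuous_intros)
  from tr_rows[OF this, of 0] have *: "l * E (p 1) (p 1) = E (p 0) (p 0) * l'"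
    "c + l * k (p 1) (p 1) = k (p 0) (p 0) + E (p 0) (p 0) * c'"
    using assms(2,3) by fastforce+
  have "E x x = 1" "k x x = 0" if "x \<in> X" for x
    using cover[OF that] E_refl k_refl by blast+
  moreover have "p 0 \<in> X" "p 1 \<in> X" using pc(2) by auto
  ultimately show ?thesis using * by simp
qed

definition L :: "(real \<Rightarrow> 'a) \<Rightarrow> complex" where "L p = fst (SOME z. tr p 0 1 (fst z) (snd z))"
definition C :: "(real \<Rightarrow> 'a) \<Rightarrow> complex" where "C p = snd (SOME z. tr p 0 1 (fst z) (snd z))"

lemma tr_LC: "path_in X p \<Longrightarrow> tr p 0 1 (L p) (C p)"
proof -
  assume "path_in X p"
  then have "\<exists>z. tr p 0 1 (fst z) (snd z)" using tr_exists by force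
  then show ?thesis unfolding L_def C_def by (rule someI_ex)
qed

lemma LC_eqI: "path_in X p \<Longrightarrow> tr p 0 1 l c \<Longrightarrow> L p = l \<and> C p = c"
  using tr_unique tr_LC by blast

lemma tr_reparametrize:
  assumes "tr p u v l c" "0 < a" "\<And>s. u \<le> s \<Longrightarrow> s \<le> v \<Longrightarrow> q (a * s + b) = p s"
  shows "tr q (a * u + b) (a * v + b) l c"
  using assms
proof (induction rule: tr.induct)
  case (small u v U)
  have "q ` {a * u + b..a * v + b} \<subseteq> U"
  proof
    fix x assume "x \<in> q ` {a * u + b..a * v + b}"
    then obtain r where r: "a * u + b \<le> r" "r \<le> a * v + b" "x = q r" by auto
    define s where "s = (r - b) / a"
    have "r = a * s + b" "u \<le> s" "s \<le> v" using r \<open>0 < a\<close> by (auto simp: s_def field_simps)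
    then show "x \<in> U" using small r(3) by auto
  qed
  then have "tr q (a * u + b) (a * v + b) (E (q (a * u + b)) (q (a * v + b))) (k (q (a * u + b)) (q (a * v + b)))"
    using small by (intro tr.small) auto
  then show ?case using small by simp
next
  case (join u v l c w l' c')
  have "u \<le> v" "v \<le> w" using join.hyps tr_le by auto
  then show ?case using join by (intro tr.join) auto
qed

sublocale affine_system X L C
proof
  show "L p \<noteq> 0" if "path_in X p" for p using tr_nonzero[OF tr_LC[OF that]] .
  have join: "L (p +++ q) = L p * L q \<and> C (p +++ q) = C p + L p * C q"
    if pq: "path_in X p" "path_in X q" "pathfinish p = pathstart q" for p q
  proof -
    have "tr (p +++ q) (1 / 2 * 0 + 0) (1 / 2 * 1 + 0) (L p) (C p)"
      by (rule tr_reparametrize[OF tr_LC[OF pq(1)]]) (auto simp: joinpaths_def)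
    moreover have "tr (p +++ q) (1 / 2 * 0 + 1 / 2) (1 / 2 * 1 + 1 / 2) (L q) (C q)"
    proof (rule tr_reparametrize[OF tr_LC[OF pq(2)]])
      fix s :: real assume "0 \<le> s" "s \<le> 1"
      then show "(p +++ q) (1 / 2 * s + 1 / 2) = q s"
        using pq(3) by (cases "s = 0") (auto simp: joinpaths_def pathstart_def pathfinish_def field_simps)
    qed simp
    ultimately have "tr (p +++ q) 0 1 (L p * L q) (C p + L p * C q)"
      by (intro tr.join[of _ _ "1/2"]) simp_all
    then show ?thesis using LC_eqI path_in_join[OF pq] by blast
  qed
  show "L (p +++ q) = L p * L q" "C (p +++ q) = C p + L p * C q"
    if "path_in X p" "path_in X q" "pathfinish p = pathstart q" for p q using join[OF that] by auto
  have hom: "L p = L q \<and> C p = C q" if hom: "homotopic_paths X p q" for p q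
  proof -
    obtain h where h: "continuous_on ({0..1::real} \<times> {0..1::real}) h" "h ` ({0..1} \<times> {0..1}) \<subseteq> X"
      "\<And>x. x \<in> {0..1} \<Longrightarrow> h (0, x) = p x" "\<And>x. x \<in> {0..1} \<Longrightarrow> h (1, x) = q x"
      "\<And>t. t \<in> {0..1} \<Longrightarrow> h (t, 0) = pathstart p" "\<And>t. t \<in> {0..1} \<Longrightarrow> h (t, 1) = pathfinish p"
      using hom unfolding homotopic_paths by (auto simp: pathfinish_def pathstart_def image_subset_iff_funcset)
    have row: "path_in X (\<lambda>s. h (r, s))" if "r \<in> {0..1}" for r
      unfolding path_in_iff using h(2) that
      by (auto intro!: continuous_on_compose2[OF h(1)] continuous_intros)
    have ends: "pathstart p \<in> X" "pathfinish p \<in> X"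
      using homotopic_paths_imp_subset[OF hom] by auto
    have refl: "E x x = 1" "k x x = 0" if "x \<in> X" for x
      using cover[OF that] E_refl k_refl by blast+
    \<comment> \<open>All rows have the same end points, where \<open>E\<close> is 1 and
      \<open>k\<close> is 0; so the ladder shows that \<open>T\<close> is locally constant.\<close>
    define T where "T r = (L (\<lambda>s. h (r, s)), C (\<lambda>s. h (r, s)))" for r
    have loc: "\<exists>d>0. \<forall>r'\<in>{0..1}. \<bar>r' - r\<bar> < d \<longrightarrow> T r = T r'" if r: "r \<in> {0..1}" for r
    proof -
      obtain d where d: "d > 0" "\<forall>r'\<in>{0..1}. \<bar>r' - r\<bar> < d \<longrightarrow> (\<forall>l c l' c'.
        tr (\<lambda>s. h (r, s)) 0 1 l c \<and> tr (\<lambda>s. h (r', s)) 0 1 l' c' \<longrightarrow>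
        l * E (h (r, 1)) (h (r', 1)) = E (h (r, 0)) (h (r', 0)) * l' \<and>
        c + l * k (h (r, 1)) (h (r', 1)) = k (h (r, 0)) (h (r', 0)) + E (h (r, 0)) (h (r', 0)) * c')"
        using tr_rows[OF h(1,2) r] by blast
      have "T r = T r'" if r': "r' \<in> {0..1}" "\<bar>r' - r\<bar> < d" for r'
        using d(2)[rule_format, OF r' conjI[OF tr_LC[OF row[OF r]] tr_LC[OF row[OF r'(1)]]]]
          h(5,6)[OF r] h(5,6)[OF r'(1)] refl ends by (simp add: T_def)
      then show ?thesis using d(1) by blast
    qed
    define P where "P a b \<longleftrightarrow> (0 \<le> a \<and> b \<le> 1 \<longrightarrow> T a = T b)" for a b
    have "P 0 1"
    proof (rule Bolzano[of 0 1 P])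
      fix x :: real assume x: "0 \<le> x" "x \<le> 1"
      then obtain d where d: "d > 0" "\<And>r'. r' \<in> {0..1} \<Longrightarrow> \<bar>r' - x\<bar> < d \<Longrightarrow> T x = T r'"
        using loc[of x] by auto
      have "P a b" if "a \<le> x" "x \<le> b" "b - a < d" for a b
        unfolding P_def
      proof
        assume "0 \<le> a \<and> b \<le> 1"
        then show "T a = T b" using d(2)[of a] d(2)[of b] that x by auto
      qed
      then show "\<exists>d>0. \<forall>a b. a \<le> x \<and> x \<le> b \<and> b - a < d \<longrightarrow> P a b" using d(1) by blast
    qed (auto simp: P_def)
    then have "T 0 = T 1" by (simp add: P_def)
    moreover have "T 0 = (L p, C p)" "T 1 = (L q, C q)"
    proof -
      have "tr p 0 1 (L (\<lambda>s. h (0, s))) (C (\<lambda>s. h (0, s)))"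
        using tr_reparametrize[OF tr_LC[OF row[of 0]], of 1 p 0] h(3) by simp
      moreover have "tr q 0 1 (L (\<lambda>s. h (1, s))) (C (\<lambda>s. h (1, s)))"
        using tr_reparametrize[OF tr_LC[OF row[of 1]], of 1 q 0] h(4) by simp
      moreover have "path_in X p" "path_in X q"
        using homotopic_paths_imp_subset[OF hom] homotopic_paths_imp_path[OF hom] by (auto simp: path_in_def)
      ultimately show "T 0 = (L p, C p)" "T 1 = (L q, C q)"
        using LC_eqI by (auto simp: T_def)
    qed
    ultimately show ?thesis by simp
  qed
  show "L p = L q" "C p = C q" if "homotopic_paths X p q" for p q using hom[OF that] by auto
qed

end

section \<open>The translated component lies in the characteristic variety\<close>

abbreviation dX :: "(nat \<Rightarrow> complex) set" where "dX \<equiv> complement 3 8 dB3"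

lemma dX_iff: "x \<in> dX \<longleftrightarrow> x \<in> cspace 3 \<and> (\<forall>j<8. lform j x \<noteq> 0)"
  by (simp add: complement_dB3)

lemma sum_lessThan_8: "(\<Sum>j<8. g j) = g 0 + g 1 + g 2 + g 3 + g 4 + g 5 + g 6 + g (7::nat)"
  for g :: "nat \<Rightarrow> complex"
  by (simp add: eval_nat_numeral)

text \<open>The pencil whose fibre over 1 has multiplicity two on the complement: \<open>1 - pmap\<close> is the square
  of \<open>x 0 / x 2\<close>, up to a product of forms of the arrangement.\<close>

definition pmap :: "(nat \<Rightarrow> complex) \<Rightarrow> complex" where
  "pmap x = (lform 0 x * lform 0 x * lform 4 x * lform 5 x) / (lform 1 x * lform 1 x * lform 2 x * lform 3 x)"

text \<open>The identity \<open>z^2 (x^2 - y^2) - y^2 (x^2 - z^2) = - x^2 (y - z) (y + z)\<close>,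
  in which the deleted plane appears squared.\<close>

lemma one_minus_pmap:
  assumes "x \<in> dX"
  shows "1 - pmap x = - (x 0 * x 0 * lform 6 x * lform 7 x) / (lform 1 x * lform 1 x * lform 2 x * lform 3 x)"
proof -
  have nz: "lform 1 x * lform 1 x * lform 2 x * lform 3 x \<noteq> 0"
    using assms unfolding dX_iff by (simp del: lform_simps)
  have "lform 1 x * lform 1 x * lform 2 x * lform 3 x - lform 0 x * lform 0 x * lform 4 x * lform 5 x =
      - (x 0 * x 0 * lform 6 x * lform 7 x)"
    unfolding lform_simps by (simp add: algebra_simps)
  then have "- (x 0 * x 0 * lform 6 x * lform 7 x) / (lform 1 x * lform 1 x * lform 2 x * lform 3 x) =
     (lform 1 x * lform 1 x * lform 2 x * lform 3 x - lform 0 x * lform 0 x * lform 4 x * lform 5 x) /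
     (lform 1 x * lform 1 x * lform 2 x * lform 3 x)" by simp
  also have "\<dots> = 1 - pmap x" unfolding pmap_def diff_divide_distrib using nz by simp
  finally show ?thesis ..
qed

lemma continuous_on_lform: "j < 8 \<Longrightarrow> continuous_on S (lform j)"
proof -
  have "continuous_on S (\<lambda>x :: nat \<Rightarrow> complex. x i)" for i by (rule continuous_on_proj)
  then show "j < 8 \<Longrightarrow> continuous_on S (lform j)"
    unfolding less_8 by (elim disjE) (simp_all add: continuous_on_add continuous_on_diff lform_simps[abs_def])
qed

lemma continuous_on_pmap: "continuous_on dX pmap"
  unfolding pmap_def using continuous_on_lform[of _ dX]
  by (intro continuous_on_divide continuous_on_mult) (simp_all add: dX_iff del: lform_simps)

text \<open>The bound 1/10 is so small that sums of eight such imaginary parts, even with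
  \<open>pi\<close> added, stay below \<open>2 * pi\<close>. Equality of exponentials then gives
  equality of logarithms.\<close>

lemma Ln_near:
  assumes "cmod (w - 1) < 1 / 20"
  shows "w \<noteq> 0" "\<bar>Im (Ln w)\<bar> < 1 / 10"
proof -
  show "w \<noteq> 0" using assms by auto
  have "cmod (Ln (1 + (w - 1))) \<le> 2 * cmod (w - 1)" using assms by (intro norm_Ln_le) auto
  then have "cmod (Ln w) < 1 / 10" using assms by simp
  then show "\<bar>Im (Ln w)\<bar> < 1 / 10" using abs_Im_le_cmod[of "Ln w"] by linarith
qed

lemma pi_gt_2: "2 < pi"
  using pi_gt3 by simp

section \<open>The local system of a point of the curve and the crossing cocycle\<close>

locale translated_torus = fixes a :: complex
begin

text \<open>The product of the \<open>lform j\<close> to the powers \<open>ex j\<close> is, up to a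
  constant, \<open>pmap\<close> to the power \<open>a\<close> times the square root of
  \<open>1 - pmap\<close> times \<open>x 2 / x 0\<close>. The halves yield the monodromy -1.\<close>

definition ex :: "nat \<Rightarrow> complex" where
  "ex j = [2 * a, - 2 * a, - a - 1 / 2, - a - 1 / 2, a, a, 1 / 2, 1 / 2] ! j"

lemma ex_simps:
  "ex 0 = 2 * a" "ex (Suc 0) = - 2 * a" "ex 2 = - a - 1 / 2" "ex 3 = - a - 1 / 2"
  "ex 4 = a" "ex 5 = a" "ex 6 = 1 / 2" "ex 7 = 1 / 2"
  by (simp_all add: ex_def)

definition lg :: "nat \<Rightarrow> (nat \<Rightarrow> complex) \<Rightarrow> (nat \<Rightarrow> complex) \<Rightarrow> complex" where
  "lg j x y = Ln (lform j y / lform j x)"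

text \<open>The quotient of the values at \<open>y\<close> and at \<open>x\<close> of the
  multivalued product of powers; for nearby points the principal logarithms select the right
  branch.\<close>

definition E :: "(nat \<Rightarrow> complex) \<Rightarrow> (nat \<Rightarrow> complex) \<Rightarrow> complex" where
  "E x y = exp (\<Sum>j<8. ex j * lg j x y)"

text \<open>A branch, defined where \<open>Re (pmap x) < 0\<close>, of the inverse of the multivalued function
  \<open>\<Prod>j<8. lform j x powr ex j\<close>.\<close>

definition ph :: "(nat \<Rightarrow> complex) \<Rightarrow> complex" where
  "ph x = exp (- a * Ln (- pmap x) - Ln (1 - pmap x) / 2) * (x 0 / x 2)"

definition side :: "(nat \<Rightarrow> complex) \<Rightarrow> complex" where
  "side x = of_bool (Im (pmap x) \<ge> 0)"

text \<open>Crossings of the cut \<open>pmap x \<le> 0\<close> are counted with weight \<open>ph\<close>.\<close>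

definition k :: "(nat \<Rightarrow> complex) \<Rightarrow> (nat \<Rightarrow> complex) \<Rightarrow> complex" where
  "k x y = (if Re (pmap x) < 0 \<and> Re (pmap y) < 0 then ph x * (side x - side y) else 0)"

text \<open>The half planes \<open>Re > 0\<close>, \<open>Im > 0\<close>, \<open>Im < 0\<close>,
  \<open>Re < 0\<close> cover the values of \<open>pmap\<close>, which is never 0, and only in the
  last can a good set meet the cut. The coordinate \<open>x 0\<close> is controlled there because
  \<open>ph\<close> contains it; on the complement it vanishes only where \<open>pmap\<close> is
  1.\<close>

definition good :: "(nat \<Rightarrow> complex) set \<Rightarrow> bool" where
  "good U \<longleftrightarrow> U \<subseteq> dX \<and>
     (\<forall>x\<in>U. \<forall>y\<in>U. (\<forall>j<8. cmod (lform j y / lform j x - 1) < 1 / 20) \<and>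
        (Re (pmap x) < 0 \<and> Re (pmap y) < 0 \<longrightarrow> cmod (y 0 / x 0 - 1) < 1 / 20)) \<and>
     ((\<forall>x\<in>U. Re (pmap x) > 0) \<or> (\<forall>x\<in>U. Im (pmap x) > 0) \<or> (\<forall>x\<in>U. Im (pmap x) < 0) \<or> (\<forall>x\<in>U. Re (pmap x) < 0))"

lemma goodD:
  assumes "good U" "x \<in> U" "y \<in> U"
  shows "x \<in> dX" "j < 8 \<Longrightarrow> cmod (lform j y / lform j x - 1) < 1 / 20"
    "Re (pmap x) < 0 \<Longrightarrow> Re (pmap y) < 0 \<Longrightarrow> cmod (y 0 / x 0 - 1) < 1 / 20"
  using assms unfolding good_def by blast+

lemma lg_bound: "good U \<Longrightarrow> x \<in> U \<Longrightarrow> y \<in> U \<Longrightarrow> j < 8 \<Longrightarrow> \<bar>Im (lg j x y)\<bar> < 1 / 10"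
  unfolding lg_def using goodD(2) Ln_near(2) by blast

lemma exp_lg: "good U \<Longrightarrow> x \<in> U \<Longrightarrow> y \<in> U \<Longrightarrow> j < 8 \<Longrightarrow> exp (lg j x y) = lform j y / lform j x"
  unfolding lg_def using goodD(2) Ln_near(1) by (metis exp_Ln)

lemma lform_nz: "good U \<Longrightarrow> x \<in> U \<Longrightarrow> j < 8 \<Longrightarrow> lform j x \<noteq> 0"
  using goodD(1) dX_iff by blast

lemma lg_trans:
  assumes "good U" "x \<in> U" "y \<in> U" "z \<in> U" "j < 8"
  shows "lg j x y + lg j y z = lg j x z"
proof (rule exp_complex_eqI)
  show "\<bar>Im (lg j x y + lg j y z) - Im (lg j x z)\<bar> < 2 * pi"
    using lg_bound[OF assms(1,2,3,5)] lg_bound[OF assms(1,3,4,5)] lg_bound[OF assms(1,2,4,5)] pi_gt_2 by simp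
  show "exp (lg j x y + lg j y z) = exp (lg j x z)"
    unfolding exp_add exp_lg[OF assms(1,2,3,5)] exp_lg[OF assms(1,3,4,5)] exp_lg[OF assms(1,2,4,5)]
    using lform_nz[OF assms(1,3,5)] by simp
qed

lemma E_trans:
  assumes "good U" "x \<in> U" "y \<in> U" "z \<in> U"
  shows "E x y * E y z = E x z"
proof -
  have "(\<Sum>j<8. ex j * lg j x y) + (\<Sum>j<8. ex j * lg j y z) = (\<Sum>j<8. ex j * lg j x z)"
    unfolding sum.distrib[symmetric] distrib_left[symmetric]
    by (intro sum.cong refl) (simp add: lg_trans[OF assms])
  then show ?thesis unfolding E_def exp_add[symmetric] by simp
qed

text \<open>\<open>E\<close> and the quotients of \<open>ph\<close> are exponentials of the same
  combinations of logarithms. The identities \<open>A\<close> and \<open>B\<close> between these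
  hold up to multiples of \<open>2 * pi * \<i>\<close> by the formulas for \<open>pmap\<close> and
  \<open>1 - pmap\<close>, and exactly since all imaginary parts are small.\<close>

lemma ph_flat:
  assumes U: "good U" "x \<in> U" "y \<in> U" and re: "Re (pmap x) < 0" "Re (pmap y) < 0"
  shows "E x y * ph y = ph x"
proof -
  let ?l = "\<lambda>j. lg j x y"
  note nz = lform_nz[OF U(1,2)] lform_nz[OF U(1,3)]
  note el = exp_lg[OF U] and bd = lg_bound[OF U]
  have X: "x \<in> dX" "y \<in> dX" using goodD(1) U by blast+
  have f1: "1 - pmap x \<noteq> 0" "1 - pmap y \<noteq> 0" "pmap x \<noteq> 0" "pmap y \<noteq> 0" using re by auto
  have x0: "x 0 \<noteq> 0" "y 0 \<noteq> 0" using one_minus_pmap[OF X(1)] one_minus_pmap[OF X(2)] f1 by auto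
  define m where "m = Ln (y 0 / x 0)"
  have m: "exp m = y 0 / x 0" "\<bar>Im m\<bar> < 1 / 10"
    using Ln_near[OF goodD(3)[OF U re]] by (auto simp: m_def)
  have half: "\<bar>Im (Ln (- pmap x))\<bar> < pi / 2" "\<bar>Im (Ln (- pmap y))\<bar> < pi / 2"
    "\<bar>Im (Ln (1 - pmap x))\<bar> < pi / 2" "\<bar>Im (Ln (1 - pmap y))\<bar> < pi / 2"
    by (rule Re_Ln_pos_lt[THEN iffD2]; use re f1 in simp)+
  have b: "\<bar>Im (?l 0)\<bar> < 1 / 10" "\<bar>Im (?l 1)\<bar> < 1 / 10" "\<bar>Im (?l 2)\<bar> < 1 / 10" "\<bar>Im (?l 3)\<bar> < 1 / 10"
     "\<bar>Im (?l 4)\<bar> < 1 / 10" "\<bar>Im (?l 5)\<bar> < 1 / 10" "\<bar>Im (?l 6)\<bar> < 1 / 10" "\<bar>Im (?l 7)\<bar> < 1 / 10"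
    by (rule bd; simp)+
  have e: "exp (?l 0) = lform 0 y / lform 0 x" "exp (?l 1) = lform 1 y / lform 1 x"
    "exp (?l 2) = lform 2 y / lform 2 x" "exp (?l 3) = lform 3 y / lform 3 x"
    "exp (?l 4) = lform 4 y / lform 4 x" "exp (?l 5) = lform 5 y / lform 5 x"
    "exp (?l 6) = lform 6 y / lform 6 x" "exp (?l 7) = lform 7 y / lform 7 x"
    by (rule el; simp)+
  have n: "lform 0 x \<noteq> 0" "lform 1 x \<noteq> 0" "lform 2 x \<noteq> 0" "lform 3 x \<noteq> 0" "lform 4 x \<noteq> 0" "lform 5 x \<noteq> 0"
    "lform 6 x \<noteq> 0" "lform 7 x \<noteq> 0"
    "lform 0 y \<noteq> 0" "lform 1 y \<noteq> 0" "lform 2 y \<noteq> 0" "lform 3 y \<noteq> 0" "lform 4 y \<noteq> 0" "lform 5 y \<noteq> 0"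
    "lform 6 y \<noteq> 0" "lform 7 y \<noteq> 0"
    by (rule nz; simp)+
  have A: "?l 0 + ?l 0 + ?l 4 + ?l 5 - ?l 1 - ?l 1 - ?l 2 - ?l 3 = Ln (- pmap y) - Ln (- pmap x)"
  proof (rule exp_complex_eqI)
    show "\<bar>Im (?l 0 + ?l 0 + ?l 4 + ?l 5 - ?l 1 - ?l 1 - ?l 2 - ?l 3) - Im (Ln (- pmap y) - Ln (- pmap x))\<bar> < 2 * pi"
      unfolding minus_complex.sel plus_complex.sel using b half pi_gt_2 unfolding abs_less_iff by linarith
    show "exp (?l 0 + ?l 0 + ?l 4 + ?l 5 - ?l 1 - ?l 1 - ?l 2 - ?l 3) = exp (Ln (- pmap y) - Ln (- pmap x))"
      unfolding exp_add exp_diff e using f1 n by (simp add: pmap_def field_simps del: lform_simps)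
  qed
  have B: "?l 6 + ?l 7 - ?l 2 - ?l 3 = Ln (1 - pmap y) - Ln (1 - pmap x) - m - m + ?l 1 + ?l 1"
  proof (rule exp_complex_eqI)
    show "\<bar>Im (?l 6 + ?l 7 - ?l 2 - ?l 3) - Im (Ln (1 - pmap y) - Ln (1 - pmap x) - m - m + ?l 1 + ?l 1)\<bar> < 2 * pi"
      unfolding minus_complex.sel plus_complex.sel using b half pi_gt_2 m(2) unfolding abs_less_iff by linarith
    have "exp (Ln (1 - pmap y)) = 1 - pmap y" "exp (Ln (1 - pmap x)) = 1 - pmap x" using f1 by simp_all
    then show "exp (?l 6 + ?l 7 - ?l 2 - ?l 3) = exp (Ln (1 - pmap y) - Ln (1 - pmap x) - m - m + ?l 1 + ?l 1)"
      unfolding exp_add exp_diff e m(1) one_minus_pmap[OF X(1)] one_minus_pmap[OF X(2)]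
      using n x0 by (simp add: field_simps del: lform_simps)
  qed
  have "(\<Sum>j<8. ex j * ?l j) = a * (?l 0 + ?l 0 + ?l 4 + ?l 5 - ?l 1 - ?l 1 - ?l 2 - ?l 3) + (?l 6 + ?l 7 - ?l 2 - ?l 3) / 2"
    unfolding sum_lessThan_8 by (simp add: ex_def algebra_simps add_divide_distrib diff_divide_distrib)
  also have "\<dots> = a * (Ln (- pmap y) - Ln (- pmap x)) + (Ln (1 - pmap y) - Ln (1 - pmap x)) / 2 - m + ?l 1"
    unfolding A B by (simp add: add_divide_distrib diff_divide_distrib)
  finally have S: "(\<Sum>j<8. ex j * ?l j) + (- a * Ln (- pmap y) - Ln (1 - pmap y) / 2) =
      (- a * Ln (- pmap x) - Ln (1 - pmap x) / 2) - m + ?l 1"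
    by (simp add: algebra_simps diff_divide_distrib)
  have "E x y * ph y = exp ((\<Sum>j<8. ex j * ?l j) + (- a * Ln (- pmap y) - Ln (1 - pmap y) / 2)) * (y 0 / y 2)"
    unfolding E_def ph_def exp_add by simp
  also have "\<dots> = exp (- a * Ln (- pmap x) - Ln (1 - pmap x) / 2) * ((lform 1 y / lform 1 x) / (y 0 / x 0) * (y 0 / y 2))"
    unfolding S exp_add exp_diff[of _ m] m(1) e(2) by simp
  also have "(lform 1 y / lform 1 x) / (y 0 / x 0) * (y 0 / y 2) = x 0 / x 2"
    using n(2,10) x0 by (simp add: field_simps)
  finally show ?thesis by (simp add: ph_def)
qed

text \<open>In the first three kinds of good sets no crossing is counted. In the last,
  \<open>ph\<close> is flat for \<open>E\<close>, so the weighted differences of \<open>side\<close>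
  telescope.\<close>

lemma k_trans:
  assumes U: "good U" "x \<in> U" "y \<in> U" "z \<in> U"
  shows "k x y + E x y * k y z = k x z"
proof -
  from U(1) consider "\<forall>x\<in>U. Re (pmap x) > 0" | "\<forall>x\<in>U. Im (pmap x) > 0" | "\<forall>x\<in>U. Im (pmap x) < 0" | "\<forall>x\<in>U. Re (pmap x) < 0"
    unfolding good_def by blast
  then show ?thesis
  proof cases
    case 1
    then have "\<not> Re (pmap x) < 0" "\<not> Re (pmap y) < 0" using U by fastforce+
    then show ?thesis by (simp add: k_def)
  next
    case 2
    then have "side x = 1" "side y = 1" "side z = 1" using U by (auto simp: side_def intro: less_imp_le)
    then show ?thesis by (simp add: k_def)
  next
    case 3
    then have "side x = 0" "side y = 0" "side z = 0" using U by (auto simp: side_def not_le)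
    then show ?thesis by (simp add: k_def)
  next
    case 4
    then have re: "Re (pmap x) < 0" "Re (pmap y) < 0" "Re (pmap z) < 0" using U by auto
    have "k x y + E x y * k y z = ph x * (side x - side y) + (E x y * ph y) * (side y - side z)"
      using re by (simp add: k_def)
    also have "\<dots> = k x z" unfolding ph_flat[OF U(1-3) re(1,2)] using re by (simp add: k_def algebra_simps)
    finally show ?thesis .
  qed
qed

lemma openin_less: "continuous_on dX g \<Longrightarrow> openin (top_of_set dX) {y \<in> dX. g y < (c::real)}"
proof -
  assume "continuous_on dX g"
  then have "openin (top_of_set dX) (dX \<inter> g -` {..<c})"
    by (intro continuous_openin_preimage_gen open_lessThan)
  moreover have "dX \<inter> g -` {..<c} = {y \<in> dX. g y < c}" by auto
  ultimately show ?thesis by simp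
qed

text \<open>Neighbourhoods are measured from their centre, with 1/50, whereas good sets require
  closeness of all pairs, with 1/20.\<close>

lemma ratio_close:
  assumes "cmod (r - 1) < 1 / 50" "cmod (r' - 1) < 1 / 50"
  shows "cmod (r' / r - 1) < 1 / 20"
proof -
  have "1 \<le> cmod r + cmod (r - 1)" using norm_triangle_ineq4[of r "r - 1"] by simp
  then have r: "cmod r > 49 / 50" using assms(1) by linarith
  then have "r \<noteq> 0" by auto
  have "cmod (r' - r) \<le> cmod (r' - 1) + cmod (r - 1)" using norm_triangle_ineq4[of "r' - 1" "r - 1"] by simp
  then have "cmod (r' - r) < 1 / 20 * (49 / 50)" using assms by linarith
  also have "\<dots> \<le> 1 / 20 * cmod r" using r by simp
  finally have "cmod (r' - r) / cmod r < 1 / 20" using r by (simp add: divide_less_eq)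
  moreover have "r' / r - 1 = (r' - r) / r" using \<open>r \<noteq> 0\<close> by (simp add: field_simps)
  ultimately show ?thesis by (simp add: norm_divide)
qed

lemma good_cover:
  assumes x: "x \<in> dX"
  shows "\<exists>U. openin (top_of_set dX) U \<and> x \<in> U \<and> good U"
proof -
  have nz: "lform j x \<noteq> 0" if "j < 8" for j using x that unfolding dX_iff by blast
  define V where "V = (\<Inter>j\<in>{..<8}. {y \<in> dX. cmod (lform j y / lform j x - 1) < 1 / 50})"
  have V: "openin (top_of_set dX) V"
    unfolding V_def
    by (intro openin_INT2 openin_less continuous_intros continuous_on_lform) (use nz in \<open>auto simp: lessThan_empty_iff\<close>)
  have xV: "x \<in> V" using x nz by (simp add: V_def del: lform_simps)
  have V_close: "cmod (lform j z / lform j y - 1) < 1 / 20" if "y \<in> V" "z \<in> V" "j < 8" for y z j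
  proof -
    have "cmod (lform j y / lform j x - 1) < 1 / 50" "cmod (lform j z / lform j x - 1) < 1 / 50"
      using that unfolding V_def by blast+
    from ratio_close[OF this] show ?thesis using nz[OF that(3)] by simp
  qed
  have VX: "V \<subseteq> dX"
  proof
    fix y assume "y \<in> V"
    then have "y \<in> {y \<in> dX. cmod (lform 0 y / lform 0 x - 1) < 1 / 50}" unfolding V_def by (rule INT_D) simp
    then show "y \<in> dX" by simp
  qed
  have cr: "continuous_on dX (\<lambda>y. Re (pmap y))" "continuous_on dX (\<lambda>y. Im (pmap y))"
    "continuous_on dX (\<lambda>y. - Re (pmap y))" "continuous_on dX (\<lambda>y. - Im (pmap y))"
    by (intro continuous_intros continuous_on_pmap)+
  show ?thesis
  proof (cases "Re (pmap x) > 0")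
    case True
    define U where "U = V \<inter> {y \<in> dX. - Re (pmap y) < 0}"
    have "openin (top_of_set dX) U" unfolding U_def by (intro openin_Int V openin_less cr)
    moreover have "x \<in> U" using True x xV by (simp add: U_def)
    moreover have "good U"
      unfolding good_def
    proof (intro conjI ballI allI impI)
      show "U \<subseteq> dX" using VX by (auto simp: U_def)
      show "cmod (lform j z / lform j y - 1) < 1 / 20" if "y \<in> U" "z \<in> U" "j < 8" for y z j
        using V_close that unfolding U_def by blast
      have pos: "\<forall>y\<in>U. Re (pmap y) > 0" by (simp add: U_def)
      then show "(\<forall>x\<in>U. Re (pmap x) > 0) \<or> (\<forall>x\<in>U. Im (pmap x) > 0) \<or> (\<forall>x\<in>U. Im (pmap x) < 0) \<or> (\<forall>x\<in>U. Re (pmap x) < 0)"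
        by blast
      show "cmod (z 0 / y 0 - 1) < 1 / 20" if "y \<in> U" "Re (pmap y) < 0 \<and> Re (pmap z) < 0" for y z
        using pos that by fastforce
    qed
    ultimately show ?thesis by blast
  next
    case False
    have x0: "x 0 \<noteq> 0"
    proof
      assume "x 0 = 0"
      then have "pmap x = 1" using one_minus_pmap[OF x] by simp
      then show False using False by simp
    qed
    define W where "W = V \<inter> {y \<in> dX. cmod (y 0 / x 0 - 1) < 1 / 50}"
    have W: "openin (top_of_set dX) W"
      unfolding W_def using x0 by (intro openin_Int V openin_less continuous_intros continuous_on_proj) auto
    have xW: "x \<in> W" using x xV x0 by (simp add: W_def)
    have WX: "W \<subseteq> dX" using VX by (auto simp: W_def)
    have W_close: "cmod (lform j z / lform j y - 1) < 1 / 20" if "y \<in> W" "z \<in> W" "j < 8" for y z j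
      using V_close that by (auto simp: W_def simp del: lform_simps)
    have W_close0: "cmod (z 0 / y 0 - 1) < 1 / 20" if "y \<in> W" "z \<in> W" for y z
      using ratio_close[of "y 0 / x 0" "z 0 / x 0"] that x0 by (simp add: W_def)
    have fin: ?thesis if g: "continuous_on dX g" "g x < (0::real)"
      and t: "(\<forall>y\<in>dX. g y < 0 \<longrightarrow> Im (pmap y) > 0) \<or> (\<forall>y\<in>dX. g y < 0 \<longrightarrow> Im (pmap y) < 0) \<or> (\<forall>y\<in>dX. g y < 0 \<longrightarrow> Re (pmap y) < 0)" for g
    proof (intro exI[of _ "W \<inter> {y \<in> dX. g y < 0}"] conjI)
      show "openin (top_of_set dX) (W \<inter> {y \<in> dX. g y < 0})" by (intro openin_Int W openin_less g)
      show "x \<in> W \<inter> {y \<in> dX. g y < 0}" using xW x g(2) by simp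
      show "good (W \<inter> {y \<in> dX. g y < 0})"
        unfolding good_def
      proof (intro conjI ballI allI impI)
        show "W \<inter> {y \<in> dX. g y < 0} \<subseteq> dX" by auto
        show "cmod (lform j z / lform j y - 1) < 1 / 20"
          if "y \<in> W \<inter> {y \<in> dX. g y < 0}" "z \<in> W \<inter> {y \<in> dX. g y < 0}" "j < 8" for y z j
          using W_close that by blast
        show "cmod (z 0 / y 0 - 1) < 1 / 20"
          if "y \<in> W \<inter> {y \<in> dX. g y < 0}" "z \<in> W \<inter> {y \<in> dX. g y < 0}" for y z
          using W_close0 that by blast
      qed (use t in blast)
    qed
    have "pmap x \<noteq> 0"
      using nz[of 0] nz[of 1] nz[of 2] nz[of 3] nz[of 4] nz[of 5] by (simp add: pmap_def del: lform_simps)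
    then have "Re (pmap x) \<noteq> 0 \<or> Im (pmap x) \<noteq> 0" by (auto simp: complex_eq_iff)
    then consider "Im (pmap x) > 0" | "Im (pmap x) < 0" | "Re (pmap x) < 0"
      using False by linarith
    then show ?thesis
    proof cases
      case 1 then show ?thesis by (intro fin[OF cr(4)]) auto
    next
      case 2 then show ?thesis by (intro fin[OF cr(2)]) auto
    next
      case 3 then show ?thesis by (intro fin[OF cr(1)]) auto
    qed
  qed
qed

sublocale local_cocycle dX good E k
proof
  show "E x y \<noteq> 0" for x y by (simp add: E_def)
qed (rule good_cover E_trans k_trans; assumption)+

text \<open>\<open>\<theta>\<close> is a lift of the logarithms of the forms along the path. On each
  piece in a good set its increments agree with the principal logarithms \<open>lg\<close>, and the
  increments add up.\<close>

lemma tr_exp: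
  assumes "tr p u v l c" and \<theta>: "\<And>j s. j < 8 \<Longrightarrow> u \<le> s \<Longrightarrow> s \<le> v \<Longrightarrow> lform j (p s) = exp (\<theta> j s)"
    and i: "i < 8" "\<And>s. u \<le> s \<Longrightarrow> s \<le> v \<Longrightarrow> \<theta> i s = b + 2 * of_real pi * \<i> * of_real s"
    and j: "\<And>j s. j < 8 \<Longrightarrow> j \<noteq> i \<Longrightarrow> u \<le> s \<Longrightarrow> s \<le> v \<Longrightarrow> \<bar>Im (\<theta> j s) - B j\<bar> < pi / 2"
  shows "l = exp (\<Sum>j<8. ex j * (\<theta> j v - \<theta> j u))"
  using assms
proof (induction rule: tr.induct)
  case (small u v U)
  have pU: "p u \<in> U" "p v \<in> U" using small.hyps by auto
  have "lg j (p u) (p v) = \<theta> j v - \<theta> j u" if j: "j < 8" for j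
  proof (rule exp_complex_eqI)
    show "exp (lg j (p u) (p v)) = exp (\<theta> j v - \<theta> j u)"
      using small.prems(1)[OF j] small.hyps(1) by (simp add: exp_lg[OF small.hyps(2) pU j] exp_diff)
    note lgb = lg_bound[OF small.hyps(2) pU j]
    show "\<bar>Im (lg j (p u) (p v)) - Im (\<theta> j v - \<theta> j u)\<bar> < 2 * pi"
    proof (cases "j = i")
      case False
      have "\<bar>Im (\<theta> j v) - B j\<bar> < pi / 2" "\<bar>Im (\<theta> j u) - B j\<bar> < pi / 2"
        using small.prems(4)[OF j False] small.hyps(1) by auto
      then show ?thesis using lgb pi_gt_2 unfolding minus_complex.sel abs_less_iff by linarith
    next
      case True
      \<comment> \<open>A half turn multiplies \<open>lform i\<close> by -1, which is not within
        1/20 of 1, so no piece in a good set lasts that long.\<close>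
      have "v - u < 1 / 2"
      proof (rule ccontr)
        assume "\<not> v - u < 1 / 2"
        then have w: "u \<le> u + 1 / 2" "u + 1 / 2 \<le> v" by auto
        then have "p (u + 1 / 2) \<in> U" using small.hyps(3) by auto
        then have "cmod (lform i (p (u + 1 / 2)) / lform i (p u) - 1) < 1 / 20"
          using goodD(2)[OF small.hyps(2) pU(1)] i(1) by blast
        moreover have "lform i (p (u + 1 / 2)) / lform i (p u) = exp (\<theta> i (u + 1 / 2) - \<theta> i u)"
          using small.prems(1)[OF i(1)] w by (simp add: exp_diff)
        moreover have "\<theta> i (u + 1 / 2) - \<theta> i u = of_real pi * \<i>"
          using small.prems(3)[of u] small.prems(3)[of "u + 1 / 2"] w by (simp add: algebra_simps)
        ultimately show False by (simp add: exp_pi_i)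
      qed
      moreover have "Im (\<theta> j v - \<theta> j u) = 2 * pi * (v - u)"
        using small.prems(3)[of u] small.prems(3)[of v] small.hyps(1) True by (simp add: algebra_simps)
      moreover have "0 \<le> 2 * pi * (v - u)" "2 * pi * (v - u) < 2 * pi * (1 / 2)" if "v - u < 1 / 2"
        using that small.hyps(1) by (simp, intro mult_strict_left_mono) auto
      ultimately show ?thesis using lgb pi_gt_2 unfolding abs_less_iff by linarith
    qed
  qed
  then show ?case unfolding E_def by (intro arg_cong[of _ _ exp] sum.cong) auto
next
  case (join u v l c w l' c')
  have le: "u \<le> v" "v \<le> w" using join.hyps tr_le by auto
  have "l = exp (\<Sum>j<8. ex j * (\<theta> j v - \<theta> j u))" by (rule join.IH(1)) (use join.prems le in auto)
  moreover have "l' = exp (\<Sum>j<8. ex j * (\<theta> j w - \<theta> j v))" by (rule join.IH(2)) (use join.prems le in auto)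
  moreover have "(\<Sum>j<8. ex j * (\<theta> j v - \<theta> j u)) + (\<Sum>j<8. ex j * (\<theta> j w - \<theta> j v)) =
      (\<Sum>j<8. ex j * (\<theta> j w - \<theta> j u))"
    unfolding sum.distrib[symmetric] by (intro sum.cong) (auto simp: algebra_simps)
  ultimately show ?case unfolding exp_add[symmetric] by (simp add: exp_add[symmetric])
qed

text \<open>Along the meridian \<open>lform i\<close> turns once around 0. Any other form has no
  zero on the disc, so its constant term dominates its linear term and it stays in a half
  plane.\<close>

lemma L_meridian:
  assumes g: "is_meridian 3 8 dB3 i g" and i: "i < 8"
  shows "L g = exp (2 * of_real pi * \<i> * ex i)"
proof -
  obtain q v where qv: "q \<in> cspace 3" "v \<in> cspace 3"
    and disc: "\<And>z j. cmod z \<le> 1 \<Longrightarrow> j < 8 \<Longrightarrow> (\<lambda>n. q n + z * v n) \<in> dB3 j \<longleftrightarrow> j = i \<and> z = 0"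
    and g_eq: "g = (\<lambda>s n. q n + ee s * v n)"
    using g unfolding is_meridian_def by blast
  have lin: "lform j (\<lambda>n. q n + z * v n) = lform j q + z * lform j v" if "j < 8" for j z
    using that unfolding less_8 by (elim disjE) (simp_all add: algebra_simps)
  have csp: "(\<lambda>n. q n + z * v n) \<in> cspace 3" for z using qv by (simp add: cspace_def)
  have zero: "lform j q + z * lform j v = 0 \<longleftrightarrow> j = i \<and> z = 0" if "cmod z \<le> 1" "j < 8" for z j
    using disc[OF that] csp[of z] lin[OF that(2)] by (simp add: dB3_def)
  have gX: "g s \<in> dX" for s
    unfolding dX_iff g_eq using csp lin zero[of "ee s"] by simp
  have "continuous_on {0..1} g"
    unfolding g_eq by (rule continuous_on_coordinatewise_then_product) (intro continuous_intros)
  then have "path_in dX g" using gX by (auto simp: path_in_iff)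
  from tr_LC[OF this] have tr: "tr g 0 1 (L g) (C g)" .
  have qi: "lform i q = 0" "lform i v \<noteq> 0" using zero[of 0 i] zero[of 1 i] i by auto
  have small: "cmod (lform j v) < cmod (lform j q)" if j: "j < 8" "j \<noteq> i" for j
  proof (rule ccontr)
    assume n: "\<not> cmod (lform j v) < cmod (lform j q)"
    have q0: "lform j q \<noteq> 0" using zero[of 0 j] j by auto
    then have v0: "lform j v \<noteq> 0" using n by auto
    have "cmod (- lform j q / lform j v) \<le> 1" using n v0 by (simp add: norm_divide divide_le_eq)
    from zero[OF this j(1)] show False using v0 j(2) by simp
  qed
  define \<theta> where "\<theta> j s = (if j = i then Ln (lform i v) + 2 * of_real pi * \<i> * of_real s
     else Ln (lform j q) + Ln (1 + ee s * (lform j v / lform j q)))" for j :: nat and s :: real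
  have re: "0 < Re (1 + ee s * (lform j v / lform j q))" if "j < 8" "j \<noteq> i" for j s
  proof -
    have "cmod (ee s * (lform j v / lform j q)) < 1"
      using small[OF that] by (simp add: norm_mult norm_divide divide_less_eq)
    then show ?thesis using abs_Re_le_cmod[of "ee s * (lform j v / lform j q)"] by simp
  qed
  have re_nz: "1 + ee s * (lform j v / lform j q) \<noteq> 0" if "j < 8" "j \<noteq> i" for j s
    using re[OF that, of s] by (metis less_irrefl zero_complex.sel(1))
  have "L g = exp (\<Sum>j<8. ex j * (\<theta> j 1 - \<theta> j 0))"
  proof (rule tr_exp[OF tr _ i, where B = "\<lambda>j. Im (Ln (lform j q))" and b = "Ln (lform i v)"])
    fix j :: nat and s :: real assume j: "j < 8"
    show "lform j (g s) = exp (\<theta> j s)"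
    proof (cases "j = i")
      case True
      then show ?thesis unfolding g_eq lin[OF j] using qi by (simp add: \<theta>_def exp_add)
    next
      case False
      then have "lform j q \<noteq> 0" "1 + ee s * (lform j v / lform j q) \<noteq> 0"
        using zero[of 0 j] j re_nz[OF j False] by auto
      then show ?thesis unfolding g_eq lin[OF j] using False by (simp add: \<theta>_def exp_add field_simps)
    qed
  next
    fix j :: nat and s :: real assume j: "j < 8" "j \<noteq> i"
    show "\<bar>Im (\<theta> j s) - Im (Ln (lform j q))\<bar> < pi / 2"
      using j(2) Re_Ln_pos_lt[OF re_nz[OF j], of s] re[OF j, of s] by (simp add: \<theta>_def)
  qed (simp add: \<theta>_def)
  also have "(\<Sum>j<8. ex j * (\<theta> j 1 - \<theta> j 0)) = (\<Sum>j<8. if j = i then 2 * of_real pi * \<i> * ex i else 0)"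
    by (intro sum.cong refl) (simp add: \<theta>_def)
  also have "\<dots> = 2 * of_real pi * \<i> * ex i" using i by (simp add: sum.delta)
  finally show ?thesis .
qed

lemma tr_no_crossing:
  assumes "tr p u v l c"
    and "(\<forall>s\<in>{u..v}. Re (pmap (p s)) > 0) \<or> (\<forall>s\<in>{u..v}. Im (pmap (p s)) > 0) \<or> (\<forall>s\<in>{u..v}. Im (pmap (p s)) < 0)"
  shows "c = 0"
  using assms
proof (induction rule: tr.induct)
  case (small u v U)
  have uv: "u \<in> {u..v}" "v \<in> {u..v}" using small.hyps(1) by auto
  from small.prems show ?case
  proof (elim disjE)
    assume "\<forall>s\<in>{u..v}. Re (pmap (p s)) > 0"
    then have "\<not> Re (pmap (p u)) < 0" using uv by fastforce
    then show ?thesis by (simp add: k_def)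
  next
    assume "\<forall>s\<in>{u..v}. Im (pmap (p s)) > 0"
    then have "side (p u) = 1" "side (p v) = 1" using uv by (auto simp: side_def intro: less_imp_le)
    then show ?thesis by (simp add: k_def)
  next
    assume "\<forall>s\<in>{u..v}. Im (pmap (p s)) < 0"
    then have "side (p u) = 0" "side (p v) = 0" using uv by (auto simp: side_def not_le)
    then show ?thesis by (simp add: k_def)
  qed
next
  case (join u v l c w l' c')
  have le: "u \<le> v" "v \<le> w" using join.hyps tr_le by auto
  have sub: "{u..v} \<subseteq> {u..w}" "{v..w} \<subseteq> {u..w}" using le by auto
  have "c = 0" by (rule join.IH(1)) (use join.prems sub in blast)
  moreover have "c' = 0" by (rule join.IH(2)) (use join.prems sub in blast)
  ultimately show ?case by simp
qed

text \<open>While \<open>Re (pmap (p s)) < 0\<close>, all crossings telescope and only the sides of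
  the two end points count.\<close>

lemma tr_crossing:
  assumes "tr p u v l c" "\<forall>s\<in>{u..v}. Re (pmap (p s)) < 0"
  shows "ph (p u) = l * ph (p v) \<and> c = ph (p u) * (side (p u) - side (p v))"
  using assms
proof (induction rule: tr.induct)
  case (small u v U)
  have re: "Re (pmap (p u)) < 0" "Re (pmap (p v)) < 0" using small by auto
  have "p u \<in> U" "p v \<in> U" using small.hyps by auto
  from ph_flat[OF small.hyps(2) this re] show ?case using re by (simp add: k_def)
next
  case (join u v l c w l' c')
  have le: "u \<le> v" "v \<le> w" using join.hyps tr_le by auto
  have "ph (p u) = l * ph (p v) \<and> c = ph (p u) * (side (p u) - side (p v))"
    by (rule join.IH(1)) (use join.prems le in auto)
  moreover have "ph (p v) = l' * ph (p w) \<and> c' = ph (p v) * (side (p v) - side (p w))"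
    by (rule join.IH(2)) (use join.prems le in auto)
  moreover have "l * (ph (p v) * (side (p v) - side (p w))) = (l * ph (p v)) * (side (p v) - side (p w))"
    by (rule mult.assoc[symmetric])
  ultimately show ?case by (simp add: right_diff_distrib)
qed

subsection \<open>The cocycle is not a coboundary\<close>

text \<open>The computation takes place on the line \<open>x = 2\<close>, \<open>z = 1\<close>,
  which meets the planes at \<open>y = 0\<close>, \<open>1\<close>, \<open>-1\<close>,
  \<open>2\<close>, \<open>-2\<close>.\<close>

abbreviation slice :: "complex \<Rightarrow> nat \<Rightarrow> complex" where "slice y \<equiv> point 2 y 1"

lemma slice_in_dX: "slice y \<in> dX \<longleftrightarrow> y \<notin> {0, 1, -1, 2, -2}"
proof -
  have "slice y \<in> dX \<longleftrightarrow> y \<noteq> 0 \<and> 2 - y \<noteq> 0 \<and> 2 + y \<noteq> 0 \<and> y - 1 \<noteq> 0 \<and> y + 1 \<noteq> 0"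
    unfolding dX_iff less_8 by (auto simp: point_cspace)
  then show ?thesis by (auto simp: eq_neg_iff_add_eq_0 add.commute)
qed

lemma pmap_slice: "pmap (slice y) = 3 * y\<^sup>2 / (4 - y\<^sup>2)"
  by (simp add: pmap_def power2_eq_square algebra_simps)

text \<open>The real part is positive inside the lemniscate \<open>cmod (y^2 - 2) < 2\<close>; the
  sign of the imaginary part depends only on the quadrant of \<open>y\<close>.\<close>

lemma sign_pmap_slice:
  assumes "slice y \<in> dX"
  shows "Im (pmap (slice y)) > 0 \<longleftrightarrow> Re y * Im y > 0" "Im (pmap (slice y)) < 0 \<longleftrightarrow> Re y * Im y < 0"
    "Re (pmap (slice y)) > 0 \<longleftrightarrow> 4 * ((Re y)\<^sup>2 - (Im y)\<^sup>2) > ((Re y)\<^sup>2 + (Im y)\<^sup>2)\<^sup>2"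
    "Re (pmap (slice y)) < 0 \<longleftrightarrow> 4 * ((Re y)\<^sup>2 - (Im y)\<^sup>2) < ((Re y)\<^sup>2 + (Im y)\<^sup>2)\<^sup>2"
proof -
  have im: "Im (3 * y\<^sup>2 * cnj (4 - y\<^sup>2)) = 24 * (Re y * Im y)"
    and re: "Re (3 * y\<^sup>2 * cnj (4 - y\<^sup>2)) = 3 * (4 * ((Re y)\<^sup>2 - (Im y)\<^sup>2) - ((Re y)\<^sup>2 + (Im y)\<^sup>2)\<^sup>2)"
    by (simp_all add: power2_eq_square algebra_simps)
  have cmp: "0 < 24 * c \<longleftrightarrow> c > 0" "24 * c < 0 \<longleftrightarrow> c < 0" "0 < 3 * (c - d) \<longleftrightarrow> c > d" "3 * (c - d) < 0 \<longleftrightarrow> c < d"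
    for c d :: real by auto
  show "Im (pmap (slice y)) > 0 \<longleftrightarrow> Re y * Im y > 0" "Im (pmap (slice y)) < 0 \<longleftrightarrow> Re y * Im y < 0"
    "Re (pmap (slice y)) > 0 \<longleftrightarrow> 4 * ((Re y)\<^sup>2 - (Im y)\<^sup>2) > ((Re y)\<^sup>2 + (Im y)\<^sup>2)\<^sup>2"
    "Re (pmap (slice y)) < 0 \<longleftrightarrow> 4 * ((Re y)\<^sup>2 - (Im y)\<^sup>2) < ((Re y)\<^sup>2 + (Im y)\<^sup>2)\<^sup>2"
    unfolding pmap_slice Im_complex_div_gt_0 Im_complex_div_lt_0 Re_complex_div_gt_0 Re_complex_div_lt_0 im re cmp
    by (rule refl)+
qed

lemma path_in_slice:
  assumes "path_in S q" "\<And>y. y \<in> S \<Longrightarrow> y \<notin> {0, 1, -1, 2, -2}"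
  shows "path_in dX (slice \<circ> q)"
proof (rule path_in_compose[OF assms(1)])
  have "continuous_on S (\<lambda>y j. point 2 y 1 j)"
  proof (rule continuous_on_coordinatewise_then_product)
    fix j :: nat
    show "continuous_on S (\<lambda>y. point 2 y 1 j)"
      by (cases "j = 1"; cases "j = 0") (auto simp: point_def intro!: continuous_intros)
  qed
  then show "continuous_on S slice" by simp
  show "slice ` S \<subseteq> dX" using assms(2) slice_in_dX by auto
qed

text \<open>A circle around \<open>y = 1\<close> inside one lobe of the lemniscate: it is a meridian
  of the plane \<open>y = z\<close> that avoids the cut, so a flat section vanishes at its
  start.\<close>

lemma loop_slice:
  assumes e: "e = 1 \<or> e = (-1::real)"
  defines "lp \<equiv> \<lambda>s. slice (1 + ee s * (\<i> * of_real (e / 2)))"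
  shows "path_in dX lp" "L lp = -1" "C lp = 0"
proof -
  let ?S = "sphere 1 (1/2) :: complex set"
  have S: "y \<notin> {0, 1, -1, 2, -2}" if "y \<in> ?S" for y using that by (auto simp: dist_norm norm_minus_commute)
  have on: "1 + ee s * (\<i> * of_real (e / 2)) \<in> ?S" for s
    using e by (auto simp: dist_norm norm_mult)
  have "path_in ?S (\<lambda>s. 1 + ee s * (\<i> * of_real (e / 2)))"
    unfolding path_in_iff using on by (auto intro!: continuous_intros)
  from path_in_slice[OF this S] show p: "path_in dX lp" by (simp add: lp_def comp_def)
  have "is_meridian 3 8 dB3 6 lp"
    unfolding is_meridian_def
  proof (rule bexI[of _ "slice 1"], rule bexI[of _ "point 0 (\<i> * of_real (e / 2)) 0"], intro conjI allI impI)
    fix z :: complex and j :: nat assume z: "cmod z \<le> 1" and j: "j < 8"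
    let ?y = "1 + z * (\<i> * of_real (e / 2))"
    have "(\<lambda>n. slice 1 n + z * point 0 (\<i> * of_real (e / 2)) 0 n) = slice ?y"
      by (auto simp: point_def fun_eq_iff)
    moreover have "cmod (?y - 1) < 1" using z e by (auto simp: norm_mult)
    moreover have "lform j (slice y) = 0 \<longleftrightarrow> j = 6 \<and> y = 1" if "cmod (y - 1) < 1" for y
    proof -
      have "y \<noteq> 0" "y \<noteq> 2" "y \<noteq> -2" "y \<noteq> -1" using that by auto
      then show ?thesis
        using j unfolding less_8 by (elim disjE) (auto simp: add_eq_0_iff minus_equation_iff)
    qed
    moreover have "?y = 1 \<longleftrightarrow> z = 0" using e by auto
    ultimately show "(\<lambda>n. slice 1 n + z * point 0 (\<i> * of_real (e / 2)) 0 n) \<in> dB3 j \<longleftrightarrow> j = 6 \<and> z = 0"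
      by (simp add: dB3_def point_cspace)
  next
    show "lp = (\<lambda>s n. slice 1 n + ee s * point 0 (\<i> * of_real (e / 2)) 0 n)"
      by (auto simp: lp_def point_def fun_eq_iff)
  qed (rule point_cspace)+
  from L_meridian[OF this] show "L lp = -1"
    by (simp add: ex_def exp_pi_i)
  have "Re (pmap (lp s)) > 0" for s
  proof -
    let ?y = "1 + ee s * (\<i> * of_real (e / 2))"
    have X: "slice ?y \<in> dX" using S[OF on] slice_in_dX by blast
    define r where "r = Re ?y - 1"
    have "cmod (?y - 1) = 1 / 2" using e by (auto simp: norm_mult)
    then have "(cmod (?y - 1))\<^sup>2 = 1 / 4" by (simp add: power2_eq_square)
    then have im: "(Im ?y)\<^sup>2 = 1 / 4 - r\<^sup>2" unfolding cmod_power2 by (simp add: r_def)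
    have re: "Re ?y = 1 + r" by (simp add: r_def)
    \<comment> \<open>On the circle \<open>(Im y)^2 = 1/4 - r^2\<close>, so the condition is
      quadratic in \<open>r\<close>; completing the square shows that it holds.\<close>
    have "4 * ((1 + r)\<^sup>2 - (1 / 4 - r\<^sup>2)) - ((1 + r)\<^sup>2 + (1 / 4 - r\<^sup>2))\<^sup>2 = (2 * r + 3 / 4)\<^sup>2 + 7 / 8"
      by (simp add: power2_eq_square algebra_simps)
    then have "4 * ((1 + r)\<^sup>2 - (1 / 4 - r\<^sup>2)) > ((1 + r)\<^sup>2 + (1 / 4 - r\<^sup>2))\<^sup>2"
      using zero_le_power2[of "2 * r + 3 / 4"] by linarith
    then show ?thesis
      unfolding lp_def using sign_pmap_slice(3)[OF X] unfolding im re by blast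
  qed
  then show "C lp = 0" using tr_no_crossing[OF tr_LC[OF p]] by blast
qed

text \<open>The segment from \<open>3 + i e\<close> to \<open>1 + i e / 2\<close> stays in one
  quadrant and hence on one side of the cut.\<close>

lemma approach_slice:
  assumes e: "e = 1 \<or> e = (-1::real)"
  defines "q \<equiv> slice \<circ> linepath (Complex 3 e) (Complex 1 (e / 2))"
  shows "path_in dX q" "C q = 0"
proof -
  let ?S = "{y. 0 < Re y} \<inter> {y. 0 < e * Im y}"
  have conv: "convex ?S"
    using e by (intro convex_Int convex_halfspace_Re_gt) (auto simp: convex_halfspace_Im_gt convex_halfspace_Im_lt)
  have in_S: "path_in ?S (linepath (Complex 3 e) (Complex 1 (e / 2)))"
    using e by (intro path_in_linepath[OF conv]) auto
  have S: "y \<notin> {0, 1, -1, 2, -2}" if "y \<in> ?S" for y using that by auto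
  show p: "path_in dX q" unfolding q_def by (rule path_in_slice[OF in_S S])
  have sgn: "(e = 1 \<longrightarrow> Im (pmap (q s)) > 0) \<and> (e = -1 \<longrightarrow> Im (pmap (q s)) < 0)" if "s \<in> {0..1}" for s
  proof -
    let ?y = "linepath (Complex 3 e) (Complex 1 (e / 2)) s"
    have y: "?y \<in> ?S" using in_S that by (auto simp: path_in_iff)
    have "slice ?y \<in> dX" using S[OF y] slice_in_dX by blast
    from sign_pmap_slice(1,2)[OF this] show ?thesis
      using y by (auto simp: q_def zero_less_mult_iff mult_less_0_iff)
  qed
  show "C q = 0" using tr_no_crossing[OF tr_LC[OF p]] sgn e by blast
qed

text \<open>The vertical segment at \<open>Re y = 3\<close> lies outside the lemniscate and passes
  from the lower to the upper side of the cut.\<close>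

lemma crossing_slice:
  defines "q \<equiv> slice \<circ> linepath (Complex 3 (-1)) (Complex 3 1)"
  shows "path_in dX q" "C q \<noteq> 0"
proof -
  let ?S = "{y. 3 \<le> Re y \<and> Re y \<le> 3 \<and> -1 \<le> Im y \<and> Im y \<le> 1}"
  have conv: "convex ?S"
  proof -
    have "?S = cbox (Complex 3 (-1)) (Complex 3 1)" by (auto simp: in_cbox_complex_iff)
    then show ?thesis by simp
  qed
  have in_S: "path_in ?S (linepath (Complex 3 (-1)) (Complex 3 1))"
    by (intro path_in_linepath[OF conv]) auto
  have S: "y \<notin> {0, 1, -1, 2, -2}" if "y \<in> ?S" for y using that by auto
  show p: "path_in dX q" unfolding q_def by (rule path_in_slice[OF in_S S])
  have neg: "Re (pmap (slice y)) < 0" if y: "y \<in> ?S" for y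
  proof -
    have "slice y \<in> dX" using S[OF y] slice_in_dX by blast
    moreover have "4 * (3\<^sup>2 - i\<^sup>2) < (3\<^sup>2 + i\<^sup>2)\<^sup>2" for i :: real
    proof -
      have "(3\<^sup>2 + i\<^sup>2)\<^sup>2 - 4 * (3\<^sup>2 - i\<^sup>2) = 45 + 22 * i\<^sup>2 + (i\<^sup>2)\<^sup>2" by (simp add: power2_eq_square algebra_simps)
      then show ?thesis using zero_le_power2[of i] zero_le_power2[of "i\<^sup>2"] by linarith
    qed
    moreover have "Re y = 3" using y by auto
    ultimately show ?thesis using sign_pmap_slice(4) by metis
  qed
  have q01: "q 0 = slice (Complex 3 (-1))" "q 1 = slice (Complex 3 1)"
    by (simp_all add: q_def linepath_def)
  have in01: "Complex 3 (-1) \<in> ?S" "Complex 3 1 \<in> ?S" by auto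
  have X: "slice (Complex 3 (-1)) \<in> dX" "slice (Complex 3 1) \<in> dX"
    using S[OF in01(1)] S[OF in01(2)] slice_in_dX by blast+
  have "C q = ph (q 0) * (side (q 0) - side (q 1))"
    using tr_crossing[OF tr_LC[OF p]] neg in_S by (auto simp: path_in_iff q_def)
  moreover have "side (q 0) = 0" "side (q 1) = 1"
    unfolding q01 using sign_pmap_slice(2)[OF X(1)] sign_pmap_slice(1)[OF X(2)] by (auto simp: side_def)
  moreover have "ph (q 0) \<noteq> 0" unfolding q01 by (simp add: ph_def)
  ultimately show "C q \<noteq> 0" by simp
qed

text \<open>Vanishing at the starts of both loops is transported to \<open>3 + i\<close> and
  \<open>3 - i\<close>; the segment between them then gives \<open>b * C q = 0\<close> with
  \<open>C q \<noteq> 0\<close>.\<close>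

lemma not_coboundary:
  assumes s: "\<forall>p. path_in dX p \<longrightarrow> s (pathstart p) = b * C p + L p * s (pathfinish p)"
  shows "b = 0"
proof -
  have zero: "s (slice (Complex 3 e)) = 0" if e: "e = 1 \<or> e = (-1::real)" for e
  proof -
    let ?lp = "\<lambda>s. slice (1 + ee s * (\<i> * of_real (e / 2)))"
    let ?q = "slice \<circ> linepath (Complex 3 e) (Complex 1 (e / 2))"
    have pt: "1 + \<i> * of_real (e / 2) = Complex 1 (e / 2)" by (simp add: complex_eq_iff)
    have "s (slice (Complex 1 (e / 2))) = - s (slice (Complex 1 (e / 2)))"
      using s[rule_format, OF loop_slice(1)[OF e]] loop_slice(2,3)[OF e] pt
      by (simp add: pathstart_def pathfinish_def)
    then have "s (slice (Complex 1 (e / 2))) = 0" by simp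
    then show ?thesis
      using s[rule_format, OF approach_slice(1)[OF e]] approach_slice(2)[OF e]
      by (simp add: pathstart_compose pathfinish_compose)
  qed
  show ?thesis
    using s[rule_format, OF crossing_slice(1)] crossing_slice(2) zero[of 1] zero[of "-1"]
    by (simp add: pathstart_compose pathfinish_compose)
qed

lemma cohomology: "cohomology_dim_ge dX L 1 1"
  unfolding cohomology_dim_ge_def
proof (intro exI[of _ "\<lambda>_ f. C (leading_edge f)"] conjI allI impI)
  show "(\<lambda>f. C (leading_edge f)) \<in> twisted_cocycles dX L 1" by (rule cocycle_of_system)
  fix b :: "nat \<Rightarrow> complex" and i :: nat
  assume "(\<lambda>f. \<Sum>i<1. b i * C (leading_edge f)) \<in> twisted_coboundaries dX L 1" and i: "i < 1"
  then have "(\<lambda>f. b 0 * C (leading_edge f)) \<in> twisted_coboundaries dX L 1" by simp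
  from coboundary_of_system[OF this] show "b i = 0" using not_coboundary i by auto
qed

lemma local_system: "rank_one_local_system dX L"
  unfolding rank_one_local_system_def using L_nonzero L_homotopic L_join by (auto simp: path_in_def)

end

section \<open>The component\<close>

definition tpoint :: "complex \<Rightarrow> nat \<Rightarrow> complex" where
  "tpoint \<tau> i = (if i < 8 then [\<tau> ^ 2, 1 / \<tau> ^ 2, - 1 / \<tau>, - 1 / \<tau>, \<tau>, \<tau>, -1, -1] ! i else 0)"

definition translated_curve :: "(nat \<Rightarrow> complex) set" where
  "translated_curve = tpoint ` (- {0})"

lemma tpoint_simps [simp]:
  "tpoint \<tau> 0 = \<tau> ^ 2" "tpoint \<tau> (Suc 0) = 1 / \<tau> ^ 2" "tpoint \<tau> 2 = - 1 / \<tau>" "tpoint \<tau> 3 = - 1 / \<tau>"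
  "tpoint \<tau> 4 = \<tau>" "tpoint \<tau> 5 = \<tau>" "tpoint \<tau> 6 = -1" "tpoint \<tau> 7 = -1"
  by (simp_all add: tpoint_def)

lemma tpoint_torus: "\<tau> \<noteq> 0 \<Longrightarrow> tpoint \<tau> \<in> torus 8"
  unfolding torus_def less_8 by (auto simp: tpoint_def)

lemma translated_curve_subset_variety: "translated_curve \<subseteq> characteristic_variety 3 8 dB3 1"
proof
  fix t assume "t \<in> translated_curve"
  then obtain \<tau> where \<tau>: "\<tau> \<noteq> 0" "t = tpoint \<tau>" by (auto simp: translated_curve_def)
  define a where "a = Ln \<tau> / (2 * of_real pi * \<i>)"
  interpret translated_torus a .
  have a: "exp (2 * of_real pi * \<i> * a) = \<tau>" using \<tau>(1) by (simp add: a_def)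
  have "exp (2 * of_real pi * \<i> * ex i) = tpoint \<tau> i" if i: "i < 8" for i
  proof -
    have e1: "exp (2 * of_real pi * \<i> * (2 * a)) = \<tau> ^ 2"
      unfolding a[symmetric] exp_double[symmetric] by (simp add: mult_ac)
    have e2: "exp (2 * of_real pi * \<i> * (- 2 * a)) = 1 / \<tau> ^ 2"
      unfolding e1[symmetric] by (simp add: exp_minus field_simps)
    have half: "exp (2 * of_real pi * \<i> * (1 / 2)) = -1" by (simp add: exp_pi_i)
    have "2 * of_real pi * \<i> * (- a - 1 / 2) = - (2 * of_real pi * \<i> * a) - 2 * of_real pi * \<i> * (1 / 2)"
      by (simp add: algebra_simps)
    then have e3: "exp (2 * of_real pi * \<i> * (- a - 1 / 2)) = - 1 / \<tau>"
      by (simp only: exp_diff exp_minus a half) (simp add: field_simps)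
    show ?thesis
      using i unfolding less_8
      by (elim disjE) (simp_all only: One_nat_def ex_simps tpoint_simps e1 e2 e3 a half)
  qed
  then have "arrangement_local_system 3 8 dB3 t L"
    unfolding arrangement_local_system_def using local_system L_meridian \<tau>(2) by auto
  then show "t \<in> characteristic_variety 3 8 dB3 1"
    unfolding characteristic_variety_def using tpoint_torus[OF \<tau>(1)] \<tau>(2) cohomology by blast
qed

lemma variety_relations:
  assumes t: "t \<in> characteristic_variety 3 8 dB3 1" and ne: "\<forall>i<8. t i \<noteq> 1"
  shows "t \<in> translated_curve"
proof -
  obtain L where T: "t \<in> torus 8" and L: "arrangement_local_system 3 8 dB3 t L"
    and dim: "cohomology_dim_ge (complement 3 8 dB3) L 1 1"
    using t unfolding characteristic_variety_def by blast
  obtain c where c: "\<forall>i<1. c i \<in> twisted_cocycles (complement 3 8 dB3) L 1"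
    and indep: "\<forall>a :: nat \<Rightarrow> complex. (\<lambda>f. \<Sum>i<1. a i * c i f) \<in> twisted_coboundaries (complement 3 8 dB3) L 1
       \<longrightarrow> (\<forall>i<1. a i = 0)"
    using dim unfolding cohomology_dim_ge_def by blast
  have "c 0 \<notin> twisted_coboundaries (complement 3 8 dB3) L 1"
    using indep[rule_format, of "\<lambda>_. 1" 0] by auto
  then interpret nontrivial_cocycle t L "c 0"
    by unfold_locales (use L c ne in auto)
  define \<tau> where "\<tau> = t 4"
  have \<tau>: "\<tau> \<noteq> 0" using T by (simp add: torus_def \<tau>_def)
  have "t i = tpoint \<tau> i" for i
  proof (cases "i < 8")
    case True
    have "t 1 = 1 / \<tau> ^ 2" "t 2 = - 1 / \<tau>" "t 3 = - 1 / \<tau>"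
      using relations(2-4) \<tau> unfolding \<tau>_def by (simp_all only: nonzero_eq_divide_eq power_not_zero not_False_eq_True)
    then show ?thesis
      using True relations(1,5-7) unfolding less_8 by (elim disjE) (simp_all add: \<tau>_def)
  next
    case False
    then show ?thesis using T by (simp add: torus_def tpoint_def)
  qed
  then show ?thesis using \<tau> by (auto simp: translated_curve_def)
qed

section \<open>Zariski geometry of the curve\<close>

lemma laurent_diff:
  assumes "laurent_polynomial_fun n f" "laurent_polynomial_fun n g"
  shows "laurent_polynomial_fun n (\<lambda>t. f t - g t)"
proof -
  have "laurent_polynomial_fun n (\<lambda>t. f t + (-1) * g t)"
    by (intro laurent_polynomial_fun.intros assms)
  then show ?thesis by simp
qed

lemmas laurent_intros = laurent_polynomial_fun.intros laurent_diff

lemma translated_curve_closed: "zariski_closed 8 translated_curve"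
proof -
  let ?F = "{\<lambda>t. t 6 - (-1), \<lambda>t. t 7 - (-1), \<lambda>t. t 5 - t 4, \<lambda>t. t 2 * t 4 - (-1), \<lambda>t. t 3 * t 4 - (-1),
     \<lambda>t. t 0 - t 4 * t 4, \<lambda>t. t 1 * (t 4 * t 4) - (1::complex)} :: ((nat \<Rightarrow> complex) \<Rightarrow> complex) set"
  have "\<forall>f\<in>?F. laurent_polynomial_fun 8 f"
    by (auto intro!: laurent_intros(1-2,4-6))
  moreover have "translated_curve = {t \<in> torus 8. \<forall>f\<in>?F. f t = 0}"
  proof (intro equalityI subsetI)
    fix t assume "t \<in> translated_curve"
    then show "t \<in> {t \<in> torus 8. \<forall>f\<in>?F. f t = 0}"
      using tpoint_torus by (auto simp: translated_curve_def power2_eq_square)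
  next
    fix t assume t: "t \<in> {t \<in> torus 8. \<forall>f\<in>?F. f t = 0}"
    then have T: "t \<in> torus 8" by simp
    have t4: "t 4 \<noteq> 0" using T by (simp add: torus_def)
    have "t i = tpoint (t 4) i" for i
    proof (cases "i < 8")
      case True
      have rel: "t 1 * t 4 ^ 2 = 1" "t 2 * t 4 = -1" "t 3 * t 4 = -1"
        "t 0 = t 4 ^ 2" "t 5 = t 4" "t 6 = -1" "t 7 = -1"
        using t by (simp_all add: power2_eq_square del: diff_minus_eq_add)
      then have "t 1 = 1 / t 4 ^ 2" "t 2 = - 1 / t 4" "t 3 = - 1 / t 4"
        using t4 by (simp_all only: nonzero_eq_divide_eq power_not_zero not_False_eq_True)
      then show ?thesis
        using True rel(4-7) unfolding less_8 by (elim disjE) simp_all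
    next
      case False
      then show ?thesis using T by (simp add: torus_def tpoint_def)
    qed
    then have "t = tpoint (t 4)" by blast
    then show "t \<in> translated_curve" using t4 unfolding translated_curve_def by blast
  qed
  ultimately show ?thesis unfolding zariski_closed_def by blast
qed

text \<open>Restricted to the curve, coordinates and their inverses have poles of order at most 2 in
  \<open>\<tau>\<close>; clearing denominators leaves polynomials, which have finitely many
  roots.\<close>

lemma laurent_on_translated_curve:
  assumes "laurent_polynomial_fun 8 f"
  shows "\<exists>N p. \<forall>\<tau>. \<tau> \<noteq> 0 \<longrightarrow> \<tau> ^ N * f (tpoint \<tau>) = poly p \<tau>"
  using assms
proof (induction rule: laurent_polynomial_fun.induct)
  case (const a)
  have "\<tau> ^ 0 * a = poly [:a:] \<tau>" for \<tau> by simp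
  then show ?case by blast
next
  case (coord i)
  have "\<exists>p. \<forall>\<tau>. \<tau> \<noteq> 0 \<longrightarrow> \<tau> ^ 2 * tpoint \<tau> i = poly p \<tau>"
  proof (intro exI[of _ "[monom 1 4, 1, monom (-1) 1, monom (-1) 1, monom 1 3, monom 1 3, monom (-1) 2, monom (-1) 2] ! i"]
      allI impI)
    fix \<tau> :: complex assume "\<tau> \<noteq> 0"
    then show "\<tau> ^ 2 * tpoint \<tau> i = poly ([monom 1 4, 1, monom (-1) 1, monom (-1) 1, monom 1 3, monom 1 3, monom (-1) 2, monom (-1) 2] ! i) \<tau>"
      using coord unfolding less_8
      by (elim disjE) (simp_all add: poly_monom power2_eq_square power3_eq_cube power4_eq_xxxx)
  qed
  then show ?case by blast
next
  case (inverse_coord i)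
  have "\<exists>p. \<forall>\<tau>. \<tau> \<noteq> 0 \<longrightarrow> \<tau> ^ 2 * inverse (tpoint \<tau> i) = poly p \<tau>"
  proof (intro exI[of _ "[1, monom 1 4, monom (-1) 3, monom (-1) 3, monom 1 1, monom 1 1, monom (-1) 2, monom (-1) 2] ! i"]
      allI impI)
    fix \<tau> :: complex assume "\<tau> \<noteq> 0"
    then show "\<tau> ^ 2 * inverse (tpoint \<tau> i) = poly ([1, monom 1 4, monom (-1) 3, monom (-1) 3, monom 1 1, monom 1 1, monom (-1) 2, monom (-1) 2] ! i) \<tau>"
      using inverse_coord unfolding less_8
      by (elim disjE) (simp_all add: poly_monom power2_eq_square power3_eq_cube power4_eq_xxxx field_simps)
  qed
  then show ?case by blast
next
  case (add f g)
  then obtain N p M q where "\<forall>\<tau>. \<tau> \<noteq> 0 \<longrightarrow> \<tau> ^ N * f (tpoint \<tau>) = poly p \<tau>"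
    "\<forall>\<tau>. \<tau> \<noteq> 0 \<longrightarrow> \<tau> ^ M * g (tpoint \<tau>) = poly q \<tau>" by blast
  then have "\<forall>\<tau>. \<tau> \<noteq> 0 \<longrightarrow> \<tau> ^ (N + M) * (f (tpoint \<tau>) + g (tpoint \<tau>)) = poly (monom 1 M * p + monom 1 N * q) \<tau>"
    by (auto simp: poly_monom power_add algebra_simps)
  then show ?case by blast
next
  case (mult f g)
  then obtain N p M q where pq: "\<forall>\<tau>. \<tau> \<noteq> 0 \<longrightarrow> \<tau> ^ N * f (tpoint \<tau>) = poly p \<tau>"
    "\<forall>\<tau>. \<tau> \<noteq> 0 \<longrightarrow> \<tau> ^ M * g (tpoint \<tau>) = poly q \<tau>" by blast
  have "\<tau> ^ (N + M) * (f (tpoint \<tau>) * g (tpoint \<tau>)) = poly (p * q) \<tau>" if "\<tau> \<noteq> 0" for \<tau>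
  proof -
    have "\<tau> ^ (N + M) * (f (tpoint \<tau>) * g (tpoint \<tau>)) = (\<tau> ^ N * f (tpoint \<tau>)) * (\<tau> ^ M * g (tpoint \<tau>))"
      by (simp only: power_add ac_simps)
    then show ?thesis using pq that by simp
  qed
  then show ?case by blast
qed

lemma translated_curve_irreducible: "zariski_irreducible 8 translated_curve"
  unfolding zariski_irreducible_def
proof (intro conjI allI impI)
  show "translated_curve \<subseteq> torus 8" using tpoint_torus by (auto simp: translated_curve_def)
  show "translated_curve \<noteq> {}" by (auto simp: translated_curve_def)
  fix Y Z assume YZ: "zariski_closed 8 Y \<and> zariski_closed 8 Z \<and> translated_curve \<subseteq> Y \<union> Z"
  have sep: "\<exists>p. p \<noteq> 0 \<and> (\<forall>\<tau>. \<tau> \<noteq> 0 \<longrightarrow> poly p \<tau> \<noteq> 0 \<longrightarrow> tpoint \<tau> \<notin> Y)"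
    if Y: "zariski_closed 8 Y" and n: "\<not> translated_curve \<subseteq> Y" for Y
  proof -
    obtain F where F: "\<forall>f\<in>F. laurent_polynomial_fun 8 f" "Y = {t \<in> torus 8. \<forall>f\<in>F. f t = 0}"
      using Y unfolding zariski_closed_def by blast
    obtain \<tau> where \<tau>: "\<tau> \<noteq> 0" "tpoint \<tau> \<notin> Y" using n by (auto simp: translated_curve_def)
    then obtain f where f: "f \<in> F" "f (tpoint \<tau>) \<noteq> 0" using F(2) tpoint_torus by blast
    obtain N p where p: "\<And>\<tau>. \<tau> \<noteq> 0 \<Longrightarrow> \<tau> ^ N * f (tpoint \<tau>) = poly p \<tau>"
      using laurent_on_translated_curve F(1) f(1) by meson
    have "poly p \<tau> \<noteq> 0" using p[OF \<tau>(1)] f(2) \<tau>(1) by auto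
    then have "p \<noteq> 0" by auto
    moreover have "tpoint \<sigma> \<notin> Y" if "\<sigma> \<noteq> 0" "poly p \<sigma> \<noteq> 0" for \<sigma>
    proof -
      have "f (tpoint \<sigma>) \<noteq> 0" using p[OF that(1)] that(2) by auto
      then show ?thesis using f(1) F(2) by blast
    qed
    ultimately show ?thesis by blast
  qed
  show "translated_curve \<subseteq> Y \<or> translated_curve \<subseteq> Z"
  proof (rule ccontr)
    assume n: "\<not> (translated_curve \<subseteq> Y \<or> translated_curve \<subseteq> Z)"
    obtain p where p: "p \<noteq> 0" "\<And>\<tau>. \<tau> \<noteq> 0 \<Longrightarrow> poly p \<tau> \<noteq> 0 \<Longrightarrow> tpoint \<tau> \<notin> Y"
      using sep[of Y] YZ n by blast
    obtain q where q: "q \<noteq> 0" "\<And>\<tau>. \<tau> \<noteq> 0 \<Longrightarrow> poly q \<tau> \<noteq> 0 \<Longrightarrow> tpoint \<tau> \<notin> Z"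
      using sep[of Z] YZ n by blast
    \<comment> \<open>The factor \<open>[:0, 1:]\<close> excludes \<open>\<tau> = 0\<close>, which
      gives no point of the curve.\<close>
    have "finite {\<tau>. poly ([:0, 1:] * p * q) \<tau> = 0}"
      using p(1) q(1) by (intro poly_roots_finite) auto
    then obtain \<tau> where "poly ([:0, 1:] * p * q) \<tau> \<noteq> 0"
      using infinite_UNIV_char_0[where 'a = complex] by (metis (mono_tags, lifting) UNIV_eq_I mem_Collect_eq)
    then have "\<tau> \<noteq> 0" "tpoint \<tau> \<notin> Y" "tpoint \<tau> \<notin> Z" using p(2) q(2) by auto
    then show False using YZ by (auto simp: translated_curve_def)
  qed
qed

lemma translated_curve_dimension: "0 < zariski_dim 8 translated_curve"
proof -
  define Z where "Z i = (if i = 0 then {tpoint 1} else translated_curve)" for i :: nat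
  have t1: "tpoint 1 \<in> translated_curve" by (auto simp: translated_curve_def)
  have "zariski_irreducible 8 {tpoint 1}"
    unfolding zariski_irreducible_def using tpoint_torus[of 1] by auto
  then have irr: "zariski_irreducible 8 (Z i)" for i
    using translated_curve_irreducible by (simp add: Z_def)
  have "zariski_closed 8 {t \<in> torus 8. \<forall>f\<in>{\<lambda>t. t 4 - 1}. f t = 0}"
    unfolding zariski_closed_def
    by (intro exI[of _ "{\<lambda>t. t 4 - (1::complex)}"]) (auto intro!: laurent_intros)
  moreover have "{tpoint 1} = translated_curve \<inter> {t \<in> torus 8. \<forall>f\<in>{\<lambda>t. t 4 - 1}. f t = 0}"
    using t1 tpoint_torus[of 1] by (auto simp: translated_curve_def)
  ultimately have "\<exists>Y. zariski_closed 8 Y \<and> {tpoint 1} = translated_curve \<inter> Y" by blast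
  then have closed: "\<exists>Y. zariski_closed 8 Y \<and> Z i = translated_curve \<inter> Y" for i
    using translated_curve_closed by (auto simp: Z_def)
  have "tpoint 2 4 \<noteq> tpoint 1 4" by simp
  then have "tpoint 2 \<noteq> tpoint 1" by metis
  moreover have "tpoint 2 \<in> translated_curve" by (auto simp: translated_curve_def)
  ultimately have "Z i \<subset> Z (Suc i)" if "i < 1" for i using that t1 by (auto simp: Z_def)
  then have "enat 1 \<in> {enat k | k. \<exists>Z :: nat \<Rightarrow> (nat \<Rightarrow> complex) set.
     (\<forall>i\<le>k. zariski_irreducible 8 (Z i) \<and> (\<exists>Y. zariski_closed 8 Y \<and> Z i = translated_curve \<inter> Y)) \<and>
     (\<forall>i<k. Z i \<subset> Z (Suc i))}" using irr closed by blast
  then have "enat 1 \<le> zariski_dim 8 translated_curve"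
    unfolding zariski_dim_def by (rule Sup_upper)
  then show ?thesis by (metis enat_1 less_le_trans zero_less_one)
qed

text \<open>A larger irreducible \<open>D\<close> is covered by the closed locus where some
  coordinate is 1 and by the curve. The first does not contain \<open>tpoint 2\<close>, so
  \<open>D\<close> lies in the curve.\<close>

lemma translated_curve_is_component: "irreducible_component 8 (characteristic_variety 3 8 dB3 1) translated_curve"
  unfolding irreducible_component_def
proof (intro conjI allI impI translated_curve_subset_variety translated_curve_irreducible)
  fix D assume D: "D \<subseteq> characteristic_variety 3 8 dB3 1 \<and> zariski_irreducible 8 D \<and> translated_curve \<subseteq> D"
  define g where "g t = (t 0 - 1) * ((t 1 - 1) * ((t 2 - 1) * ((t 3 - 1) * ((t 4 - 1) * ((t 5 - 1) * ((t 6 - 1) * (t 7 - 1)))))))"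
    for t :: "nat \<Rightarrow> complex"
  define Y where "Y = {t \<in> torus 8. \<forall>f\<in>{g}. f t = 0}"
  have Y_iff: "t \<in> Y \<longleftrightarrow> t \<in> torus 8 \<and> g t = 0" for t
    by (simp add: Y_def)
  have factor: "laurent_polynomial_fun 8 (\<lambda>t. t i - 1)" if "i < 8" for i
    using that by (rule laurent_diff[OF laurent_polynomial_fun.coord laurent_polynomial_fun.const])
  have "laurent_polynomial_fun 8 g"
    unfolding g_def by (intro laurent_polynomial_fun.mult factor) simp_all
  then have Y: "zariski_closed 8 Y"
    unfolding zariski_closed_def Y_def by (intro exI[of _ "{g}"]) simp
  have g0: "g t = 0 \<longleftrightarrow> (\<exists>i<8. t i = 1)" for t
    unfolding less_8 g_def mult_eq_0_iff right_minus_eq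
    by (simp only: conj_disj_distribR ex_disj_distrib simp_thms)
  have "t \<in> Y \<or> t \<in> translated_curve" if "t \<in> D" for t
  proof -
    have t: "t \<in> characteristic_variety 3 8 dB3 1" using D that by blast
    then have T: "t \<in> torus 8" by (simp add: characteristic_variety_def)
    show ?thesis
    proof (cases "\<exists>i<8. t i = 1")
      case True
      then show ?thesis using T by (simp add: Y_iff g0)
    next
      case False
      then have "\<forall>i<8. t i \<noteq> 1" by simp
      from variety_relations[OF t this] show ?thesis by simp
    qed
  qed
  then have "D \<subseteq> Y \<union> translated_curve" by blast
  moreover have "\<forall>Y Z. zariski_closed 8 Y \<and> zariski_closed 8 Z \<and> D \<subseteq> Y \<union> Z \<longrightarrow> D \<subseteq> Y \<or> D \<subseteq> Z"
    using D unfolding zariski_irreducible_def by simp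
  ultimately have "D \<subseteq> Y \<or> D \<subseteq> translated_curve" using Y translated_curve_closed by metis
  moreover have "\<not> D \<subseteq> Y"
  proof
    assume "D \<subseteq> Y"
    moreover have "tpoint 2 \<in> translated_curve" by (simp add: translated_curve_def)
    ultimately have "tpoint 2 \<in> Y" using D by blast
    then have "g (tpoint 2) = 0" by (simp only: Y_iff)
    then show False by (simp add: g_def)
  qed
  ultimately show "D = translated_curve" using D by blast
qed

theorem theorem1:
  "\<exists>(l::nat) (n::nat) (H :: nat \<Rightarrow> (nat \<Rightarrow> complex) set) (C :: (nat \<Rightarrow> complex) set).
     2 \<le> l \<and> hyperplane_arrangement l n H \<and>
     irreducible_component n (characteristic_variety l n H 1) C \<and>
     0 < zariski_dim n C \<and>
     torus_one n \<notin> C"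
proof (intro exI conjI)
  show "2 \<le> (3::nat)" by simp
  show "hyperplane_arrangement 3 8 dB3" by (rule arrangement_dB3)
  show "irreducible_component 8 (characteristic_variety 3 8 dB3 1) translated_curve" by (rule translated_curve_is_component)
  show "0 < zariski_dim 8 translated_curve" by (rule translated_curve_dimension)
  show "torus_one 8 \<notin> translated_curve"
  proof
    assume "torus_one 8 \<in> translated_curve"
    then obtain \<tau> where "torus_one 8 = tpoint \<tau>" by (auto simp: translated_curve_def)
    then have "torus_one 8 6 = tpoint \<tau> 6" by simp
    then show False by (simp add: torus_one_def)
  qed
qed

end
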